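(* Let $\theta,\varphi$ be two nonconstant one-variable inner functions on the unit disk. If $M$ is a Hilbert-Schmidt submodule of $H^2(\mathbb{D}^2)$ and $M_{\theta,\varphi}=[C_{\theta,\varphi}M]$, then $$\Sigma_0^{M_{\theta,\varphi}}(0,0)=\Sigma_0^M(\theta(0),\varphi(0)),\qquad \Sigma_1^{M_{\theta,\varphi}}(0,0)=\Sigma_1^M(\theta(0),\varphi(0)).$$ Moreover, $\|C_{M_{\theta,\varphi}}\|_{H.S.}^2=\Sigma_0^M(\theta(0),\varphi(0))+\Sigma_1^M(\theta(0),\varphi(0))$, where $C_{M_{\theta,\varphi}}$ is the core operator of $M_{\theta,\varphi}$.
   Context: $\mathbb{D}$ is the open unit disk and $H^2(\mathbb{D}^2)$ the Hardy space over the bidisk. A submodule is a closed subspace of $H^2(\mathbb{D}^2)$ invariant under multiplication by $z$ and $w$. $[X]$ is the submodule generated by $X$, i.e. the norm closure of the linear span of $\mathbb{C}[z,w]\cdot X$. $C_{\theta,\varphi}f(z,w)=f(\theta(z),\varphi(w))$, a bounded operator on $H^2(\mathbb{D}^2)$. An inner function is a bounded analytic function on $\mathbb{D}$ whose boundary values have modulus 1 a.e. For a submodule $M$ and bounded analytic $\phi$ with $\phi M\subseteq M$, $R_\phi$ denotes multiplication by $\phi$ on $M$; $[A,B]=AB-BA$. $M$ is Hilbert-Schmidt if $[R_z^*,R_z][R_w^*,R_w]$ and $[R_z^*,R_w]$ are Hilbert-Schmidt operators. (If $M$ is Hilbert-Schmidt, then so is $M_{\theta,\varphi}$.) For $a\in\mathbb{D}$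 let $\varphi_a(\zeta)=\frac{a-\zeta}{1-\bar a\zeta}$. For $(a,b)\in\mathbb{D}^2$ let $P_a,Q_b,P_a',Q_b'$ be the orthogonal projections from $M$ onto $M\ominus(z-a)M$, $M\ominus(w-b)M$, $(z-a)(M\ominus(w-b)M)$, $(w-b)(M\ominus(z-a)M)$, respectively. The numerical invariant functions of a Hilbert-Schmidt submodule $M$ are $$\Sigma_0^M(a,b)=\|P_aQ_b\|_{H.S.}^2=\|[R_{\varphi_a(z)}^*,R_{\varphi_a(z)}][R_{\varphi_b(w)}^*,R_{\varphi_b(w)}]\|_{H.S.}^2,$$ $$\Sigma_1^M(a,b)=\|P_a'Q_b'\|_{H.S.}^2=\|[R_{\varphi_a(z)}^*,R_{\varphi_b(w)}]\|_{H.S.}^2 .$$ The core operator $C_M$ of a submodule $M$ is the operator that is zero on $H^2(\mathbb{D}^2)\ominus M$ and equals $I-R_zR_z^*-R_wR_w^*+R_zR_wR_z^*R_w^*$ on $M$. $\|\cdot\|_{H.S.}$ is the Hilbert-Schmidt norm.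
   Formalization: Σ_1 is taken as the commutator norm ‖[R_{φ_a(z)}^*,R_{φ_b(w)}]‖²_{H.S.}; with the stated projections P_a', Q_b' the first expression differs from it (e.g. M={f: f(0,0)=0}, b=0, a≠0) and the claim fails; φ_a(z), φ_b(w) should replace z−a, w−b there. *)

theory Defs
  imports
    "HOL-Complex_Analysis.Complex_Analysis"
    "HOL-Computational_Algebra.Polynomial"
begin

section \<open>The Hardy space over the bidisk\<close>

text \<open>
  An element of \<open>H\<^sup>2(\<D>\<^sup>2)\<close> is an analytic function
  \<open>f(z,w) = \<Sum> c(m,n) z\<^sup>m w\<^sup>n\<close> with square-summable Taylor coefficients; it is stored as
  its coefficient family \<open>c\<close> and recovered as a function by \<open>hval\<close> below.
\<close>

typedef hardy2 = "{c :: nat \<times> nat \<Rightarrow> complex. (\<lambda>p. (cmod (c p))\<^sup>2) summable_on UNIV}"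
  morphisms hcoeff Abs_hardy2
  by (rule exI[of _ "\<lambda>_. 0"]) simp

setup_lifting type_definition_hardy2

lemma hcoeff_summable: "(\<lambda>p. (cmod (hcoeff f p))\<^sup>2) summable_on UNIV"
  using hcoeff[of f] by simp

lemma square_summable_add:
  fixes c d :: "'a \<Rightarrow> complex"
  assumes "(\<lambda>p. (cmod (c p))\<^sup>2) summable_on UNIV" "(\<lambda>p. (cmod (d p))\<^sup>2) summable_on UNIV"
  shows "(\<lambda>p. (cmod (c p + d p))\<^sup>2) summable_on UNIV"
proof (rule summable_on_comparison_test)
  show "(\<lambda>p. 2 * (cmod (c p))\<^sup>2 + 2 * (cmod (d p))\<^sup>2) summable_on UNIV"
    by (intro summable_on_add summable_on_cmult_right assms)
next
  fix p
  have "(cmod (c p + d p))\<^sup>2 \<le> (cmod (c p) + cmod (d p))\<^sup>2"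
    by (intro power_mono norm_triangle_ineq) auto
  also have "\<dots> \<le> 2 * (cmod (c p))\<^sup>2 + 2 * (cmod (d p))\<^sup>2"
    using sum_squares_bound[of "cmod (c p)" "cmod (d p)"] by (simp add: power2_sum)
  finally show "(cmod (c p + d p))\<^sup>2 \<le> 2 * (cmod (c p))\<^sup>2 + 2 * (cmod (d p))\<^sup>2" .
qed auto

lemma square_summable_cmult:
  fixes c :: "'a \<Rightarrow> complex"
  assumes "(\<lambda>p. (cmod (c p))\<^sup>2) summable_on UNIV"
  shows "(\<lambda>p. (cmod (a * c p))\<^sup>2) summable_on UNIV"
  using summable_on_cmult_right[OF assms, of "(cmod a)\<^sup>2"]
  by (simp add: norm_mult power_mult_distrib)

lemma square_summable_mult:
  fixes c d :: "'a \<Rightarrow> complex"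
  assumes "(\<lambda>p. (cmod (c p))\<^sup>2) summable_on UNIV" "(\<lambda>p. (cmod (d p))\<^sup>2) summable_on UNIV"
  shows "(\<lambda>p. c p * cnj (d p)) summable_on UNIV"
proof (rule abs_summable_summable, rule summable_on_comparison_test)
  show "(\<lambda>p. (cmod (c p))\<^sup>2 + (cmod (d p))\<^sup>2) summable_on UNIV"
    by (intro summable_on_add assms)
next
  fix p
  show "norm (c p * cnj (d p)) \<le> (cmod (c p))\<^sup>2 + (cmod (d p))\<^sup>2"
    using sum_squares_bound[of "cmod (c p)" "cmod (d p)"]
      mult_nonneg_nonneg[OF norm_ge_zero[of "c p"] norm_ge_zero[of "d p"]]
    unfolding norm_mult complex_mod_cnj mult.assoc by linarith
qed auto

instantiation hardy2 :: ab_group_add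
begin

lift_definition zero_hardy2 :: hardy2 is "\<lambda>_. 0" by simp

lift_definition plus_hardy2 :: "hardy2 \<Rightarrow> hardy2 \<Rightarrow> hardy2" is "\<lambda>c d p. c p + d p"
  by (rule square_summable_add)

lift_definition uminus_hardy2 :: "hardy2 \<Rightarrow> hardy2" is "\<lambda>c p. - c p" by simp

lift_definition minus_hardy2 :: "hardy2 \<Rightarrow> hardy2 \<Rightarrow> hardy2" is "\<lambda>c d p. c p - d p"
  subgoal for c d using square_summable_add[of c "\<lambda>p. - d p"] by simp
  done

instance by standard (transfer; simp add: fun_eq_iff algebra_simps)+

end

lift_definition cscale :: "complex \<Rightarrow> hardy2 \<Rightarrow> hardy2" is "\<lambda>a c p. a * c p"
  by (rule square_summable_cmult)

global_interpretation h2: vector_space cscale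
  defines h2_span = h2.span
    and h2_subspace = h2.subspace
  by standard (transfer; simp add: fun_eq_iff algebra_simps)+

definition cinner :: "hardy2 \<Rightarrow> hardy2 \<Rightarrow> complex" where
  "cinner f g = (\<Sum>\<^sub>\<infinity>p. hcoeff f p * cnj (hcoeff g p))"

lemma cinner_add_left: "cinner (f + g) h = cinner f h + cinner g h"
  unfolding cinner_def plus_hardy2.rep_eq distrib_right
  by (intro infsum_add square_summable_mult hcoeff_summable)

lemma cinner_cscale_left: "cinner (cscale a f) g = a * cinner f g"
  unfolding cinner_def cscale.rep_eq mult.assoc by (rule infsum_cmult_right')

lemma cinner_commute: "cinner f g = cnj (cinner g f)"
  unfolding cinner_def infsum_cnj[symmetric] by (simp add: mult.commute)

lemma cinner_self: "cinner f f = of_real (\<Sum>\<^sub>\<infinity>p. (cmod (hcoeff f p))\<^sup>2)"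
  unfolding cinner_def complex_norm_square[symmetric]
  using has_sum_of_real[OF has_sum_infsum[OF hcoeff_summable], of f, where 'a = complex]
  by (simp add: infsumI)

instantiation hardy2 :: real_inner
begin

definition scaleR_hardy2 :: "real \<Rightarrow> hardy2 \<Rightarrow> hardy2" where
  "scaleR_hardy2 r f = cscale (of_real r) f"

definition inner_hardy2 :: "hardy2 \<Rightarrow> hardy2 \<Rightarrow> real" where
  "inner_hardy2 f g = Re (cinner f g)"

definition norm_hardy2 :: "hardy2 \<Rightarrow> real" where
  "norm_hardy2 f = sqrt (inner f f)"

definition sgn_hardy2 :: "hardy2 \<Rightarrow> hardy2" where
  "sgn_hardy2 f = inverse (norm f) *\<^sub>R f"

definition dist_hardy2 :: "hardy2 \<Rightarrow> hardy2 \<Rightarrow> real" where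
  "dist_hardy2 f g = norm (f - g)"

definition uniformity_hardy2 :: "(hardy2 \<times> hardy2) filter" where
  "uniformity_hardy2 = (INF e\<in>{0<..}. principal {(f, g). dist f g < e})"

definition open_hardy2 :: "hardy2 set \<Rightarrow> bool" where
  "open_hardy2 U = (\<forall>f\<in>U. \<forall>\<^sub>F (f', g) in uniformity. f' = f \<longrightarrow> g \<in> U)"

instance
proof
  fix f g h :: hardy2 and r s :: real
  show "r *\<^sub>R (f + g) = r *\<^sub>R f + r *\<^sub>R g" "(r + s) *\<^sub>R f = r *\<^sub>R f + s *\<^sub>R f"
    "r *\<^sub>R s *\<^sub>R f = (r * s) *\<^sub>R f" "1 *\<^sub>R f = f"
    by (simp_all add: scaleR_hardy2_def h2.scale_right_distrib h2.scale_left_distrib)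
  show "dist f g = norm (f - g)" "sgn f = inverse (norm f) *\<^sub>R f" "norm f = sqrt (inner f f)"
    by (simp_all add: dist_hardy2_def sgn_hardy2_def norm_hardy2_def)
  show "inner f g = inner g f"
    unfolding inner_hardy2_def by (subst cinner_commute) simp
  show "inner (f + g) h = inner f h + inner g h" "inner (r *\<^sub>R f) g = r * inner f g"
    by (simp_all add: inner_hardy2_def scaleR_hardy2_def cinner_add_left cinner_cscale_left)
  show "0 \<le> inner f f"
    by (simp add: inner_hardy2_def cinner_self infsum_nonneg)
  show "inner f f = 0 \<longleftrightarrow> f = 0"
  proof
    assume "inner f f = 0"
    then have *: "(\<Sum>\<^sub>\<infinity>p. (cmod (hcoeff f p))\<^sup>2) = 0"
      by (simp add: inner_hardy2_def cinner_self)
    have "(cmod (hcoeff f p))\<^sup>2 = 0" for p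
      using nonneg_infsum_le_0D[of "\<lambda>p. (cmod (hcoeff f p))\<^sup>2" UNIV p] * hcoeff_summable[of f]
      by simp
    then show "f = 0" by transfer (simp add: fun_eq_iff)
  qed (simp add: inner_hardy2_def cinner_self zero_hardy2.rep_eq)
qed (simp_all add: uniformity_hardy2_def open_hardy2_def)

end

abbreviation disk :: "complex set" where
  "disk \<equiv> ball 0 1"

definition hval :: "hardy2 \<Rightarrow> complex \<Rightarrow> complex \<Rightarrow> complex" where
  "hval f z w = (\<Sum>\<^sub>\<infinity>(m, n). hcoeff f (m, n) * z ^ m * w ^ n)"

text \<open>Meaningful only if \<open>F\<close> restricted to the bidisk is the function of an element of \<open>H\<^sup>2\<close>.\<close>

definition hardy2_of :: "(complex \<Rightarrow> complex \<Rightarrow> complex) \<Rightarrow> hardy2" where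
  "hardy2_of F = (THE f. \<forall>z\<in>disk. \<forall>w\<in>disk. hval f z w = F z w)"

definition mult_op :: "(complex \<Rightarrow> complex \<Rightarrow> complex) \<Rightarrow> hardy2 \<Rightarrow> hardy2" where
  "mult_op \<phi> f = hardy2_of (\<lambda>z w. \<phi> z w * hval f z w)"

definition comp_op :: "(complex \<Rightarrow> complex) \<Rightarrow> (complex \<Rightarrow> complex) \<Rightarrow> hardy2 \<Rightarrow> hardy2" where
  "comp_op \<theta> \<phi> f = hardy2_of (\<lambda>z w. hval f (\<theta> z) (\<phi> w))"

definition inner_function :: "(complex \<Rightarrow> complex) \<Rightarrow> bool" where
  "inner_function \<theta> \<longleftrightarrow> \<theta> holomorphic_on disk \<and> bounded (\<theta> ` disk) \<and>
     (AE t in lebesgue_on {0..2*pi}.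
        \<exists>l. cmod l = 1 \<and> ((\<lambda>r. \<theta> (of_real r * cis t)) \<longlongrightarrow> l) (at_left 1))"


section \<open>Submodules\<close>

definition submodule :: "hardy2 set \<Rightarrow> bool" where
  "submodule M \<longleftrightarrow> h2_subspace M \<and> closed M \<and>
     mult_op (\<lambda>z w. z) ` M \<subseteq> M \<and> mult_op (\<lambda>z w. w) ` M \<subseteq> M"

text \<open>The ring \<open>\<complex>[z,w]\<close> is rendered as \<open>\<complex>[z][w]\<close>: the outer variable is \<open>w\<close>.\<close>

definition poly2_val :: "complex poly poly \<Rightarrow> complex \<Rightarrow> complex \<Rightarrow> complex" where
  "poly2_val p z w = poly (poly p [:w:]) z"

definition generated_submodule :: "hardy2 set \<Rightarrow> hardy2 set" where
  "generated_submodule X = closure (h2_span {mult_op (poly2_val p) f |p f. f \<in> X})"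


section \<open>Operators on a closed subspace\<close>

text \<open>
  An operator on a closed subspace \<open>M\<close> is a function on \<^typ>\<open>hardy2\<close> of which only the values
  on \<open>M\<close> are used.
\<close>

definition adj_on :: "hardy2 set \<Rightarrow> (hardy2 \<Rightarrow> hardy2) \<Rightarrow> hardy2 \<Rightarrow> hardy2" where
  "adj_on M A f = (THE g. g \<in> M \<and> (\<forall>h\<in>M. cinner (A h) f = cinner h g))"

definition ortho_proj :: "hardy2 set \<Rightarrow> hardy2 \<Rightarrow> hardy2" where
  "ortho_proj M f = (THE g. g \<in> M \<and> (\<forall>h\<in>M. cinner (f - g) h = 0))"

definition commutator :: "(hardy2 \<Rightarrow> hardy2) \<Rightarrow> (hardy2 \<Rightarrow> hardy2) \<Rightarrow> hardy2 \<Rightarrow> hardy2" where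
  "commutator A B f = A (B f) - B (A f)"

definition orthonormal_basis :: "hardy2 set \<Rightarrow> hardy2 set \<Rightarrow> bool" where
  "orthonormal_basis M E \<longleftrightarrow> E \<subseteq> M \<and> (\<forall>e\<in>E. norm e = 1) \<and>
     (\<forall>e\<in>E. \<forall>e'\<in>E. e \<noteq> e' \<longrightarrow> cinner e e' = 0) \<and> closure (h2_span E) = M"

text \<open>
  The squared Hilbert-Schmidt norm takes the value \<open>\<infinity>\<close> exactly when the operator is not
  Hilbert-Schmidt; it does not depend on the chosen orthonormal basis.
\<close>

definition hs_norm_sq :: "hardy2 set \<Rightarrow> (hardy2 \<Rightarrow> hardy2) \<Rightarrow> ennreal" where
  "hs_norm_sq M T =
     (\<Sum>\<^sub>\<infinity>e\<in>(SOME E. orthonormal_basis M E). ennreal ((norm (T e))\<^sup>2))"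

definition hilbert_schmidt_on :: "hardy2 set \<Rightarrow> (hardy2 \<Rightarrow> hardy2) \<Rightarrow> bool" where
  "hilbert_schmidt_on M T \<longleftrightarrow> hs_norm_sq M T < \<infinity>"


section \<open>Hilbert-Schmidt submodules and their numerical invariants\<close>

abbreviation R_z :: "hardy2 \<Rightarrow> hardy2" where
  "R_z \<equiv> mult_op (\<lambda>z w. z)"

abbreviation R_w :: "hardy2 \<Rightarrow> hardy2" where
  "R_w \<equiv> mult_op (\<lambda>z w. w)"

definition hilbert_schmidt_submodule :: "hardy2 set \<Rightarrow> bool" where
  "hilbert_schmidt_submodule M \<longleftrightarrow> submodule M \<and>
     hilbert_schmidt_on M (commutator (adj_on M R_z) R_z \<circ> commutator (adj_on M R_w) R_w) \<and>
     hilbert_schmidt_on M (commutator (adj_on M R_z) R_w)"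

definition moebius :: "complex \<Rightarrow> complex \<Rightarrow> complex" where
  "moebius a \<zeta> = (a - \<zeta>) / (1 - cnj a * \<zeta>)"

abbreviation R_moebius_z :: "complex \<Rightarrow> hardy2 \<Rightarrow> hardy2" where
  "R_moebius_z a \<equiv> mult_op (\<lambda>z w. moebius a z)"

abbreviation R_moebius_w :: "complex \<Rightarrow> hardy2 \<Rightarrow> hardy2" where
  "R_moebius_w b \<equiv> mult_op (\<lambda>z w. moebius b w)"

text \<open>
  Both invariants are given by their commutator expressions.  For \<open>\<Sigma>\<^sub>1\<close> the expression by
  projections agrees with the commutator when the projections are those onto
  \<open>\<phi>\<^sub>a(z)(M \<ominus> (w - b)M)\<close> and \<open>\<phi>\<^sub>b(w)(M \<ominus> (z - a)M)\<close>; with the factors \<open>z - a\<close>, \<open>w - b\<close> in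
  place of \<open>\<phi>\<^sub>a(z)\<close>, \<open>\<phi>\<^sub>b(w)\<close> it can differ when \<open>(a, b) \<noteq> (0, 0)\<close>.
\<close>

definition Sigma0 :: "hardy2 set \<Rightarrow> complex \<Rightarrow> complex \<Rightarrow> ennreal" where
  "Sigma0 M a b = hs_norm_sq M
     (commutator (adj_on M (R_moebius_z a)) (R_moebius_z a) \<circ>
      commutator (adj_on M (R_moebius_w b)) (R_moebius_w b))"

definition Sigma1 :: "hardy2 set \<Rightarrow> complex \<Rightarrow> complex \<Rightarrow> ennreal" where
  "Sigma1 M a b = hs_norm_sq M (commutator (adj_on M (R_moebius_z a)) (R_moebius_w b))"

text \<open>Composing with the projection makes the core operator vanish on \<open>H\<^sup>2 \<ominus> M\<close>.\<close>

definition core_operator :: "hardy2 set \<Rightarrow> hardy2 \<Rightarrow> hardy2" where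
  "core_operator M f =
     (let g = ortho_proj M f
      in g - R_z (adj_on M R_z g) - R_w (adj_on M R_w g)
           + R_z (R_w (adj_on M R_z (adj_on M R_w g))))"

end

theory Submission
  imports Defs
begin

text \<open>
  Let \<open>a = \<theta>(0)\<close>, \<open>b = \<phi>(0)\<close>, and let \<open>\<tau> = \<phi>\<^sub>a \<circ> \<theta>\<close>, \<open>\<sigma> = \<phi>\<^sub>b \<circ> \<phi>\<close>, so that \<open>\<tau>\<close> and \<open>\<sigma>\<close> are inner functions that
  vanish at the origin.  Composition with \<open>(\<theta>, \<phi>)\<close>, corrected by an invertible factor in each variable,
  is an isometry \<open>V\<close> with
  \<open>V (\<phi>\<^sub>a(z) f) = \<tau>(z) V f\<close> and \<open>V (\<phi>\<^sub>b(w) f) = \<sigma>(w) V f\<close>.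
  The correction does not change the generated submodule, so \<open>N = M\<^sub>\<theta>\<^sub>,\<^sub>\<phi>\<close> is generated by \<open>V M\<close>.
  With the model spaces \<open>K = H\<^sup>2 \<ominus> \<tau> H\<^sup>2\<close> and \<open>L = H\<^sup>2 \<ominus> \<sigma> H\<^sup>2\<close>, multiplication identifies \<open>K \<otimes> L \<otimes> M\<close>
  with \<open>N\<close>, the element \<open>f \<otimes> g \<otimes> m\<close> corresponding to \<open>f(z) g(w) (V m)(z, w)\<close>.

  Multiplication by \<open>z\<close> maps \<open>K\<close> into \<open>K + \<complex> \<tau>\<close>.  As \<open>\<tau>(z) V m = V (\<phi>\<^sub>a(z) m)\<close>, on \<open>K \<otimes> L \<otimes> M\<close> it is
  the compressed shift of \<open>K\<close> plus a rank one operator of \<open>K\<close> tensored with \<open>R = R\<^bsub>\<phi>\<^sub>a(z)\<^esub>\<close>.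
  Since \<open>1 \<in> K\<close> because of \<open>\<tau>(0) = 0\<close>, it follows that \<open>[R\<^sub>z\<^sup>*, R\<^sub>z]\<close> on \<open>N\<close> is the projection onto the constants of \<open>K\<close>
  tensored with \<open>[R\<^sup>*, R]\<close> on \<open>M\<close>.  The same holds for \<open>w\<close>.  Thus \<open>[R\<^sub>z\<^sup>*, R\<^sub>z] [R\<^sub>w\<^sup>*, R\<^sub>w]\<close> is a rank one
  projection tensored with the corresponding product on \<open>M\<close>; likewise \<open>[R\<^sub>z\<^sup>*, R\<^sub>w]\<close> on \<open>N\<close> is a rank one operator of
  norm one tensored with the cross commutator on \<open>M\<close>.  Tensoring with a rank one operator of norm one preserves the
  Hilbert-Schmidt norm, which proves the two equations for the invariants
  (\<open>hs_norm_sq_defects\<close>, \<open>hs_norm_sq_cross\<close>).  The core operator equals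
  \<open>[R\<^sub>z\<^sup>*, R\<^sub>z] [R\<^sub>w\<^sup>*, R\<^sub>w] - R\<^sub>z [R\<^sub>z\<^sup>*, R\<^sub>w] R\<^sub>w\<^sup>*\<close>, a sum of two operators with orthogonal ranges
  (\<open>hs_norm_sq_alternating_sum\<close>).

  The tensor product is not constructed.  The reproducing kernels \<open>e\<^sub>l\<close> of \<open>K\<close> are bounded functions, so
  the vectors \<open>e\<^sub>l(z) e\<^sub>m(w) V f\<close> can be formed directly; they span \<open>N\<close> (\<open>generated_eq\<close>), their Gram matrix is the
  one of the tensor product (\<open>cinner_EFV\<close>), and the operator identities are verified on them in the
  locale \<open>amplification\<close>.  All norms are computed in \<open>[0, \<infinity>]\<close>.

  The analytic input is of two kinds.  Parseval's identity on circles of radius \<open>r < 1\<close> shows that bounded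
  functions are bounded multipliers (\<open>conv_square_summable\<close>) and, as \<open>r\<close> tends to one, that inner functions are
  isometric ones (\<open>conv_isometric\<close>).  Secondly, closed subspaces invariant under multiplication by \<open>z\<close> are
  invariant under multiplication by all bounded analytic functions of \<open>z\<close> (\<open>Mz_invariant\<close>).
\<close>

section \<open>Hilbert space geometry of the Hardy space\<close>

lemma cinner_add_right: "cinner h (f + g) = cinner h f + cinner h g"
  by (subst (1 2 3) cinner_commute) (simp add: cinner_add_left)

lemma cinner_cscale_right: "cinner f (cscale a g) = cnj a * cinner f g"
  by (subst (1 2) cinner_commute) (simp add: cinner_cscale_left)

lemma cinner_zero_left [simp]: "cinner 0 g = 0"
  by (simp add: cinner_def zero_hardy2.rep_eq)

lemma cinner_zero_right [simp]: "cinner g 0 = 0"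
  by (simp add: cinner_def zero_hardy2.rep_eq)

lemma cinner_minus_left: "cinner (- f) g = - cinner f g"
  using cinner_add_left[of "- f" f g] by (simp add: add_eq_0_iff2)

lemma cinner_minus_right: "cinner f (- g) = - cinner f g"
  using cinner_add_right[of f "- g" g] by (simp add: add_eq_0_iff2)

lemma cinner_diff_left: "cinner (f - g) h = cinner f h - cinner g h"
  using cinner_add_left[of f "- g" h] by (simp add: cinner_minus_left)

lemma cinner_diff_right: "cinner h (f - g) = cinner h f - cinner h g"
  using cinner_add_right[of h f "- g"] by (simp add: cinner_minus_right)

lemma cinner_sum_left: "cinner (sum f A) g = (\<Sum>a\<in>A. cinner (f a) g)"
  by (induction A rule: infinite_finite_induct) (auto simp: cinner_add_left)

lemma cinner_sum_right: "cinner g (sum f A) = (\<Sum>a\<in>A. cinner g (f a))"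
  by (induction A rule: infinite_finite_induct) (auto simp: cinner_add_right)

lemmas cinner_simps =
  cinner_add_left cinner_add_right cinner_diff_left cinner_diff_right
  cinner_minus_left cinner_minus_right cinner_cscale_left cinner_cscale_right

lemma cinner_norm_sq: "cinner f f = complex_of_real ((norm f)^2)"
  unfolding power2_norm_eq_inner inner_hardy2_def
  using cinner_self[of f] by simp

lemma norm_sq_cinner: "(norm f)^2 = Re (cinner f f)"
  by (simp add: cinner_norm_sq)

lemma norm_sq_infsum: "(norm f)^2 = (\<Sum>\<^sub>\<infinity>p. (cmod (hcoeff f p))^2)"
  by (simp add: norm_sq_cinner cinner_self)

lemma norm_eqI_cinner: "cinner f f = cinner g g \<Longrightarrow> norm f = norm g"
  by (simp add: norm_hardy2_def inner_hardy2_def)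

lemma norm_cscale: "norm (cscale a f) = cmod a * norm f"
proof -
  have "(norm (cscale a f))^2 = (cmod a * norm f)^2"
    unfolding norm_sq_infsum[of "cscale a f"] power_mult_distrib norm_sq_infsum[of f]
    by (simp add: cscale.rep_eq norm_mult power_mult_distrib infsum_cmult_right')
  then show ?thesis by (simp add: power2_eq_iff_nonneg)
qed

lemma scaleR_cscale: "r *\<^sub>R f = cscale (of_real r) f"
  by (simp add: scaleR_hardy2_def)

lemma cinner_Cauchy_Schwarz: "cmod (cinner f g) \<le> norm f * norm g"
proof (cases "cinner f g = 0")
  case False
  define c where "c = cnj (cinner f g) / cmod (cinner f g)"
  have c: "cmod c = 1" using False by (simp add: c_def norm_divide)
  have "c * cinner f g = cmod (cinner f g)"
    using False by (simp add: c_def complex_norm_square[symmetric] field_simps power2_eq_square)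
  then have "cmod (cinner f g) = inner (cscale c f) g"
    by (simp add: inner_hardy2_def cinner_cscale_left)
  also have "\<dots> \<le> norm (cscale c f) * norm g"
    by (rule norm_cauchy_schwarz)
  finally show ?thesis by (simp add: norm_cscale c)
qed simp

lemma bounded_linear_cinner_left: "bounded_linear (\<lambda>f. cinner f g)"
  by (rule bounded_linear_intro[where K = "norm g"])
     (auto simp: cinner_simps scaleR_cscale cinner_Cauchy_Schwarz scaleR_conv_of_real)

lemma bounded_linear_cinner_right: "bounded_linear (\<lambda>f. cinner g f)"
  by (rule bounded_linear_intro[where K = "norm g"])
     (auto simp: cinner_simps scaleR_cscale scaleR_conv_of_real
       cinner_Cauchy_Schwarz mult.commute[of "norm _" "norm g"])

lemma cinner_eq_zero_imp: "(\<And>g. cinner f g = 0) \<Longrightarrow> f = 0"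
  using cinner_norm_sq[of f] by simp

lemma cinner_ext: "(\<And>h. cinner f h = cinner g h) \<Longrightarrow> f = g"
  using cinner_eq_zero_imp[of "f - g"] by (simp add: cinner_diff_left)

lemma cinner_ext_right: "(\<And>h. cinner h f = cinner h g) \<Longrightarrow> f = g"
  by (rule cinner_ext) (metis cinner_commute)

lift_definition hbasis :: "nat \<times> nat \<Rightarrow> hardy2" is "\<lambda>p q. if q = p then 1 else 0"
proof -
  fix p :: "nat \<times> nat"
  have "(\<lambda>q. (cmod (if q = p then 1 else 0))^2) summable_on {p}" by simp
  then show "(\<lambda>q. (cmod (if q = p then 1 else 0))^2) summable_on UNIV"
    by (rule summable_on_cong_neutral[THEN iffD1, rotated -1]) auto
qed

lemma cinner_hbasis: "cinner f (hbasis p) = hcoeff f p"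
proof -
  have "cinner f (hbasis p) = (\<Sum>\<^sub>\<infinity>q\<in>{p}. hcoeff f q)"
    unfolding cinner_def by (rule infsum_cong_neutral) (auto simp: hbasis.rep_eq)
  then show ?thesis by simp
qed

lemma hcoeff_eqI: "(\<And>p. hcoeff f p = hcoeff g p) \<Longrightarrow> f = g"
  by (metis ext hcoeff_inject)

text \<open>Square summable families are complete: a coefficientwise limit of a Cauchy sequence
  is a limit in norm, because every finite partial sum of the defect is controlled.\<close>

instance hardy2 :: banach
proof
  fix X :: "nat \<Rightarrow> hardy2"
  assume X: "Cauchy X"
  have "Cauchy (\<lambda>n. hcoeff (X n) p)" for p
    unfolding cinner_hbasis[symmetric]
    by (rule bounded_linear.Cauchy[OF bounded_linear_cinner_left X])
  then have "\<forall>p. \<exists>c. (\<lambda>n. hcoeff (X n) p) \<longlonglongrightarrow> c"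
    by (simp add: Cauchy_convergent_iff convergent_def)
  from choice[OF this] obtain c where c: "\<And>p. (\<lambda>n. hcoeff (X n) p) \<longlonglongrightarrow> c p" by blast
  have fin: "(\<Sum>p\<in>F. (cmod (hcoeff (X m) p - c p))^2) \<le> e^2"
    if "finite F" and e: "\<And>n. n \<ge> N \<Longrightarrow> norm (X m - X n) \<le> e" for F m N e
  proof (rule LIMSEQ_le_const2)
    show "(\<lambda>n. \<Sum>p\<in>F. (cmod (hcoeff (X m) p - hcoeff (X n) p))^2)
        \<longlonglongrightarrow> (\<Sum>p\<in>F. (cmod (hcoeff (X m) p - c p))^2)"
      by (intro tendsto_intros c)
    have "(\<Sum>p\<in>F. (cmod (hcoeff (X m) p - hcoeff (X n) p))^2) \<le> e^2" if "n \<ge> N" for n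
    proof -
      have "(\<Sum>p\<in>F. (cmod (hcoeff (X m) p - hcoeff (X n) p))^2)
          = (\<Sum>p\<in>F. (cmod (hcoeff (X m - X n) p))^2)"
        by (simp add: minus_hardy2.rep_eq)
      also have "\<dots> \<le> (norm (X m - X n))^2"
        unfolding norm_sq_infsum
        by (rule finite_sum_le_infsum) (auto simp: hcoeff_summable \<open>finite F\<close>)
      also have "\<dots> \<le> e^2" using e[OF that] by (simp add: power_mono)
      finally show ?thesis .
    qed
    then show "\<exists>N. \<forall>n\<ge>N. (\<Sum>p\<in>F. (cmod (hcoeff (X m) p - hcoeff (X n) p))^2) \<le> e^2" by blast
  qed
  have summ: "(\<lambda>p. (cmod (hcoeff (X m) p - c p))^2) summable_on UNIV"
      (is "?f summable_on UNIV")
    if e: "\<And>n. n \<ge> N \<Longrightarrow> norm (X m - X n) \<le> e" for m N e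
    by (rule nonneg_bdd_above_summable_on) (auto intro!: bdd_aboveI2 fin[OF _ e])
  from X[unfolded Cauchy_def, rule_format, of 1] obtain N1 where
    N1: "\<And>m n. m \<ge> N1 \<Longrightarrow> n \<ge> N1 \<Longrightarrow> dist (X m) (X n) < 1" by auto
  have "(\<lambda>p. (cmod (hcoeff (X N1) p - c p))^2) summable_on UNIV"
    by (rule summ[of N1 _ 1]) (use N1[of N1] in \<open>auto simp: dist_norm less_imp_le\<close>)
  then have "(\<lambda>p. (cmod (hcoeff (X N1) p + - (hcoeff (X N1) p - c p)))^2) summable_on UNIV"
    by (intro square_summable_add hcoeff_summable) (simp add: norm_minus_commute)
  then have cs: "(\<lambda>p. (cmod (c p))^2) summable_on UNIV" by simp
  define g where "g = Abs_hardy2 c"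
  have g: "hcoeff g = c" using cs by (simp add: g_def Abs_hardy2_inverse)
  have "X \<longlonglongrightarrow> g"
  proof (rule LIMSEQ_I)
    fix r :: real assume r: "0 < r"
    then obtain N where N: "\<And>m n. m \<ge> N \<Longrightarrow> n \<ge> N \<Longrightarrow> dist (X m) (X n) < r/2"
      using X[unfolded Cauchy_def, rule_format, of "r/2"] by auto
    have "norm (X m - g) < r" if m: "m \<ge> N" for m
    proof -
      have e: "norm (X m - X n) \<le> r/2" if "n \<ge> N" for n
        using N[OF m that] by (simp add: dist_norm less_imp_le)
      have "(norm (X m - g))^2 \<le> (r/2)^2"
        unfolding norm_sq_infsum
        by (rule infsum_le_finite_sums)
           (use summ[OF e] fin[OF _ e] in \<open>auto simp: minus_hardy2.rep_eq g\<close>)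
      then show ?thesis using r by (auto dest!: power2_le_imp_le)
    qed
    then show "\<exists>N. \<forall>n\<ge>N. norm (X n - g) < r" by blast
  qed
  then show "convergent X" by (auto simp: convergent_def)
qed

subsection \<open>Closed subspaces, projections and adjoints\<close>

definition closed_subspace :: "hardy2 set \<Rightarrow> bool" where
  "closed_subspace M \<longleftrightarrow> h2_subspace M \<and> closed M"

lemma closed_subspaceD:
  assumes "closed_subspace M"
  shows "0 \<in> M" "\<And>x y. x \<in> M \<Longrightarrow> y \<in> M \<Longrightarrow> x + y \<in> M" "\<And>a x. x \<in> M \<Longrightarrow> cscale a x \<in> M"
    "\<And>x y. x \<in> M \<Longrightarrow> y \<in> M \<Longrightarrow> x - y \<in> M" "\<And>x. x \<in> M \<Longrightarrow> - x \<in> M" "closed M"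
    "\<And>S. S \<subseteq> M \<Longrightarrow> closure (h2_span S) \<subseteq> M"
  using assms unfolding closed_subspace_def
  by (auto simp: h2.subspace_0 h2.subspace_add h2.subspace_scale h2.subspace_diff h2.subspace_neg
      dest: closure_minimal[OF h2.span_minimal, THEN subsetD])

lemma closed_subspaceI:
  assumes "0 \<in> M" "\<And>x y. x \<in> M \<Longrightarrow> y \<in> M \<Longrightarrow> x + y \<in> M" "\<And>a x. x \<in> M \<Longrightarrow> cscale a x \<in> M"
    "closed M"
  shows "closed_subspace M"
  using assms unfolding closed_subspace_def h2.subspace_def by blast

lemma closed_subspace_UNIV: "closed_subspace UNIV"
  by (rule closed_subspaceI) auto

lemma bounded_linear_cscale: "bounded_linear (cscale a)"
  by (rule bounded_linear_intro[where K = "cmod a"])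
     (auto simp: h2.scale_right_distrib scaleR_cscale mult.commute norm_cscale)

lemma closed_subspace_closure_span: "closed_subspace (closure (h2_span S))"
proof (rule closed_subspaceI)
  show "0 \<in> closure (h2_span S)"
    using closure_subset h2.span_zero by blast
  show "cscale a x \<in> closure (h2_span S)" if x: "x \<in> closure (h2_span S)" for a x
  proof -
    obtain X where "\<And>n. X n \<in> h2_span S" "X \<longlonglongrightarrow> x"
      using x by (auto simp: closure_sequential)
    then show ?thesis unfolding closure_sequential
      by (intro exI[of _ "\<lambda>n. cscale a (X n)"])
         (auto intro: h2.span_scale bounded_linear.tendsto[OF bounded_linear_cscale])
  qed
  show "x + y \<in> closure (h2_span S)"
    if x: "x \<in> closure (h2_span S)" and y: "y \<in> closure (h2_span S)" for x y
  proof -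
    obtain X where "\<And>n. X n \<in> h2_span S" "X \<longlonglongrightarrow> x"
      using x by (auto simp: closure_sequential)
    moreover obtain Y where "\<And>n. Y n \<in> h2_span S" "Y \<longlonglongrightarrow> y"
      using y by (auto simp: closure_sequential)
    ultimately show ?thesis unfolding closure_sequential
      by (intro exI[of _ "\<lambda>n. X n + Y n"]) (auto intro: h2.span_add tendsto_add)
  qed
qed simp

lemma in_closure_span: "x \<in> S \<Longrightarrow> x \<in> closure (h2_span S)"
  using closure_subset h2.span_base by blast

lemma orthogonal_if_nearest:
  fixes v h :: hardy2
  assumes "\<And>t. norm v \<le> norm (v - t *\<^sub>R h)"
  shows "inner v h = 0"
proof (cases "h = 0")
  case False
  define s where "s = inner v h"
  define t where "t = s / inner h h"
  have pos: "inner h h > 0" using False by simp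
  have "(norm v)^2 \<le> (norm (v - t *\<^sub>R h))^2"
    using assms[of t] by (intro power_mono) auto
  also have "\<dots> = (norm v)^2 - 2 * t * s + t^2 * inner h h"
    unfolding power2_norm_eq_inner
    by (simp add: inner_diff_left inner_diff_right s_def power2_eq_square
        inner_commute[of h v] algebra_simps)
  also have "\<dots> = (norm v)^2 - s^2 / inner h h"
    using pos by (simp add: t_def power2_eq_square field_simps)
  finally have "s^2 / inner h h \<le> 0" by simp
  then have "s = 0" using pos by (simp add: divide_le_0_iff)
  then show ?thesis by (simp add: s_def)
qed simp

text \<open>A minimizing sequence is Cauchy by the parallelogram law, since the midpoint of two of its
  members is again in \<open>M\<close> and so cannot be closer to \<open>f\<close> than the infimum.\<close>

lemma exists_nearest_point:
  assumes M: "closed_subspace M"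
  obtains g where "g \<in> M" "\<And>h. h \<in> M \<Longrightarrow> norm (f - g) \<le> norm (f - h)"
proof -
  define d where "d = (INF h\<in>M. norm (f - h))"
  have bdd: "bdd_below ((\<lambda>h. norm (f - h)) ` M)" by (rule bdd_belowI2[of _ 0]) simp
  have ne: "M \<noteq> {}" using closed_subspaceD(1)[OF M] by auto
  have d_le: "d \<le> norm (f - h)" if "h \<in> M" for h
    unfolding d_def by (rule cINF_lower[OF bdd that])
  have d0: "0 \<le> d" unfolding d_def by (rule cINF_greatest[OF ne]) simp
  have "\<exists>h\<in>M. norm (f - h) < d + 1 / Suc n" for n
    using cINF_less_iff[OF ne bdd, of "d + 1 / Suc n"] by (simp add: d_def)
  then obtain X where X: "\<And>n. X n \<in> M" "\<And>n. norm (f - X n) < d + 1 / Suc n" by metis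
  have lim: "(\<lambda>n. (d + 1 / Suc n)^2) \<longlonglongrightarrow> d^2"
    using tendsto_power[OF tendsto_add[OF tendsto_const[of d] LIMSEQ_inverse_real_of_nat], of 2]
    by (simp add: inverse_eq_divide)
  \<comment> \<open>The parallelogram law at \<open>f\<close>, with the midpoint of \<open>X m\<close> and \<open>X n\<close>.\<close>
  have par: "(norm (X m - X n))^2 \<le> 2 * ((d + 1 / Suc m)^2 - d^2) + 2 * ((d + 1 / Suc n)^2 - d^2)"
    for m n
  proof -
    have half: "(1/2) *\<^sub>R (X m + X n) \<in> M"
      unfolding scaleR_cscale by (intro closed_subspaceD(2,3)[OF M] X(1))
    have "(norm (X m - X n))^2 = 2 * (norm (f - X m))^2 + 2 * (norm (f - X n))^2
        - 4 * (norm (f - (1/2) *\<^sub>R (X m + X n)))^2"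
      unfolding power2_norm_eq_inner
      by (simp add: inner_diff_left inner_diff_right inner_add_left
          inner_add_right inner_commute algebra_simps)
    also have "\<dots> \<le> 2 * (d + 1 / Suc m)^2 + 2 * (d + 1 / Suc n)^2 - 4 * d^2"
      using X(2)[of m] X(2)[of n] d_le[OF half] d0
      by (intro diff_mono add_mono mult_left_mono power_mono) auto
    finally show ?thesis by simp
  qed
  have "Cauchy X"
  proof (rule metric_CauchyI)
    fix e :: real assume e: "0 < e"
    have "eventually (\<lambda>n. (d + 1 / Suc n)^2 < d^2 + e^2 / 4) sequentially"
      using order_tendstoD(2)[OF lim, of "d^2 + e^2 / 4"] e by simp
    then obtain N where N: "\<And>n. n \<ge> N \<Longrightarrow> (d + 1 / Suc n)^2 < d^2 + e^2 / 4"
      by (auto simp: eventually_sequentially)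
    have "dist (X m) (X n) < e" if "m \<ge> N" "n \<ge> N" for m n
    proof -
      have "(norm (X m - X n))^2 < e^2"
        using par[of m n] N[OF that(1)] N[OF that(2)] by simp
      then show ?thesis unfolding dist_norm using e by (auto intro: power2_less_imp_less)
    qed
    then show "\<exists>N. \<forall>m\<ge>N. \<forall>n\<ge>N. dist (X m) (X n) < e" by blast
  qed
  then obtain g where g: "X \<longlonglongrightarrow> g" using Cauchy_convergent convergent_def by blast
  have gM: "g \<in> M"
    using closed_sequentially[OF closed_subspaceD(6)[OF M] X(1) g] .
  have "norm (f - g) \<le> d"
  proof (rule LIMSEQ_le)
    show "(\<lambda>n. norm (f - X n)) \<longlonglongrightarrow> norm (f - g)" by (intro tendsto_intros g)
    show "(\<lambda>n. d + 1 / Suc n) \<longlonglongrightarrow> d"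
      using tendsto_add[OF tendsto_const[of d] LIMSEQ_inverse_real_of_nat]
      by (simp add: inverse_eq_divide)
    show "\<exists>N. \<forall>n\<ge>N. norm (f - X n) \<le> d + 1 / Suc n"
      using less_imp_le[OF X(2)] by blast
  qed
  then show thesis using d_le by (intro that[OF gM]) (meson order_trans)
qed

lemma projection_theorem:
  assumes M: "closed_subspace M"
  obtains g where "g \<in> M" "\<And>h. h \<in> M \<Longrightarrow> cinner (f - g) h = 0"
proof -
  obtain g where g: "g \<in> M" "\<And>h. h \<in> M \<Longrightarrow> norm (f - g) \<le> norm (f - h)"
    using exists_nearest_point[OF M] by blast
  have real: "inner (f - g) h = 0" if "h \<in> M" for h
  proof (rule orthogonal_if_nearest)
    fix t :: real
    have "g + t *\<^sub>R h \<in> M" unfolding scaleR_cscale by (intro closed_subspaceD(2,3)[OF M] g(1) that)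
    from g(2)[OF this] show "norm (f - g) \<le> norm (f - g - t *\<^sub>R h)"
      by (simp add: algebra_simps)
  qed
  have "cinner (f - g) h = 0" if h: "h \<in> M" for h
  proof (rule complex_eqI)
    show "Re (cinner (f - g) h) = Re 0" using real[OF h] by (simp add: inner_hardy2_def)
    have "inner (f - g) (cscale \<i> h) = 0" using real closed_subspaceD(3)[OF M h] by blast
    then show "Im (cinner (f - g) h) = Im 0" by (simp add: inner_hardy2_def cinner_cscale_right)
  qed
  then show thesis by (rule that[OF g(1)])
qed

lemma ortho_proj:
  assumes M: "closed_subspace M"
  shows "ortho_proj M f \<in> M" "h \<in> M \<Longrightarrow> cinner (ortho_proj M f) h = cinner f h"
proof -
  have "\<exists>!g. g \<in> M \<and> (\<forall>h\<in>M. cinner (f - g) h = 0)"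
  proof (rule ex_ex1I)
    show "\<exists>g. g \<in> M \<and> (\<forall>h\<in>M. cinner (f - g) h = 0)" using projection_theorem[OF M] by metis
    fix g g' assume a: "g \<in> M \<and> (\<forall>h\<in>M. cinner (f - g) h = 0)"
      "g' \<in> M \<and> (\<forall>h\<in>M. cinner (f - g') h = 0)"
    then have "g - g' \<in> M" using closed_subspaceD(4)[OF M] by simp
    with a have "cinner (g - g') (g - g') = 0" by (simp add: cinner_diff_left)
    then show "g = g'" by (simp add: cinner_norm_sq)
  qed
  from theI'[OF this] show "ortho_proj M f \<in> M" "h \<in> M \<Longrightarrow> cinner (ortho_proj M f) h = cinner f h"
    unfolding ortho_proj_def by (auto simp: cinner_diff_left)
qed

lemma closed_subspace_eq_UNIV:
  assumes M: "closed_subspace M" and *: "\<And>y. (\<And>x. x \<in> M \<Longrightarrow> cinner x y = 0) \<Longrightarrow> y = 0"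
  shows "M = UNIV"
proof -
  have "f \<in> M" for f
  proof -
    have "f - ortho_proj M f = 0"
    proof (rule *)
      fix x assume "x \<in> M"
      then have "cinner (f - ortho_proj M f) x = 0"
        by (simp add: cinner_diff_left ortho_proj[OF M])
      then show "cinner x (f - ortho_proj M f) = 0" by (subst cinner_commute) simp
    qed
    then show "f \<in> M" using ortho_proj(1)[OF M, of f] by simp
  qed
  then show ?thesis by blast
qed

lemma hbasis_total:
  assumes M: "closed_subspace M" and "\<And>p. hbasis p \<in> M"
  shows "M = UNIV"
proof (rule closed_subspace_eq_UNIV[OF M])
  fix y assume y: "\<And>x. x \<in> M \<Longrightarrow> cinner x y = 0"
  have "hcoeff y p = 0" for p
    using y[OF assms(2)[of p]] cinner_commute[of y "hbasis p"] by (simp add: cinner_hbasis)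
  then show "y = 0" by (intro hcoeff_eqI) (simp add: zero_hardy2.rep_eq)
qed

definition bounded_op :: "(hardy2 \<Rightarrow> hardy2) \<Rightarrow> bool" where
  "bounded_op T \<longleftrightarrow> (\<forall>x y. T (x + y) = T x + T y) \<and> (\<forall>a x. T (cscale a x) = cscale a (T x)) \<and>
     (\<exists>K. \<forall>x. norm (T x) \<le> K * norm x)"

lemma bounded_opD:
  assumes "bounded_op T"
  shows "T (x + y) = T x + T y" "T (cscale a x) = cscale a (T x)" "T 0 = 0"
    "T (- x) = - T x" "T (x - y) = T x - T y" "bounded_linear T"
proof -
  obtain K where K: "\<And>x. norm (T x) \<le> K * norm x" using assms by (auto simp: bounded_op_def)
  show bl: "bounded_linear T"
    using assms K
    by (intro bounded_linear_intro[where K = K])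
       (auto simp: bounded_op_def scaleR_cscale mult.commute[of _ K])
  show "T (x + y) = T x + T y" "T (cscale a x) = cscale a (T x)"
    using assms by (auto simp: bounded_op_def)
  show "T 0 = 0" "T (- x) = - T x" "T (x - y) = T x - T y"
    using bl by (simp_all add: bounded_linear.linear linear_0 linear_neg linear_diff)
qed

lemma bounded_opI:
  assumes "\<And>x y. T (x + y) = T x + T y" "\<And>a x. T (cscale a x) = cscale a (T x)"
    "\<And>x. norm (T x) \<le> K * norm x"
  shows "bounded_op T"
  using assms unfolding bounded_op_def by blast

lemma bounded_op_compose:
  assumes S: "bounded_op S" and T: "bounded_op T"
  shows "bounded_op (\<lambda>x. S (T x))"
proof -
  have "bounded_linear (\<lambda>x. S (T x))"
    using bounded_linear_compose[OF bounded_opD(6)[OF S] bounded_opD(6)[OF T]] .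
  then obtain K where "\<And>x. norm (S (T x)) \<le> norm x * K" using bounded_linear.bounded by blast
  then show ?thesis
    by (intro bounded_opI[of _ K]) (auto simp: bounded_opD[OF S] bounded_opD[OF T] mult.commute)
qed

lemma tendsto_bounded_op: "bounded_op T \<Longrightarrow> (f \<longlongrightarrow> l) F \<Longrightarrow> ((\<lambda>x. T (f x)) \<longlongrightarrow> T l) F"
  using bounded_opD(6) bounded_linear.tendsto by blast

text \<open>Identities between inner products are tested on a set with dense span by showing that the
  vectors which satisfy them form a closed subspace.\<close>

lemma closed_subspace_weak_eq:
  assumes S: "bounded_op S" and T: "bounded_op T"
  shows "closed_subspace {x. cinner (S x) f = cinner (T x) g}"
proof (rule closed_subspaceI)
  have "continuous_on UNIV (\<lambda>x. cinner (S x) f)" "continuous_on UNIV (\<lambda>x. cinner (T x) g)"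
    using bounded_linear_compose[OF bounded_linear_cinner_left bounded_opD(6)[OF S]]
      bounded_linear_compose[OF bounded_linear_cinner_left bounded_opD(6)[OF T]]
    by (simp_all add: linear_continuous_on o_def)
  then show "closed {x. cinner (S x) f = cinner (T x) g}"
    by (intro closed_Collect_eq)
qed (simp_all add: bounded_opD[OF S] bounded_opD[OF T] cinner_simps)

lemma bounded_op_id: "bounded_op (\<lambda>x. x)"
  by (rule bounded_opI[of _ 1]) auto

lemma closed_subspace_vimage:
  assumes T: "bounded_op T" and M: "closed_subspace M"
  shows "closed_subspace {x. T x \<in> M}"
proof (rule closed_subspaceI)
  have "closed (T -` M)"
    using bounded_opD(6)[OF T] closed_subspaceD(6)[OF M]
    by (simp add: continuous_closed_vimage linear_continuous_at)
  then show "closed {x. T x \<in> M}" by (simp add: vimage_def)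
qed (simp_all add: bounded_opD[OF T] closed_subspaceD[OF M])

text \<open>The kernel of a nonzero functional has a one-dimensional orthogonal complement, which
  contains the representing vector.\<close>

lemma Riesz_representation:
  assumes add: "\<And>x y. l (x + y) = l x + l y" and scale: "\<And>a x. l (cscale a x) = a * l x"
    and bound: "\<And>x. cmod (l x) \<le> K * norm x"
  obtains g where "\<And>x. l x = cinner x g"
proof (cases "\<forall>x. l x = 0")
  case True
  then show thesis using that[of 0] by simp
next
  case False
  then obtain x where x: "l x \<noteq> 0" by blast
  have bl: "bounded_linear l"
    by (rule bounded_linear_intro[where K = K])
       (auto simp: add scale scaleR_cscale scaleR_conv_of_real bound mult.commute[of "norm _" K])
  have diff: "l (u - v) = l u - l v" for u v
    using add[of "u - v" v] by simp
  have M: "closed_subspace {x. l x = 0}"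
  proof (rule closed_subspaceI)
    show "closed {x. l x = 0}"
      using bl by (intro closed_Collect_eq) (auto intro: linear_continuous_on)
  qed (use add scale scale[of 0 0] in auto)
  define y where "y = x - ortho_proj {x. l x = 0} x"
  have ly: "l y = l x" using ortho_proj(1)[OF M, of x] by (simp add: y_def diff)
  have y0: "y \<noteq> 0" using ly x diff[of 0 0] by auto
  have orth: "cinner h y = 0" if "l h = 0" for h
  proof -
    have "cinner y h = 0"
      using that ortho_proj(2)[OF M, of h x] by (simp add: y_def cinner_diff_left)
    then show ?thesis by (subst cinner_commute) simp
  qed
  have yy: "cinner y y \<noteq> 0" using y0 by (simp add: cinner_norm_sq)
  show thesis
  proof (rule that)
    fix z
    have "l (z - cscale (l z / l y) y) = 0" using x ly by (simp add: diff scale)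
    from orth[OF this] have "cinner z y = l z / l y * cinner y y" by (simp add: cinner_simps)
    then have "l z = l y / cinner y y * cinner z y" using yy x ly by (simp add: field_simps)
    then show "l z = cinner z (cscale (cnj (l y / cinner y y)) y)" by (simp add: cinner_simps)
  qed
qed

text \<open>The adjoint on \<open>M\<close> is the adjoint on the whole space followed by the projection onto \<open>M\<close>, so
  the defining description of \<^const>\<open>adj_on\<close> is satisfied by exactly one vector even if \<open>A\<close> does not map
  \<open>M\<close> into itself.  The third statement is how adjoints are computed below.\<close>

lemma adj_on:
  assumes A: "bounded_op A" and M: "closed_subspace M"
  shows "adj_on M A f \<in> M" "h \<in> M \<Longrightarrow> cinner h (adj_on M A f) = cinner (A h) f"
    "g \<in> M \<Longrightarrow> (\<And>h. h \<in> M \<Longrightarrow> cinner (A h) f = cinner h g) \<Longrightarrow> adj_on M A f = g"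
proof -
  obtain K where K: "\<And>x. norm (A x) \<le> K * norm x" using A by (auto simp: bounded_op_def)
  have "cmod (cinner (A x) f) \<le> (K * norm f) * norm x" for x
  proof -
    have "cmod (cinner (A x) f) \<le> norm (A x) * norm f" by (rule cinner_Cauchy_Schwarz)
    also have "\<dots> \<le> K * norm x * norm f" by (intro mult_right_mono K) simp
    finally show ?thesis by (simp add: mult_ac)
  qed
  then obtain g0 where g0: "\<And>x. cinner (A x) f = cinner x g0"
    by (rule Riesz_representation[of "\<lambda>x. cinner (A x) f", rotated 2])
       (simp_all add: bounded_opD[OF A] cinner_simps)
  have ex1: "\<exists>!g. g \<in> M \<and> (\<forall>h\<in>M. cinner (A h) f = cinner h g)"
  proof (rule ex_ex1I)
    have "cinner h (ortho_proj M g0) = cinner (A h) f" if "h \<in> M" for h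
      using ortho_proj(2)[OF M that, of g0] g0[of h]
      by (metis cinner_commute)
    then show "\<exists>g. g \<in> M \<and> (\<forall>h\<in>M. cinner (A h) f = cinner h g)"
      using ortho_proj(1)[OF M, of g0] by metis
    fix g g' assume a: "g \<in> M \<and> (\<forall>h\<in>M. cinner (A h) f = cinner h g)"
      "g' \<in> M \<and> (\<forall>h\<in>M. cinner (A h) f = cinner h g')"
    then have "g - g' \<in> M" using closed_subspaceD(4)[OF M] by simp
    with a have "cinner (g - g') (g - g') = 0" by (metis cinner_diff_right right_minus_eq)
    then show "g = g'" by (simp add: cinner_norm_sq)
  qed
  from theI'[OF ex1] show "adj_on M A f \<in> M" "h \<in> M \<Longrightarrow> cinner h (adj_on M A f) = cinner (A h) f"
    unfolding adj_on_def by auto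
  show "g \<in> M \<Longrightarrow> (\<And>h. h \<in> M \<Longrightarrow> cinner (A h) f = cinner h g) \<Longrightarrow> adj_on M A f = g"
    unfolding adj_on_def by (rule the1_equality[OF ex1]) blast
qed

subsection \<open>Orthonormal bases and the Hilbert-Schmidt norm\<close>

definition orthonormal_set :: "hardy2 set \<Rightarrow> bool" where
  "orthonormal_set E \<longleftrightarrow> (\<forall>e\<in>E. norm e = 1) \<and> (\<forall>e\<in>E. \<forall>e'\<in>E. e \<noteq> e' \<longrightarrow> cinner e e' = 0)"

lemma cinner_orthonormal:
  assumes "orthonormal_set E" "e \<in> E" "e' \<in> E"
  shows "cinner e e' = (if e = e' then 1 else 0)"
  using assms by (auto simp: orthonormal_set_def cinner_norm_sq)

text \<open>A maximal orthonormal subset of \<open>M\<close>, which Zorn's lemma provides, spans a dense subspace: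
  otherwise the normalized defect of some projection could be added to it.\<close>

lemma orthonormal_basis_exists:
  assumes M: "closed_subspace M"
  shows "\<exists>E. orthonormal_basis M E"
proof -
  define \<A> where "\<A> = {E. E \<subseteq> M \<and> orthonormal_set E}"
  have "\<exists>E\<in>\<A>. \<forall>X\<in>\<A>. E \<subseteq> X \<longrightarrow> X = E"
  proof (rule subset_Zorn')
    fix C assume C: "subset.chain \<A> C"
    show "\<Union>C \<in> \<A>"
    proof -
      have sub: "D \<subseteq> M" "orthonormal_set D" if "D \<in> C" for D
        using C that by (auto simp: subset_chain_def \<A>_def)
      have "\<exists>D\<in>C. e \<in> D \<and> e' \<in> D" if "e \<in> \<Union>C" "e' \<in> \<Union>C" for e e'
        using that C unfolding subset_chain_def by blast
      then have "cinner e e' = (if e = e' then 1 else 0)" if "e \<in> \<Union>C" "e' \<in> \<Union>C" for e e'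
        using that cinner_orthonormal[OF sub(2)] by meson
      moreover have "norm e = 1" if "e \<in> \<Union>C" for e
        using that sub(2) by (auto simp: orthonormal_set_def)
      ultimately show ?thesis
        using Union_least[OF sub(1)] unfolding \<A>_def orthonormal_set_def by simp
    qed
  qed
  then obtain E where E\<A>: "E \<in> \<A>" "\<forall>X\<in>\<A>. E \<subseteq> X \<longrightarrow> X = E" by (rule bexE)
  then have E: "E \<subseteq> M" "orthonormal_set E"
    and max: "\<And>X. X \<subseteq> M \<Longrightarrow> orthonormal_set X \<Longrightarrow> E \<subseteq> X \<Longrightarrow> X = E"
    by (simp_all add: \<A>_def)
  define K where "K = closure (h2_span E)"
  have K: "closed_subspace K" unfolding K_def by (rule closed_subspace_closure_span)
  have KM: "K \<subseteq> M" unfolding K_def by (rule closed_subspaceD(7)[OF M E(1)])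
  have "x \<in> K" if x: "x \<in> M" for x
  proof (rule ccontr)
    assume "x \<notin> K"
    define y where "y = x - ortho_proj K x"
    have y0: "y \<noteq> 0" using \<open>x \<notin> K\<close> ortho_proj(1)[OF K, of x] by (auto simp: y_def)
    have yM: "y \<in> M" unfolding y_def
      using x ortho_proj(1)[OF K, of x] KM by (intro closed_subspaceD(4)[OF M]) auto
    have orth: "cinner y h = 0" if "h \<in> K" for h
      by (simp add: y_def cinner_diff_left ortho_proj(2)[OF K that])
    define e where "e = cscale (1 / norm y) y"
    have e1: "norm e = 1" using y0 by (simp add: e_def norm_cscale norm_divide)
    have eorth: "cinner e h = 0" "cinner h e = 0" if "h \<in> E" for h
    proof -
      have "h \<in> K" unfolding K_def using that by (rule in_closure_span)
      then show "cinner e h = 0" by (simp add: e_def cinner_simps orth)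
      then show "cinner h e = 0" by (subst cinner_commute) simp
    qed
    have "insert e E = E"
    proof (rule max)
      show "insert e E \<subseteq> M" using E(1) closed_subspaceD(3)[OF M yM] by (auto simp: e_def)
      show "orthonormal_set (insert e E)"
        using E(2) e1 eorth by (auto simp: orthonormal_set_def)
    qed auto
    then have "cinner e e = 0" using eorth by blast
    then show False using e1 by (simp add: cinner_norm_sq)
  qed
  then have "closure (h2_span E) = M" using KM unfolding K_def by auto
  then show ?thesis using E
    by (intro exI[of _ E]) (simp add: orthonormal_basis_def orthonormal_set_def)
qed

lemma orthonormal_expansion:
  assumes E: "orthonormal_set E" "finite E"
  obtains s where "s \<in> h2_span E" "\<And>h. h \<in> h2_span E \<Longrightarrow> cinner (x - s) h = 0"
    "(norm (x - s))^2 = (norm x)^2 - (\<Sum>e\<in>E. (cmod (cinner x e))^2)"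
proof -
  define s where "s = (\<Sum>e\<in>E. cscale (cinner x e) e)"
  have "cinner (x - s) e = 0" if "e \<in> E" for e
  proof -
    have "cinner s e = (\<Sum>e'\<in>E. if e' = e then cinner x e' else 0)"
      unfolding s_def cinner_sum_left
      by (intro sum.cong) (auto simp: cinner_simps cinner_orthonormal[OF E(1) _ that])
    also have "\<dots> = cinner x e" using that E(2) by simp
    finally show ?thesis by (simp add: cinner_simps)
  qed
  moreover have "h2_subspace {h. cinner (x - s) h = 0}"
    by (auto simp: h2.subspace_def cinner_add_right cinner_cscale_right)
  ultimately have orth: "cinner (x - s) h = 0" if "h \<in> h2_span E" for h
    using h2.span_minimal[of E "{h. cinner (x - s) h = 0}"] that by blast
  have sE: "s \<in> h2_span E" unfolding s_def
    by (intro h2.span_sum h2.span_scale h2.span_base)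
  have "cinner x s = (\<Sum>e\<in>E. of_real ((cmod (cinner x e))^2))"
    unfolding s_def cinner_sum_right
    by (intro sum.cong) (simp_all add: cinner_simps complex_norm_square mult.commute del: of_real_power)
  then have xs: "Re (cinner x s) = (\<Sum>e\<in>E. (cmod (cinner x e))^2)"
    by (metis Re_complex_of_real of_real_sum)
  have ss: "cinner s s = cinner x s"
    using orth[OF sE] by (simp add: cinner_simps)
  have "Re (cinner s x) = Re (cinner x s)" by (subst cinner_commute) simp
  then have "(norm (x - s))^2 = (norm x)^2 - (\<Sum>e\<in>E. (cmod (cinner x e))^2)"
    using xs ss by (simp add: norm_sq_cinner cinner_simps)
  with sE orth show thesis by (rule that)
qed

lemma Bessel_inequality:
  assumes "orthonormal_set E" "finite E"
  shows "(\<Sum>e\<in>E. (cmod (cinner x e))^2) \<le> (norm x)^2"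
  using orthonormal_expansion[OF assms, of x] by (metis diff_ge_0_iff_ge zero_le_power2)

lemma orthonormal_best_approximation:
  assumes E: "orthonormal_set E" "finite E" and y: "y \<in> h2_span E"
  shows "(norm x)^2 - (\<Sum>e\<in>E. (cmod (cinner x e))^2) \<le> (norm (x - y))^2"
proof -
  obtain s where s: "s \<in> h2_span E" "\<And>h. h \<in> h2_span E \<Longrightarrow> cinner (x - s) h = 0"
    "(norm (x - s))^2 = (norm x)^2 - (\<Sum>e\<in>E. (cmod (cinner x e))^2)"
    by (rule orthonormal_expansion[OF E, of x]) blast
  have 1: "cinner (x - s) (s - y) = 0" by (intro s(2) h2.span_diff s(1) y)
  then have 2: "cinner (s - y) (x - s) = 0" by (subst cinner_commute) simp
  have "x - y = (x - s) + (s - y)" by simp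
  then have "(norm (x - y))^2 = (norm (x - s))^2 + (norm (s - y))^2"
    unfolding norm_sq_cinner by (simp only: cinner_add_left cinner_add_right 1 2) simp
  then show ?thesis using s(3) by simp
qed

lemma Parseval_identity:
  assumes E: "orthonormal_basis M E" and x: "x \<in> M"
  shows "(\<Sum>\<^sub>\<infinity>e\<in>E. ennreal ((cmod (cinner x e))^2)) = ennreal ((norm x)^2)" (is "?S = _")
proof (rule antisym)
  have on: "orthonormal_set E" using E by (auto simp: orthonormal_basis_def orthonormal_set_def)
  have onF: "orthonormal_set F" if "F \<subseteq> E" for F
    using on that by (auto simp: orthonormal_set_def)
  have S: "?S = (SUP F\<in>{F. finite F \<and> F \<subseteq> E}. \<Sum>e\<in>F. ennreal ((cmod (cinner x e))^2))"
    by (rule nonneg_infsum_complete) simp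
  show "?S \<le> ennreal ((norm x)^2)"
    unfolding S by (rule SUP_least) (auto intro!: ennreal_leI Bessel_inequality onF)
  show "ennreal ((norm x)^2) \<le> ?S"
  proof (rule ennreal_le_epsilon)
    fix r :: real assume r: "0 < r"
    have "x \<in> closure (h2_span E)" using E x by (simp add: orthonormal_basis_def)
    then obtain y where y: "y \<in> h2_span E" "dist y x < sqrt r"
      using r unfolding closure_approachable by (meson real_sqrt_gt_zero)
    obtain F where F: "finite F" "F \<subseteq> E" "y \<in> h2_span F"
    proof -
      obtain t c where "finite t" "t \<subseteq> E" "y = (\<Sum>a\<in>t. cscale (c a) a)"
        using y(1) unfolding h2.span_explicit by blast
      then show thesis
        by (intro that[of t]) (auto intro: h2.span_sum h2.span_scale h2.span_base)
    qed
    have "(norm (x - y))^2 \<le> (sqrt r)^2"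
      using y(2) by (intro power_mono) (auto simp: dist_norm norm_minus_commute)
    then have "(norm x)^2 \<le> (\<Sum>e\<in>F. (cmod (cinner x e))^2) + r"
      using orthonormal_best_approximation[OF onF[OF F(2)] F(1) F(3), of x] r by simp
    then have "ennreal ((norm x)^2) \<le> ennreal ((\<Sum>e\<in>F. (cmod (cinner x e))^2) + r)"
      by (rule ennreal_leI)
    also have "\<dots> = (\<Sum>e\<in>F. ennreal ((cmod (cinner x e))^2)) + ennreal r"
      using r by (simp add: sum_nonneg)
    also have "\<dots> \<le> ?S + ennreal r"
      unfolding S by (intro add_right_mono SUP_upper) (use F in auto)
    finally show "ennreal ((norm x)^2) \<le> ?S + ennreal r" .
  qed
qed

lemma ennreal_summable_on: "(f :: 'a \<Rightarrow> ennreal) summable_on A"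
  by (rule nonneg_summable_on_complete) simp

text \<open>One inequality suffices, because it can be applied with the two sums in either order.\<close>

lemma infsum_swap_le_ennreal:
  fixes g :: "'a \<Rightarrow> 'b \<Rightarrow> ennreal"
  shows "(\<Sum>\<^sub>\<infinity>e\<in>E. \<Sum>\<^sub>\<infinity>f\<in>F. g e f) \<le> (\<Sum>\<^sub>\<infinity>f\<in>F. \<Sum>\<^sub>\<infinity>e\<in>E. g e f)"
proof -
  have "(\<Sum>e\<in>A. \<Sum>\<^sub>\<infinity>f\<in>F. g e f) \<le> (\<Sum>\<^sub>\<infinity>f\<in>F. \<Sum>\<^sub>\<infinity>e\<in>E. g e f)" if A: "finite A" "A \<subseteq> E" for A
  proof -
    have "(\<Sum>e\<in>A. \<Sum>\<^sub>\<infinity>f\<in>F. g e f) = (\<Sum>\<^sub>\<infinity>f\<in>F. \<Sum>e\<in>A. g e f)"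
      using A(1)
      by (induction A) (auto simp: infsum_add ennreal_summable_on)
    also have "\<dots> \<le> (\<Sum>\<^sub>\<infinity>f\<in>F. \<Sum>\<^sub>\<infinity>e\<in>E. g e f)"
    proof (rule infsum_mono)
      show "(\<Sum>e\<in>A. g e f) \<le> (\<Sum>\<^sub>\<infinity>e\<in>E. g e f)" for f
        by (subst nonneg_infsum_complete) (use A in \<open>auto intro: SUP_upper\<close>)
    qed (simp_all add: ennreal_summable_on)
    finally show ?thesis .
  qed
  then show ?thesis
    by (subst nonneg_infsum_complete) (auto intro!: SUP_least)
qed

lemma infsum_swap_ennreal:
  fixes g :: "'a \<Rightarrow> 'b \<Rightarrow> ennreal"
  shows "(\<Sum>\<^sub>\<infinity>e\<in>E. \<Sum>\<^sub>\<infinity>f\<in>F. g e f) = (\<Sum>\<^sub>\<infinity>f\<in>F. \<Sum>\<^sub>\<infinity>e\<in>E. g e f)"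
  by (intro antisym infsum_swap_le_ennreal)

text \<open>An operator and its adjoint have the same Hilbert-Schmidt norm, both being the sum of
  all squared matrix entries.  As the matrix may be taken between any two bases, this also shows
  that the norm does not depend on the basis.\<close>

lemma hs_norm_sq_adjoint:
  assumes N: "closed_subspace N" and M: "closed_subspace M"
    and S: "\<And>x. x \<in> N \<Longrightarrow> S x \<in> M" and S': "\<And>y. y \<in> M \<Longrightarrow> S' y \<in> N"
    and adj: "\<And>x y. x \<in> N \<Longrightarrow> y \<in> M \<Longrightarrow> cinner (S x) y = cinner x (S' y)"
  shows "hs_norm_sq N S = hs_norm_sq M S'"
proof -
  define E where "E = (SOME E. orthonormal_basis N E)"
  define F where "F = (SOME E. orthonormal_basis M E)"
  have E: "orthonormal_basis N E" unfolding E_def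
    by (rule someI_ex[OF orthonormal_basis_exists[OF N]])
  have F: "orthonormal_basis M F" unfolding F_def
    by (rule someI_ex[OF orthonormal_basis_exists[OF M]])
  have EN: "E \<subseteq> N" and FM: "F \<subseteq> M" using E F by (auto simp: orthonormal_basis_def)
  have "hs_norm_sq N S = (\<Sum>\<^sub>\<infinity>e\<in>E. ennreal ((norm (S e))^2))"
    by (simp add: hs_norm_sq_def E_def)
  also have "\<dots> = (\<Sum>\<^sub>\<infinity>e\<in>E. \<Sum>\<^sub>\<infinity>f\<in>F. ennreal ((cmod (cinner (S e) f))^2))"
    using EN S by (intro infsum_cong Parseval_identity[OF F, symmetric]) auto
  also have "\<dots> = (\<Sum>\<^sub>\<infinity>f\<in>F. \<Sum>\<^sub>\<infinity>e\<in>E. ennreal ((cmod (cinner (S e) f))^2))"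
    by (rule infsum_swap_ennreal)
  also have "\<dots> = (\<Sum>\<^sub>\<infinity>f\<in>F. \<Sum>\<^sub>\<infinity>e\<in>E. ennreal ((cmod (cinner (S' f) e))^2))"
  proof (intro infsum_cong arg_cong[where f = ennreal] arg_cong[where f = "\<lambda>x. x^2"])
    fix f e assume "f \<in> F" "e \<in> E"
    then have "cinner (S e) f = cnj (cinner (S' f) e)"
      using adj[of e f] EN FM cinner_commute[of e "S' f"] by auto
    then show "cmod (cinner (S e) f) = cmod (cinner (S' f) e)" by simp
  qed
  also have "\<dots> = (\<Sum>\<^sub>\<infinity>f\<in>F. ennreal ((norm (S' f))^2))"
    using FM S' by (intro infsum_cong Parseval_identity[OF E]) auto
  also have "\<dots> = hs_norm_sq M S'" by (simp add: hs_norm_sq_def F_def)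
  finally show ?thesis .
qed

lemma hs_norm_sq_cong:
  assumes N: "closed_subspace N" and "\<And>x. x \<in> N \<Longrightarrow> norm (S x) = norm (T x)"
  shows "hs_norm_sq N S = hs_norm_sq N T"
proof -
  define E where "E = (SOME E. orthonormal_basis N E)"
  have "orthonormal_basis N E" unfolding E_def
    by (rule someI_ex[OF orthonormal_basis_exists[OF N]])
  then have "E \<subseteq> N" by (simp add: orthonormal_basis_def)
  then show ?thesis unfolding hs_norm_sq_def E_def[symmetric]
    by (intro infsum_cong) (use assms(2) in auto)
qed

lemma hs_norm_sq_Pythagoras:
  assumes N: "closed_subspace N"
    and "\<And>x. x \<in> N \<Longrightarrow> (norm (T x))^2 = (norm (S1 x))^2 + (norm (S2 x))^2"
  shows "hs_norm_sq N T = hs_norm_sq N S1 + hs_norm_sq N S2"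
proof -
  define E where "E = (SOME E. orthonormal_basis N E)"
  have "orthonormal_basis N E" unfolding E_def
    by (rule someI_ex[OF orthonormal_basis_exists[OF N]])
  then have "E \<subseteq> N" by (simp add: orthonormal_basis_def)
  then have "(\<Sum>\<^sub>\<infinity>e\<in>E. ennreal ((norm (T e))^2))
      = (\<Sum>\<^sub>\<infinity>e\<in>E. ennreal ((norm (S1 e))^2) + ennreal ((norm (S2 e))^2))"
    by (intro infsum_cong) (use assms(2) in auto)
  then show ?thesis by (simp add: hs_norm_sq_def E_def infsum_add ennreal_summable_on)
qed

text \<open>Compression to a dense set of test vectors: if \<open>T\<^sub>N\<close> is \<open>K T J\<^sup>*\<close> for isometries
  \<open>J, K\<close> from \<open>M\<close> to \<open>N\<close>, then both operators have the same Hilbert-Schmidt norm.  It is enough to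
  know \<open>T\<^sub>N\<close> and \<open>J\<^sup>*\<close> on vectors spanning a dense subspace, because the identity is
  tested on the adjoints.\<close>

lemma hs_norm_sq_conjugate:
  assumes N: "N = closure (h2_span G)" and M: "closed_subspace M"
    and TN: "\<And>x. x \<in> N \<Longrightarrow> TN x \<in> N" "\<And>x. x \<in> N \<Longrightarrow> TN' x \<in> N"
      "\<And>x y. x \<in> N \<Longrightarrow> y \<in> N \<Longrightarrow> cinner (TN x) y = cinner x (TN' y)"
    and T: "\<And>x. x \<in> M \<Longrightarrow> T x \<in> M" "\<And>x. x \<in> M \<Longrightarrow> T' x \<in> M"
      "\<And>x y. x \<in> M \<Longrightarrow> y \<in> M \<Longrightarrow> cinner (T x) y = cinner x (T' y)"
    and J: "\<And>m. m \<in> M \<Longrightarrow> J m \<in> N" "\<And>m. norm (J m) = norm m"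
    and K: "bounded_op K" "\<And>m. m \<in> M \<Longrightarrow> K m \<in> N" "\<And>m. norm (K m) = norm m"
    and G: "\<And>x. x \<in> G \<Longrightarrow> \<exists>m\<in>M. TN x = K (T m) \<and> (\<forall>m'\<in>M. cinner x (J m') = cinner m m')"
  shows "hs_norm_sq N TN = hs_norm_sq M T"
proof -
  have NC: "closed_subspace N" unfolding N by (rule closed_subspace_closure_span)
  define W where "W = adj_on M K"
  note W = adj_on[OF K(1) M, folded W_def]
  have TN': "TN' y = J (T' (W y))" if y: "y \<in> N" for y
  proof -
    define d where "d = TN' y - J (T' (W y))"
    have W1: "T' (W y) \<in> M" by (intro T(2) W(1))
    have dN: "d \<in> N" unfolding d_def
      by (intro closed_subspaceD(4)[OF NC] TN(2) J(1) y W1)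
    have "G \<subseteq> {x. cinner x d = cinner x 0}"
    proof
      fix x assume x: "x \<in> G"
      then have xN: "x \<in> N" unfolding N by (rule in_closure_span)
      obtain m where m: "m \<in> M" "TN x = K (T m)" "\<And>m'. m' \<in> M \<Longrightarrow> cinner x (J m') = cinner m m'"
        using G[OF x] by blast
      have "cinner x (TN' y) = cinner (K (T m)) y"
        using TN(3)[OF xN y] m(2) by simp
      also have "\<dots> = cinner (T m) (W y)" by (rule W(2)[symmetric]) (rule T(1)[OF m(1)])
      also have "\<dots> = cinner x (J (T' (W y)))"
        using T(3)[OF m(1) W(1)] m(3)[OF W1] by simp
      finally show "x \<in> {x. cinner x d = cinner x 0}" by (simp add: d_def cinner_diff_right)
    qed
    then have "N \<subseteq> {x. cinner x d = cinner x 0}"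
      unfolding N by (intro closed_subspaceD(7) closed_subspace_weak_eq bounded_op_id)
    then have "cinner d d = 0" using dN by auto
    then show ?thesis by (simp add: cinner_norm_sq d_def)
  qed
  have TW: "T' (W x) \<in> M" for x by (intro T(2) W(1))
  have "hs_norm_sq N TN = hs_norm_sq N TN'"
    by (rule hs_norm_sq_adjoint[OF NC NC TN])
  also have "\<dots> = hs_norm_sq N (\<lambda>y. T' (W y))"
    by (rule hs_norm_sq_cong[OF NC]) (simp add: TN' J(2))
  also have "\<dots> = hs_norm_sq M (\<lambda>m. K (T m))"
  proof (rule hs_norm_sq_adjoint[OF NC M TW K(2)[OF T(1)]])
    fix x y assume "x \<in> N" and y: "y \<in> M"
    have "cinner (T' (W x)) y = cnj (cinner (T y) (W x))"
      by (subst T(3)[OF y W(1)]) (rule cinner_commute)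
    also have "\<dots> = cnj (cinner (K (T y)) x)"
      by (subst W(2)[OF T(1)[OF y]]) simp
    finally show "cinner (T' (W x)) y = cinner x (K (T y))"
      by (simp add: cinner_commute[of x])
  qed
  also have "\<dots> = hs_norm_sq M T"
    by (rule hs_norm_sq_cong[OF M]) (simp add: K(3))
  finally show ?thesis .
qed

section \<open>Commutators of isometries on closed subspaces\<close>

definition isometric :: "(hardy2 \<Rightarrow> hardy2) \<Rightarrow> bool" where
  "isometric T \<longleftrightarrow> (\<forall>x y. cinner (T x) (T y) = cinner x y)"

lemma isometricD: "isometric T \<Longrightarrow> cinner (T x) (T y) = cinner x y"
  by (simp add: isometric_def)

lemma isometric_norm: "isometric T \<Longrightarrow> norm (T x) = norm x"
  by (rule norm_eqI_cinner) (simp add: isometric_def)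

lemma adj_on_linear:
  assumes A: "bounded_op A" and M: "closed_subspace M"
  shows "adj_on M A (x + y) = adj_on M A x + adj_on M A y"
    "adj_on M A (x - y) = adj_on M A x - adj_on M A y"
    "adj_on M A (cscale a x) = cscale a (adj_on M A x)"
  by (intro adj_on(3)[OF A M] closed_subspaceD(2-4)[OF M] adj_on(1)[OF A M];
      simp add: cinner_simps adj_on(2)[OF A M])+

lemma adj_on_isometric:
  assumes "bounded_op A" "closed_subspace M" "isometric A" "x \<in> M"
  shows "adj_on M A (A x) = x"
  using assms by (intro adj_on(3)) (simp_all add: isometric_def)

lemma cinner_adj_on_left:
  assumes A: "bounded_op A" and M: "closed_subspace M" and h: "h \<in> M"
  shows "cinner (adj_on M A f) h = cinner f (A h)"
  using adj_on(2)[OF A M h, of f] cinner_commute by metis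

lemma commutator_in:
  assumes "bounded_op A" "closed_subspace N" "\<And>x. x \<in> N \<Longrightarrow> B x \<in> N" "x \<in> N"
  shows "commutator (adj_on N A) B x \<in> N"
  unfolding commutator_def
  by (intro closed_subspaceD(4)[OF assms(2)] adj_on(1)[OF assms(1,2)] assms(3))

lemma cinner_commutator:
  assumes N: "closed_subspace N" and A: "bounded_op A" "\<And>x. x \<in> N \<Longrightarrow> A x \<in> N"
    and B: "bounded_op B" "\<And>x. x \<in> N \<Longrightarrow> B x \<in> N" and x: "x \<in> N" and y: "y \<in> N"
  shows "cinner (commutator (adj_on N A) B x) y = cinner x (commutator (adj_on N B) A y)"
proof -
  note As = adj_on(1,2)[OF A(1) N] and Bs = adj_on(1,2)[OF B(1) N]
  have "cinner (B (adj_on N A x)) y = cinner x (A (adj_on N B y))"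
    by (simp only: Bs(2)[OF As(1), symmetric] cinner_adj_on_left[OF A(1) N Bs(1)])
  moreover have "cinner (adj_on N A (B x)) y = cinner x (adj_on N B (A y))"
    by (simp add: cinner_adj_on_left[OF A(1) N y] Bs(2)[OF x])
  ultimately show ?thesis by (simp add: commutator_def cinner_simps)
qed

lemma commutator_self:
  assumes "bounded_op A" "closed_subspace N" "isometric A" "x \<in> N"
  shows "commutator (adj_on N A) A x = x - A (adj_on N A x)"
  by (simp add: commutator_def adj_on_isometric[OF assms])

text \<open>With \<open>P\<close>, \<open>Q\<close> the projections onto \<open>N \<ominus> Z N\<close> and \<open>N \<ominus> W N\<close> and \<open>X = [Z\<^sup>*, W]\<close>, the
  alternating sum equals \<open>P Q - Z X W\<^sup>*\<close>.  The two summands have orthogonal ranges, and neither the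
  isometry \<open>Z\<close> nor the coisometry \<open>W\<^sup>*\<close> changes the Hilbert-Schmidt norm.\<close>

lemma hs_norm_sq_alternating_sum:
  assumes N: "closed_subspace N" and Z: "bounded_op Z" "isometric Z" "\<And>x. x \<in> N \<Longrightarrow> Z x \<in> N"
    and W: "bounded_op W" "isometric W" "\<And>x. x \<in> N \<Longrightarrow> W x \<in> N"
  shows "hs_norm_sq UNIV (\<lambda>f. let g = ortho_proj N f in g - Z (adj_on N Z g) - W (adj_on N W g)
           + Z (W (adj_on N Z (adj_on N W g))))
    = hs_norm_sq N (commutator (adj_on N Z) Z \<circ> commutator (adj_on N W) W)
      + hs_norm_sq N (commutator (adj_on N Z) W)"
proof -
  define P where "P = commutator (adj_on N Z) Z"
  define Q where "Q = commutator (adj_on N W) W"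
  define X where "X = commutator (adj_on N Z) W"
  define X' where "X' = commutator (adj_on N W) Z"
  define g where "g = ortho_proj N"
  have gN: "g f \<in> N" for f unfolding g_def by (rule ortho_proj(1)[OF N])
  have g: "cinner (g f) h = cinner f h" if "h \<in> N" for f h
    unfolding g_def by (rule ortho_proj(2)[OF N that])
  have PN: "P x \<in> N" and QN: "Q x \<in> N" and XN: "X x \<in> N" and X'N: "X' x \<in> N" if "x \<in> N" for x
    unfolding P_def Q_def X_def X'_def using that by (auto intro!: commutator_in N Z W)
  have Padj: "cinner (P x) y = cinner x (P y)" and Qadj: "cinner (Q x) y = cinner x (Q y)"
    and Xadj: "cinner (X x) y = cinner x (X' y)" if "x \<in> N" "y \<in> N" for x y
    unfolding P_def Q_def X_def X'_def using that by (auto intro!: cinner_commutator N Z W)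
  note P = commutator_self[OF Z(1) N Z(2), folded P_def]
  note Q = commutator_self[OF W(1) N W(2), folded Q_def]
  note Zs = adj_on[OF Z(1) N] and Ws = adj_on[OF W(1) N]
  have decomp: "h - Z (adj_on N Z h) - W (adj_on N W h) + Z (W (adj_on N Z (adj_on N W h)))
      = P (Q h) - Z (X (adj_on N W h))" if h: "h \<in> N" for h
    using P[OF QN[OF h]] Q[OF h]
    by (simp add: X_def commutator_def adj_on_linear[OF Z(1) N] bounded_opD[OF Z(1)])
  have PZ: "P (Z h) = 0" if "h \<in> N" for h
    using that by (simp add: P Z(3) adj_on_isometric[OF Z(1) N Z(2)])
  have pyth: "(norm (P (Q h) - Z (X (adj_on N W h))))^2
      = (norm (P (Q h)))^2 + (norm (X (adj_on N W h)))^2" if h: "h \<in> N" for h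
  proof -
    define u v where "u = P (Q h)" and "v = X (adj_on N W h)"
    have v: "v \<in> N" unfolding v_def by (intro XN Ws(1))
    have "cinner u (Z v) = 0"
      unfolding u_def by (subst Padj) (simp_all add: QN h Z(3) v PZ)
    moreover from this have "cinner (Z v) u = 0" by (subst cinner_commute) simp
    ultimately have "(norm (u - Z v))^2 = (norm u)^2 + (norm (Z v))^2"
      unfolding norm_sq_cinner by (simp add: cinner_diff_left cinner_diff_right)
    then show ?thesis by (simp add: u_def v_def isometric_norm[OF Z(2)])
  qed
  have "hs_norm_sq UNIV (\<lambda>f. let g = ortho_proj N f in g - Z (adj_on N Z g) - W (adj_on N W g)
           + Z (W (adj_on N Z (adj_on N W g))))
      = hs_norm_sq UNIV (\<lambda>f. P (Q (g f))) + hs_norm_sq UNIV (\<lambda>f. X (adj_on N W (g f)))"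
    by (rule hs_norm_sq_Pythagoras[OF closed_subspace_UNIV])
       (simp only: g_def[symmetric] Let_def decomp[OF gN] pyth[OF gN])
  also have "hs_norm_sq UNIV (\<lambda>f. P (Q (g f))) = hs_norm_sq N (\<lambda>y. Q (P y))"
    by (rule hs_norm_sq_adjoint[OF closed_subspace_UNIV N])
       (simp_all add: PN QN gN Padj Qadj g)
  also have "\<dots> = hs_norm_sq N (P \<circ> Q)"
    by (rule hs_norm_sq_adjoint[OF N N]) (simp_all add: PN QN Padj Qadj)
  also have "hs_norm_sq UNIV (\<lambda>f. X (adj_on N W (g f))) = hs_norm_sq N (\<lambda>y. W (X' y))"
  proof (rule hs_norm_sq_adjoint[OF closed_subspace_UNIV N])
    show "cinner (X (adj_on N W (g x))) y = cinner x (W (X' y))" if y: "y \<in> N" for x y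
      using y by (simp add: Xadj Ws(1) cinner_adj_on_left[OF W(1) N] X'N W(3) g)
  qed (simp_all add: XN Ws(1))
  also have "\<dots> = hs_norm_sq N X'"
    by (rule hs_norm_sq_cong[OF N]) (rule isometric_norm[OF W(2)])
  also have "\<dots> = hs_norm_sq N X"
    by (rule hs_norm_sq_adjoint[OF N N, symmetric]) (simp_all add: XN X'N Xadj)
  finally show ?thesis unfolding P_def Q_def X_def .
qed

section \<open>Amplification of a pair of isometries\<close>

text \<open>
  The following locale describes, without reference to analytic functions, the way in which
  \<open>N = M\<^sub>\<theta>\<^sub>,\<^sub>\<phi>\<close> arises from \<open>M\<close>.  Model \<open>N\<close> as \<open>K \<otimes> L \<otimes> M\<close>, where \<open>K\<close> and \<open>L\<close> are spaces of functions
  of one variable containing the constant function \<open>1\<close>.  Then \<open>V\<close> embeds \<open>M\<close> as \<open>1 \<otimes> 1 \<otimes> M\<close>, and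
  \<open>E\<^sub>l\<close> and \<open>F\<^sub>m\<close> multiply by the reproducing kernels \<open>k\<^sub>l\<close> of \<open>K\<close> and \<open>k\<^sub>m\<close> of \<open>L\<close>, whose values are \<open>\<kappa>\<close>
  and \<open>\<rho>\<close>.  The isometry \<open>Z\<close> is a shift along \<open>K\<close> except that, when it leaves \<open>K\<close>, it falls back on
  \<open>1\<close> and applies \<open>A\<close> to \<open>M\<close>: with \<open>u\<close> the last vector of \<open>K\<close>, which \<open>U\<close> produces from \<open>1\<close>, this is the
  relation \<open>Z U V = V A\<close>.  Similarly for \<open>W\<close>, \<open>Y\<close>, \<open>B\<close> and the second variable.

  The equation \<open>E_eq\<close> says that \<open>k\<^sub>l\<close> is \<open>(1 - t \<tau>) / (1 - s z)\<close> with \<open>s\<close>, \<open>t\<close> the conjugates of \<open>l\<close>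
  and \<open>\<tau>(l)\<close>, and with \<open>\<tau> = z u\<close>.  It can be solved for \<open>Z E\<^sub>l\<close> unless \<open>l = 0\<close>; this is why
  \<open>l = 0\<close> and \<open>m = 0\<close> are left out of the spanning set in \<open>N_eq\<close>.

  In this model the defect \<open>I - Z Z\<^sup>*\<close> is the projection onto \<open>1\<close> in the first factor, tensored with
  \<open>I - A A\<^sup>*\<close>; and \<open>[Z\<^sup>*, W]\<close> is a rank one operator on \<open>K \<otimes> L\<close> of norm one, tensored with
  \<open>[A\<^sup>*, B]\<close>.  The lemmas below verify this on the spanning vectors.
\<close>

locale amplification =
  fixes M N :: "hardy2 set" and Z U A W Y B V :: "hardy2 \<Rightarrow> hardy2"
    and E F :: "complex \<Rightarrow> hardy2 \<Rightarrow> hardy2"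
    and \<tau> \<sigma> :: "complex \<Rightarrow> complex" and \<kappa> \<rho> :: "complex \<Rightarrow> complex \<Rightarrow> complex"
  assumes M: "closed_subspace M"
    and A: "bounded_op A" "isometric A" "\<And>x. x \<in> M \<Longrightarrow> A x \<in> M"
    and B: "bounded_op B" "isometric B" "\<And>x. x \<in> M \<Longrightarrow> B x \<in> M"
    and V: "bounded_op V" "isometric V" "\<And>x. x \<in> M \<Longrightarrow> V x \<in> N"
    and Z: "bounded_op Z" "isometric Z" "\<And>x. x \<in> N \<Longrightarrow> Z x \<in> N"
    and W: "bounded_op W" "isometric W" "\<And>x. x \<in> N \<Longrightarrow> W x \<in> N"
    and U: "bounded_op U" "isometric U" "\<And>x. x \<in> N \<Longrightarrow> U x \<in> N"
    and Y: "bounded_op Y" "isometric Y" "\<And>x. x \<in> N \<Longrightarrow> Y x \<in> N"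
    and E: "\<And>l. l \<in> disk \<Longrightarrow> bounded_op (E l)" "\<And>l x. l \<in> disk \<Longrightarrow> x \<in> N \<Longrightarrow> E l x \<in> N"
    and F: "\<And>m. m \<in> disk \<Longrightarrow> bounded_op (F m)" "\<And>m x. m \<in> disk \<Longrightarrow> x \<in> N \<Longrightarrow> F m x \<in> N"
    and comm: "\<And>x. Z (W x) = W (Z x)" "\<And>x. U (Y x) = Y (U x)"
      "\<And>x. Z (Y x) = Y (Z x)" "\<And>x. U (W x) = W (U x)"
    and comm_F: "\<And>m x. m \<in> disk \<Longrightarrow> Z (F m x) = F m (Z x)" "\<And>m x. m \<in> disk \<Longrightarrow> U (F m x) = F m (U x)"
    and comm_E: "\<And>l x. l \<in> disk \<Longrightarrow> W (E l x) = E l (W x)" "\<And>l x. l \<in> disk \<Longrightarrow> Y (E l x) = E l (Y x)"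
    and comm_EF: "\<And>l m x. l \<in> disk \<Longrightarrow> m \<in> disk \<Longrightarrow> E l (F m x) = F m (E l x)"
    and ZUV: "\<And>x. Z (U (V x)) = V (A x)" and WYV: "\<And>x. W (Y (V x)) = V (B x)"
    and E_eq: "\<And>l x. l \<in> disk \<Longrightarrow>
      E l x = x + cscale (cnj l) (Z (E l x)) - cscale (cnj (\<tau> l)) (Z (U x))"
    and F_eq: "\<And>m x. m \<in> disk \<Longrightarrow>
      F m x = x + cscale (cnj m) (W (F m x)) - cscale (cnj (\<sigma> m)) (W (Y x))"
    and E_0: "\<And>x. E 0 x = x" and F_0: "\<And>x. F 0 x = x"
    and gram: "\<And>l m l' m' x y. l \<in> disk \<Longrightarrow> m \<in> disk \<Longrightarrow> l' \<in> disk \<Longrightarrow> m' \<in> disk \<Longrightarrow>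
      cinner (E l (F m (V x))) (E l' (F m' (V y))) = \<kappa> l l' * \<rho> m m' * cinner x y"
    and \<kappa>_0: "\<And>l. l \<in> disk \<Longrightarrow> \<kappa> l 0 = 1" "\<And>l. l \<in> disk \<Longrightarrow> \<kappa> 0 l = 1"
    and \<rho>_0: "\<And>m. m \<in> disk \<Longrightarrow> \<rho> m 0 = 1" "\<And>m. m \<in> disk \<Longrightarrow> \<rho> 0 m = 1"
    and N_eq: "N = closure (h2_span {E l (F m (V x)) | l m x. l \<in> disk - {0} \<and> m \<in> disk - {0} \<and> x \<in> M})"
begin

lemma swapped: "amplification M N W Y B Z U A V F E \<sigma> \<tau> \<rho> \<kappa>"
proof -
  have "{E l (F m (V x)) | l m x. l \<in> disk - {0} \<and> m \<in> disk - {0} \<and> x \<in> M} =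
    {F l (E m (V x)) | l m x. l \<in> disk - {0} \<and> m \<in> disk - {0} \<and> x \<in> M}"
    by (intro Collect_cong) (metis DiffD1 comm_EF)
  with N_eq have eq: "N = closure (h2_span {F l (E m (V x)) | l m x. l \<in> disk - {0} \<and> m \<in> disk - {0} \<and> x \<in> M})"
    by simp
  have gram': "cinner (F l (E m (V x))) (F l' (E m' (V y))) = \<rho> l l' * \<kappa> m m' * cinner x y"
    if "l \<in> disk" "m \<in> disk" "l' \<in> disk" "m' \<in> disk" for l m l' m' x y
    using gram[of m l m' l' x y] comm_EF that by simp
  have comm_FE: "F l (E m x) = E m (F l x)" if "l \<in> disk" "m \<in> disk" for l m x
    using comm_EF that by simp
  show ?thesis
    by unfold_locales
       (fact M A B V Z W U Y E F comm comm[symmetric] comm_F comm_E comm_FE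
         ZUV WYV E_eq F_eq E_0 F_0 gram' \<kappa>_0 \<rho>_0 eq)+
qed

lemma N: "closed_subspace N"
  unfolding N_eq by (rule closed_subspace_closure_span)

abbreviation "Zs \<equiv> adj_on N Z"
abbreviation "Ws \<equiv> adj_on N W"
abbreviation "As \<equiv> adj_on M A"
abbreviation "Bs \<equiv> adj_on M B"

lemma disk_0: "0 \<in> disk" by simp

lemma cscale_Z_E:
  "l \<in> disk \<Longrightarrow> cscale (cnj l) (Z (E l x)) = E l x - x + cscale (cnj (\<tau> l)) (Z (U x))"
  using E_eq[of l x] by (simp add: algebra_simps)

lemma ZUFV: "m \<in> disk \<Longrightarrow> Z (U (F m (V x))) = F m (V (A x))"
  by (simp add: comm_F ZUV)

text \<open>Up to a factor \<open>E_eq\<close> turns \<open>Z E\<^sub>l\<close> into \<open>E\<^sub>l - 1\<close> plus a multiple of \<open>Z U\<close>.  The difference does not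
  contribute, because all kernels have the same inner product with the kernel at zero, which
  is the constant function.\<close>

lemma cinner_Z_E:
  assumes l: "l \<in> disk" and m: "m \<in> disk" "m' \<in> disk"
  shows "cnj l * cinner (Z (E l (F m (V x)))) (F m' (V y)) = cnj (\<tau> l) * \<rho> m m' * cinner (A x) y"
proof -
  have "cnj l * cinner (Z (E l (F m (V x)))) (F m' (V y))
      = cinner (cscale (cnj l) (Z (E l (F m (V x))))) (F m' (V y))"
    by (simp add: cinner_simps)
  also have "\<dots> = cinner (E l (F m (V x))) (F m' (V y)) - cinner (F m (V x)) (F m' (V y))
      + cnj (\<tau> l) * cinner (F m (V (A x))) (F m' (V y))"
    by (simp only: cscale_Z_E[OF l] ZUFV[OF m(1)] cinner_simps)
  also have "\<dots> = cnj (\<tau> l) * \<rho> m m' * cinner (A x) y"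
    using gram[OF l m(1) disk_0 m(2), of x y] gram[OF disk_0 m(1) disk_0 m(2)] \<kappa>_0 l
    by (simp add: E_0)
  finally show ?thesis .
qed

text \<open>On \<open>1 \<otimes> L \<otimes> M\<close> the adjoint of \<open>Z\<close> is \<open>A\<^sup>*\<close> followed by a step back to the last vector of \<open>K\<close>.
  Both sides are compared on the spanning vectors.\<close>

lemma Zs_FV:
  assumes m: "m \<in> disk" and x: "x \<in> M"
  shows "Zs (F m (V x)) = U (F m (V (As x)))"
proof (rule adj_on(3)[OF Z(1) N])
  have Asx: "As x \<in> M" by (rule adj_on(1)[OF A(1) M])
  show "U (F m (V (As x))) \<in> N" by (intro U F V m Asx)
  have "N \<subseteq> {h. cinner (Z h) (F m (V x)) = cinner h (U (F m (V (As x))))}" (is "_ \<subseteq> ?R")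
    unfolding N_eq
  proof (rule closed_subspaceD(7))
    show "closed_subspace ?R" by (intro closed_subspace_weak_eq Z bounded_op_id)
    show "{E l (F m (V x)) | l m x. l \<in> disk - {0} \<and> m \<in> disk - {0} \<and> x \<in> M} \<subseteq> ?R"
    proof
      fix h assume "h \<in> {E l (F m (V x)) | l m x. l \<in> disk - {0} \<and> m \<in> disk - {0} \<and> x \<in> M}"
      then obtain l n y where h_def: "h = E l (F n (V y))" and l: "l \<in> disk" "l \<noteq> 0"
        and n: "n \<in> disk" and y: "y \<in> M" by blast
      have "cnj l * cinner h (U (F m (V (As x)))) = cnj l * cinner (Z h) (Z (U (F m (V (As x)))))"
        by (simp add: isometricD[OF Z(2)])
      also have "\<dots> = cnj (\<tau> l) * \<rho> n m * cinner (A y) (A (As x))"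
        unfolding h_def ZUFV[OF m] by (rule cinner_Z_E[OF l(1) n m])
      also have "\<dots> = cnj (\<tau> l) * \<rho> n m * cinner (A y) x"
        by (simp add: isometricD[OF A(2)] adj_on(2)[OF A(1) M y])
      also have "\<dots> = cnj l * cinner (Z h) (F m (V x))"
        unfolding h_def by (rule cinner_Z_E[OF l(1) n m, symmetric])
      finally show "h \<in> ?R" using l(2) by simp
    qed
  qed
  then show "cinner (Z h) (F m (V x)) = cinner h (U (F m (V (As x))))" if "h \<in> N" for h
    using that by blast
qed

text \<open>This is the product rule for the backward shift: \<open>E\<^sub>l x - x\<close> is in the range of \<open>Z\<close>, and
  \<open>Z\<^sup>*\<close> inverts \<open>Z\<close> there.\<close>

lemma Zs_E:
  assumes l: "l \<in> disk" and x: "x \<in> N"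
  shows "Zs (E l x) = Zs x + cscale (cnj l) (E l x) - cscale (cnj (\<tau> l)) (U x)"
proof -
  note lin = adj_on_linear[OF Z(1) N]
  have "Zs (E l x) = Zs (x + cscale (cnj l) (Z (E l x)) - cscale (cnj (\<tau> l)) (Z (U x)))"
    using E_eq[OF l] by simp
  also have "\<dots> = Zs x + cscale (cnj l) (Zs (Z (E l x))) - cscale (cnj (\<tau> l)) (Zs (Z (U x)))"
    by (simp only: lin)
  finally show ?thesis
    by (simp only: adj_on_isometric[OF Z(1) N Z(2)] E(2)[OF l x] U(3)[OF x])
qed

text \<open>The defect annihilates the range of \<open>Z\<close>, so it sees only the value \<open>1\<close> of the kernel at zero.\<close>

lemma defect_E:
  assumes l: "l \<in> disk" and x: "x \<in> N"
  shows "commutator Zs Z (E l x) = commutator Zs Z x"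
proof -
  have "Z (Zs (E l x)) = Z (Zs x) + (E l x - x)"
    unfolding Zs_E[OF l x] by (simp add: bounded_opD[OF Z(1)] cscale_Z_E[OF l])
  then show ?thesis
    by (simp add: commutator_self[OF Z(1) N Z(2) E(2)[OF l x]] commutator_self[OF Z(1) N Z(2) x])
qed

lemma defect_FV:
  assumes m: "m \<in> disk" and x: "x \<in> M"
  shows "commutator Zs Z (F m (V x)) = F m (V (commutator As A x))"
  by (simp only: commutator_self[OF Z(1) N Z(2) F(2)[OF m V(3)[OF x]]]
      commutator_self[OF A(1) M A(2) x] Zs_FV[OF m x] ZUFV[OF m]
      bounded_opD[OF F(1)[OF m]] bounded_opD[OF V(1)])

text \<open>The terms by which the product rule differs from \<open>Z\<^sup>* x\<close> commute with \<open>W\<close>.\<close>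

lemma cross_E:
  assumes l: "l \<in> disk" and x: "x \<in> N"
  shows "commutator Zs W (E l x) = commutator Zs W x"
  using l x by (simp add: commutator_def comm_E(1) Zs_E W(3) bounded_opD[OF W(1)] comm(4))

end

context amplification begin

interpretation swap: amplification M N W Y B Z U A V F E \<sigma> \<tau> \<rho> \<kappa>
  by (rule swapped)

text \<open>Multiplied by the conjugate of \<open>m\<close>, the vector \<open>W F\<^sub>m V x\<close> is a combination of vectors on which \<open>Z\<^sup>*\<close>
  is known.  All terms cancel except for the ones where \<open>W\<close> wraps around and \<open>B\<close> meets
  \<open>A\<^sup>*\<close>.\<close>

lemma cross_FV:
  assumes m: "m \<in> disk" and x: "x \<in> M"
  shows "cscale (cnj m) (commutator Zs W (F m (V x)))
    = cscale (cnj (\<sigma> m)) (U (V (commutator As B x)))"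
proof -
  note lin = adj_on_linear[OF Z(1) N]
  have Asx: "As x \<in> M" by (rule adj_on(1)[OF A(1) M])
  have F0: "Zs (V y) = U (V (As y))" if "y \<in> M" for y
    using Zs_FV[OF disk_0 that] by (simp add: F_0)
  have WF: "cscale (cnj m) (W (F m (V y))) = F m (V y) - V y + cscale (cnj (\<sigma> m)) (V (B y))" for y
    using swap.cscale_Z_E[OF m, of "V y"] by (simp add: WYV)
  have "cscale (cnj m) (Zs (W (F m (V x)))) = Zs (cscale (cnj m) (W (F m (V x))))"
    by (simp only: lin)
  also have "\<dots> = U (F m (V (As x))) - U (V (As x)) + cscale (cnj (\<sigma> m)) (U (V (As (B x))))"
    by (simp only: WF lin Zs_FV[OF m x] F0[OF x] F0[OF B(3)[OF x]])
  finally have 1: "cscale (cnj m) (Zs (W (F m (V x))))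
    = U (F m (V (As x))) - U (V (As x)) + cscale (cnj (\<sigma> m)) (U (V (As (B x))))" .
  have "cscale (cnj m) (W (Zs (F m (V x)))) = U (cscale (cnj m) (W (F m (V (As x)))))"
    by (simp add: Zs_FV[OF m x] comm(4)[symmetric] bounded_opD[OF U(1)])
  also have "\<dots> = U (F m (V (As x))) - U (V (As x)) + cscale (cnj (\<sigma> m)) (U (V (B (As x))))"
    by (simp add: WF bounded_opD[OF U(1)])
  finally have 2: "cscale (cnj m) (W (Zs (F m (V x))))
    = U (F m (V (As x))) - U (V (As x)) + cscale (cnj (\<sigma> m)) (U (V (B (As x))))" .
  show ?thesis
    unfolding commutator_def
    by (simp add: h2.scale_right_diff_distrib 1 2 bounded_opD[OF U(1)] bounded_opD[OF V(1)])
qed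

lemma cinner_EFV_V:
  assumes "l \<in> disk" "m \<in> disk"
  shows "cinner (E l (F m (V x))) (V y) = cinner x y"
  using gram[OF assms disk_0 disk_0, of x y] assms \<kappa>_0 \<rho>_0 by (simp add: E_0 F_0)

lemma cinner_EFV_YV:
  assumes l: "l \<in> disk" and m: "m \<in> disk"
  shows "cnj m * cinner (E l (F m (V x))) (Y (V y)) = cnj (\<sigma> m) * cinner x y"
proof -
  have "cnj m * cinner (E l (F m (V x))) (Y (V y))
      = cnj m * cinner (W (F m (E l (V x)))) (E 0 (V (B y)))"
    using isometricD[OF W(2), of "E l (F m (V x))" "Y (V y)"] l m by (simp add: WYV E_0 comm_EF)
  also have "\<dots> = cnj (\<sigma> m) * cinner x y"
    using swap.cinner_Z_E[OF m l disk_0, of x "B y"] l by (simp add: \<kappa>_0 isometricD[OF B(2)])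
  finally show ?thesis .
qed

text \<open>On the spanning vectors the product of the defects is \<open>V T V\<^sup>*\<close>, where \<open>T\<close> is the product of the
  defects of \<open>A\<close> and \<open>B\<close>.\<close>

theorem hs_norm_sq_defects:
  "hs_norm_sq N (commutator Zs Z \<circ> commutator Ws W) = hs_norm_sq M (commutator As A \<circ> commutator Bs B)"
proof (rule hs_norm_sq_conjugate[OF N_eq M, where J = V and K = V and
      TN' = "commutator Ws W \<circ> commutator Zs Z" and T' = "commutator Bs B \<circ> commutator As A"])
  fix g assume "g \<in> {E l (F m (V x)) | l m x. l \<in> disk - {0} \<and> m \<in> disk - {0} \<and> x \<in> M}"
  then obtain l m x where g: "g = E l (F m (V x))" and l: "l \<in> disk" and m: "m \<in> disk" and x: "x \<in> M"
    by blast
  have EV: "E l (V x) \<in> N" by (intro E V l x)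
  have Bx: "commutator Bs B x \<in> M" by (intro commutator_in B M x)
  have "commutator Ws W g = E l (V (commutator Bs B x))"
    unfolding g comm_EF[OF l m] swap.defect_E[OF m EV] by (rule swap.defect_FV[OF l x])
  moreover have "commutator Zs Z (E l (V (commutator Bs B x))) = V (commutator As A (commutator Bs B x))"
    using defect_E[OF l V(3)[OF Bx]] defect_FV[OF disk_0 Bx] by (simp add: F_0)
  ultimately show "\<exists>m\<in>M. (commutator Zs Z \<circ> commutator Ws W) g = V ((commutator As A \<circ> commutator Bs B) m)
      \<and> (\<forall>m'\<in>M. cinner g (V m') = cinner m m')"
    using x by (intro bexI[of _ x]) (simp_all add: g cinner_EFV_V[OF l m])
qed (simp_all add: commutator_in cinner_commutator M N A B Z W V isometric_norm)

text \<open>On the spanning vectors \<open>[Z\<^sup>*, W]\<close> is \<open>(U V) [A\<^sup>*, B] (Y V)\<^sup>*\<close>, and both \<open>U V\<close> and \<open>Y V\<close> are isometries.\<close>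

theorem hs_norm_sq_cross:
  "hs_norm_sq N (commutator Zs W) = hs_norm_sq M (commutator As B)"
proof (rule hs_norm_sq_conjugate[OF N_eq M, where J = "\<lambda>x. Y (V x)" and K = "\<lambda>x. U (V x)" and
      TN' = "commutator Ws Z" and T' = "commutator Bs A"])
  fix g assume "g \<in> {E l (F m (V x)) | l m x. l \<in> disk - {0} \<and> m \<in> disk - {0} \<and> x \<in> M}"
  then obtain l m x where g: "g = E l (F m (V x))" and l: "l \<in> disk" and m: "m \<in> disk" "m \<noteq> 0"
    and x: "x \<in> M"
    by blast
  have FV: "F m (V x) \<in> N" by (intro F V m x)
  define c where "c = cnj (\<sigma> m) / cnj m"
  have cm: "cnj m \<noteq> 0" using m(2) by simp
  have "cscale (cnj m) (commutator Zs W g) = cscale (cnj m) (cscale c (U (V (commutator As B x))))"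
    using cross_FV[OF m(1) x] cross_E[OF l FV] cm by (simp add: g c_def)
  then have "commutator Zs W g = cscale c (U (V (commutator As B x)))"
    using cm by (simp only: h2.scale_cancel_left) simp
  also have "\<dots> = U (V (commutator As B (cscale c x)))"
    by (simp add: commutator_def adj_on_linear[OF A(1) M] bounded_opD[OF B(1)] bounded_opD[OF V(1)]
        bounded_opD[OF U(1)] h2.scale_right_diff_distrib)
  finally have 1: "commutator Zs W g = U (V (commutator As B (cscale c x)))" .
  have "cinner g (Y (V y)) = cinner (cscale c x) y" for y
    using cinner_EFV_YV[OF l m(1), of x y] cm by (simp add: g c_def cinner_simps field_simps)
  then show "\<exists>m\<in>M. commutator Zs W g = U (V (commutator As B m))
      \<and> (\<forall>m'\<in>M. cinner g (Y (V m')) = cinner m m')"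
    using 1 closed_subspaceD(3)[OF M x] by blast
qed (simp_all add: commutator_in cinner_commutator M N A B Z W V U Y isometric_norm bounded_op_compose)

end

section \<open>Power series on circles\<close>

abbreviation circle_measure :: "real measure" where
  "circle_measure \<equiv> lebesgue_on {0..2*pi}"

lemma integral_cis:
  "integral\<^sup>L circle_measure (\<lambda>t. cis (of_int k * t)) = (if k = 0 then of_real (2 * pi) else 0)"
proof (cases "k = 0")
  case True
  then show ?thesis by (simp add: measure_restrict_space scaleR_conv_of_real)
next
  case False
  have ints: "integrable circle_measure (\<lambda>t. cis (of_int k * t))"
    by (intro continuous_imp_integrable_real continuous_intros)
  have "((\<lambda>t. cis (of_int k * t)) has_integral
      (cis (of_int k * (2*pi)) / (\<i> * of_int k) - cis (of_int k * 0) / (\<i> * of_int k))) {0..2*pi}"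
  proof (rule fundamental_theorem_of_calculus)
    fix t :: real
    have "((\<lambda>z. exp (\<i> * of_int k * z) / (\<i> * of_int k)) has_field_derivative
        exp (\<i> * of_int k * of_real t)) (at (of_real t))"
      using False by (auto intro!: derivative_eq_intros)
    from has_vector_derivative_real_field[OF this, of "{0..2*pi}"]
    show "((\<lambda>t. cis (of_int k * t) / (\<i> * of_int k)) has_vector_derivative cis (of_int k * t))
      (at t within {0..2*pi})"
      by (simp add: cis_conv_exp mult.assoc)
  qed simp
  moreover have "cis (of_int k * (2*pi)) = 1"
    using cis_multiple_2pi[of "of_int k"] by (simp add: mult_ac)
  ultimately have "((\<lambda>t. cis (of_int k * t)) has_integral 0) {0..2*pi}" by simp
  then show ?thesis
    using lebesgue_integral_eq_integral[OF ints] False by (simp add: integral_unique)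
qed

lemma integral_trig_polynomial:
  "integral\<^sup>L circle_measure (\<lambda>t. (cmod (\<Sum>n<N. b n * cis (real n * t)))^2)
    = 2 * pi * (\<Sum>n<N. (cmod (b n))^2)"
proof -
  have "complex_of_real (integral\<^sup>L circle_measure (\<lambda>t. (cmod (\<Sum>n<N. b n * cis (real n * t)))^2))
    = integral\<^sup>L circle_measure (\<lambda>t. of_real ((cmod (\<Sum>n<N. b n * cis (real n * t)))^2))"
    by (rule integral_complex_of_real[symmetric])
  also have "\<dots> = integral\<^sup>L circle_measure
      (\<lambda>t. \<Sum>m<N. \<Sum>n<N. b m * cnj (b n) * cis (of_int (int m - int n) * t))"
  proof (rule Bochner_Integration.integral_cong[OF refl])
    fix t
    have "cis (real m * t) * cnj (cis (real n * t)) = cis (of_int (int m - int n) * t)" for m n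
      by (simp add: cis_cnj cis_mult algebra_simps)
    then show "complex_of_real ((cmod (\<Sum>n<N. b n * cis (real n * t)))^2)
      = (\<Sum>m<N. \<Sum>n<N. b m * cnj (b n) * cis (of_int (int m - int n) * t))"
      unfolding complex_norm_square cnj_sum sum_product
      by (intro sum.cong refl) (simp add: mult_ac)
  qed
  also have "\<dots> = (\<Sum>m<N. \<Sum>n<N. b m * cnj (b n) *
      integral\<^sup>L circle_measure (\<lambda>t. cis (of_int (int m - int n) * t)))"
    by (subst Bochner_Integration.integral_sum; (intro sum.cong refl)?;
        (subst Bochner_Integration.integral_sum)?)
       (auto intro!: continuous_imp_integrable_real continuous_intros)
  also have "\<dots> = (\<Sum>m<N. \<Sum>n<N. if n = m then b m * cnj (b m) * of_real (2 * pi) else 0)"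
    by (intro sum.cong refl) (subst integral_cis, auto)
  also have "\<dots> = of_real (2 * pi * (\<Sum>n<N. (cmod (b n))^2))"
    by (simp add: complex_norm_square sum_distrib_left mult_ac del: of_real_power)
  finally show ?thesis by (simp only: of_real_eq_iff)
qed

lemma Parseval_circle:
  fixes a :: "nat \<Rightarrow> complex"
  assumes f: "\<And>z. cmod z < 1 \<Longrightarrow> (\<lambda>n. a n * z ^ n) sums f z" and r: "0 \<le> r" "r < 1"
  shows "(\<lambda>n. (cmod (a n))^2 * r ^ (2 * n)) sums
      (integral\<^sup>L circle_measure (\<lambda>t. (cmod (f (of_real r * cis t)))^2) / (2 * pi))"
    and "integrable circle_measure (\<lambda>t. (cmod (f (of_real r * cis t)))^2)"
proof -
  define b where "b n = a n * of_real r ^ n" for n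
  define s where "s N t = (\<Sum>n<N. b n * cis (real n * t))" for N t
  have "cmod (of_real ((1 + r) / 2)) < 1" using r unfolding norm_of_real by simp
  from f[OF this] have "summable (\<lambda>n. a n * of_real ((1 + r) / 2) ^ n)"
    by (rule sums_summable)
  then have sb: "summable (\<lambda>n. norm (b n))" unfolding b_def
    by (rule powser_insidea) (use r in \<open>simp only: norm_of_real; simp\<close>)
  define K where "K = (\<Sum>n. norm (b n))"
  have K: "cmod (s N t) \<le> K" for N t
  proof -
    have "cmod (s N t) \<le> (\<Sum>n<N. norm (b n))"
      unfolding s_def by (rule sum_norm_le) (simp add: norm_mult)
    also have "\<dots> \<le> K" unfolding K_def by (rule sum_le_suminf[OF sb]) auto
    finally show ?thesis .
  qed
  have lim: "(\<lambda>N. s N t) \<longlonglongrightarrow> f (of_real r * cis t)" for t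
  proof -
    have "(of_real r * cis t) ^ n = of_real r ^ n * cis (real n * t)" for n
      by (simp only: power_mult_distrib Complex.DeMoivre)
    then show ?thesis
      using f[of "of_real r * cis t"] r
      by (simp add: s_def b_def sums_def norm_mult mult.assoc)
  qed
  have lim2: "(\<lambda>N. (cmod (s N t))^2) \<longlonglongrightarrow> (cmod (f (of_real r * cis t)))^2" for t
    by (intro tendsto_intros lim)
  have meas: "(\<lambda>t. (cmod (s N t))^2) \<in> borel_measurable circle_measure" for N
    unfolding s_def by (intro continuous_imp_measurable_on_sets_lebesgue continuous_intros) auto
  have measf: "(\<lambda>t. (cmod (f (of_real r * cis t)))^2) \<in> borel_measurable circle_measure"
    by (rule borel_measurable_LIMSEQ_metric[OF meas]) (rule lim2)
  have bound: "norm ((cmod (s N t))^2) \<le> K^2" for N t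
    using K[of N t] by (simp add: power_mono)
  have "(\<lambda>N. integral\<^sup>L circle_measure (\<lambda>t. (cmod (s N t))^2)) \<longlonglongrightarrow>
      integral\<^sup>L circle_measure (\<lambda>t. (cmod (f (of_real r * cis t)))^2)"
    by (rule integral_dominated_convergence[where w = "\<lambda>_. K^2"])
       (use measf meas lim2 bound in auto)
  then have "(\<lambda>N. 2 * pi * (\<Sum>n<N. (cmod (b n))^2) / (2 * pi)) \<longlonglongrightarrow>
      integral\<^sup>L circle_measure (\<lambda>t. (cmod (f (of_real r * cis t)))^2) / (2 * pi)"
    unfolding s_def integral_trig_polynomial by (intro tendsto_intros) auto
  moreover have "(cmod (b n))^2 = (cmod (a n))^2 * r ^ (2 * n)" for n
    using r by (simp add: b_def norm_mult norm_power power_mult_distrib power_mult[symmetric] mult.commute)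
  ultimately show "(\<lambda>n. (cmod (a n))^2 * r ^ (2 * n)) sums
      (integral\<^sup>L circle_measure (\<lambda>t. (cmod (f (of_real r * cis t)))^2) / (2 * pi))"
    by (simp add: sums_def)
  show "integrable circle_measure (\<lambda>t. (cmod (f (of_real r * cis t)))^2)"
    by (rule integrable_dominated_convergence[where w = "\<lambda>_. K^2" and s = "\<lambda>N t. (cmod (s N t))^2"])
       (use measf meas lim2 bound in auto)
qed

text \<open>By Parseval's identity on the circle of radius one half.\<close>

lemma power_series_zero_imp:
  assumes "\<And>z. cmod z < 1 \<Longrightarrow> (\<lambda>n. a n * z ^ n) sums (0 :: complex)"
  shows "a n = 0"
proof -
  have "(\<lambda>n. (cmod (a n))^2 * (1/2) ^ (2 * n)) sums 0"
    using Parseval_circle(1)[OF assms, of "1/2"] by simp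
  then have s: "summable (\<lambda>n. (cmod (a n))^2 * (1/2) ^ (2 * n))"
      "(\<Sum>n. (cmod (a n))^2 * (1/2) ^ (2 * n)) = 0"
    by (auto simp: sums_iff)
  then have "\<forall>n. (cmod (a n))^2 * (1/2) ^ (2 * n) = 0"
    by (subst (asm) suminf_eq_zero_iff) auto
  then show ?thesis by simp
qed

lemma square_summable_power_series:
  fixes a :: "nat \<Rightarrow> complex"
  assumes a: "summable (\<lambda>n. (cmod (a n))^2)" and z: "cmod z < 1"
  shows "summable (\<lambda>n. norm (a n * z ^ n))"
proof -
  have "(\<lambda>n. (cmod (a n))^2) \<longlonglongrightarrow> 0" using a by (rule summable_LIMSEQ_zero)
  then have "Bseq (\<lambda>n. (cmod (a n))^2)" by (intro convergent_imp_Bseq convergentI)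
  then obtain K where K: "\<And>n. (cmod (a n))^2 \<le> K" by (auto simp: Bseq_def)
  show ?thesis
  proof (rule summable_comparison_test)
    have "norm (norm (a n * z ^ n)) \<le> (1 + K) * cmod z ^ n" for n
    proof -
      have "cmod (a n) \<le> 1 + (cmod (a n))^2"
        using sum_squares_bound[of 1 "cmod (a n)"] by (simp add: power2_eq_square) 
          (smt (verit, best) mult_le_cancel_left1 norm_ge_zero)
      then have "cmod (a n) \<le> 1 + K" using K[of n] by simp
      then show ?thesis by (simp add: norm_mult norm_power mult_right_mono)
    qed
    then show "\<exists>N. \<forall>n\<ge>N. norm (norm (a n * z ^ n)) \<le> (1 + K) * cmod z ^ n" by blast
    show "summable (\<lambda>n. (1 + K) * cmod z ^ n)"
      using z by (intro summable_mult summable_geometric) simp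
  qed
qed

text \<open>The coefficients of the product of two power series.\<close>

definition conv :: "(nat \<Rightarrow> complex) \<Rightarrow> (nat \<Rightarrow> complex) \<Rightarrow> nat \<Rightarrow> complex" where
  "conv c a k = (\<Sum>i\<le>k. c i * a (k - i))"

lemma conv_sums:
  assumes c: "\<And>z. cmod z < 1 \<Longrightarrow> (\<lambda>n. c n * z ^ n) sums \<psi> z"
    and a: "summable (\<lambda>n. (cmod (a n))^2)" and z: "cmod z < 1"
  shows "(\<lambda>k. conv c a k * z ^ k) sums (\<psi> z * (\<Sum>n. a n * z ^ n))"
proof -
  obtain x where x: "cmod z < x" "x < 1" using z dense by blast
  have "summable (\<lambda>n. c n * of_real x ^ n)"
    using c[of "of_real x"] x norm_ge_zero[of z] by (auto simp: sums_iff)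
  then have "summable (\<lambda>n. norm (c n * z ^ n))"
    by (rule powser_insidea) (use x norm_ge_zero[of z] in auto)
  from Cauchy_product_sums[OF this square_summable_power_series[OF a z]]
  have "(\<lambda>k. \<Sum>i\<le>k. (c i * z ^ i) * (a (k - i) * z ^ (k - i))) sums (\<psi> z * (\<Sum>n. a n * z ^ n))"
    using c[OF z] by (simp add: sums_iff)
  moreover have "(\<Sum>i\<le>k. (c i * z ^ i) * (a (k - i) * z ^ (k - i))) = conv c a k * z ^ k" for k
    unfolding conv_def sum_distrib_right
  proof (rule sum.cong[OF refl])
    fix i assume "i \<in> {..k}"
    then have "z ^ k = z ^ i * z ^ (k - i)" by (simp add: power_add[symmetric])
    then show "(c i * z ^ i) * (a (k - i) * z ^ (k - i)) = c i * a (k - i) * z ^ k" by simp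
  qed
  ultimately show ?thesis by simp
qed

definition radius :: "nat \<Rightarrow> real" where
  "radius j = 1 - 1 / (real j + 2)"

lemma radius: "0 \<le> radius j" "radius j < 1"
  by (auto simp: radius_def divide_le_eq)

lemma radius_tendsto: "radius \<longlonglongrightarrow> 1"
proof -
  have "(\<lambda>j. 1 - inverse (real (Suc (Suc j)))) \<longlonglongrightarrow> 1 - 0"
    by (rule tendsto_diff[OF tendsto_const LIMSEQ_Suc[OF LIMSEQ_inverse_real_of_nat]])
  then show ?thesis by (simp add: radius_def[abs_def] inverse_eq_divide add.commute)
qed

lemma sum_le_if_radius_bound:
  fixes u :: "nat \<Rightarrow> real"
  assumes "\<And>j. (\<Sum>n<N. u n * radius j ^ (2 * n)) \<le> B j" and "B \<longlonglongrightarrow> L"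
  shows "(\<Sum>n<N. u n) \<le> L"
proof (rule LIMSEQ_le)
  have "(\<lambda>j. \<Sum>n<N. u n * radius j ^ (2 * n)) \<longlonglongrightarrow> (\<Sum>n<N. u n * 1 ^ (2 * n))"
    by (intro tendsto_intros radius_tendsto)
  then show "(\<lambda>j. \<Sum>n<N. u n * radius j ^ (2 * n)) \<longlonglongrightarrow> (\<Sum>n<N. u n)" by simp
qed (use assms in auto)

lemma summable_radius:
  fixes u :: "nat \<Rightarrow> real"
  assumes "summable u" "\<And>n. 0 \<le> u n"
  shows "summable (\<lambda>n. u n * radius j ^ (2 * n))" "(\<Sum>n. u n * radius j ^ (2 * n)) \<le> suminf u"
proof -
  have le: "u n * radius j ^ (2 * n) \<le> u n" "0 \<le> u n * radius j ^ (2 * n)" for n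
    using assms(2)[of n] radius[of j] by (auto intro!: mult_left_le power_le_one)
  show "summable (\<lambda>n. u n * radius j ^ (2 * n))"
    by (rule summable_comparison_test'[OF assms(1)]) (use le in auto)
  then show "(\<Sum>n. u n * radius j ^ (2 * n)) \<le> suminf u"
    by (intro suminf_le le assms(1))
qed

text \<open>Multiplication by a bounded function does not increase the mean square on any circle by more
  than the square of the bound.\<close>

lemma conv_square_summable:
  assumes c: "\<And>z. cmod z < 1 \<Longrightarrow> (\<lambda>n. c n * z ^ n) sums \<psi> z"
    and C: "\<And>z. cmod z < 1 \<Longrightarrow> cmod (\<psi> z) \<le> C"
    and a: "summable (\<lambda>n. (cmod (a n))^2)"
  shows "summable (\<lambda>k. (cmod (conv c a k))^2)"
    "(\<Sum>k. (cmod (conv c a k))^2) \<le> C^2 * (\<Sum>n. (cmod (a n))^2)"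
proof -
  define f where "f z = (\<Sum>n. a n * z ^ n)" for z
  have f: "(\<lambda>n. a n * z ^ n) sums f z" if "cmod z < 1" for z
    unfolding f_def using summable_norm_cancel[OF square_summable_power_series[OF a that]]
    by (rule summable_sums)
  have g: "(\<lambda>k. conv c a k * z ^ k) sums (\<psi> z * f z)" if "cmod z < 1" for z
    unfolding f_def by (rule conv_sums[OF c a that])
  have part: "(\<Sum>k<N. (cmod (conv c a k))^2) \<le> C^2 * (\<Sum>n. (cmod (a n))^2)" for N
  proof (rule sum_le_if_radius_bound)
    fix j
    define r where "r = radius j"
    have r: "0 \<le> r" "r < 1" using radius by (auto simp: r_def)
    note Pf = Parseval_circle[OF f r] and Pg = Parseval_circle[OF g r]
    have "(\<Sum>k<N. (cmod (conv c a k))^2 * r ^ (2 * k)) \<le> (\<Sum>k. (cmod (conv c a k))^2 * r ^ (2 * k))"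
      using Pg(1) r by (intro sum_le_suminf) (auto simp: sums_iff)
    also have "\<dots> = integral\<^sup>L circle_measure (\<lambda>t. (cmod (\<psi> (of_real r * cis t) * f (of_real r * cis t)))^2) / (2 * pi)"
      using Pg(1) by (simp add: sums_iff)
    also have "\<dots> \<le> integral\<^sup>L circle_measure (\<lambda>t. C^2 * (cmod (f (of_real r * cis t)))^2) / (2 * pi)"
    proof (intro divide_right_mono integral_mono Pg(2) integrable_mult_right Pf(2))
      fix t
      have "cmod (of_real r * cis t) < 1" using r by (simp add: norm_mult)
      from C[OF this] show "(cmod (\<psi> (of_real r * cis t) * f (of_real r * cis t)))^2
        \<le> C^2 * (cmod (f (of_real r * cis t)))^2"
        by (auto simp: norm_mult power_mult_distrib intro!: mult_right_mono power_mono)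
      show "0 \<le> 2 * pi" by (intro mult_nonneg_nonneg pi_ge_zero) simp
    qed
    also have "\<dots> = C^2 * (\<Sum>n. (cmod (a n))^2 * r ^ (2 * n))"
      using Pf(1) by (simp add: sums_iff)
    also have "\<dots> \<le> C^2 * (\<Sum>n. (cmod (a n))^2)"
      unfolding r_def by (intro mult_left_mono summable_radius a) auto
    finally show "(\<Sum>k<N. (cmod (conv c a k))^2 * radius j ^ (2 * k)) \<le> C^2 * (\<Sum>n. (cmod (a n))^2)"
      by (simp add: r_def)
  qed simp
  show s: "summable (\<lambda>k. (cmod (conv c a k))^2)"
    by (rule summableI_nonneg_bounded[OF _ part]) simp
  show "(\<Sum>k. (cmod (conv c a k))^2) \<le> C^2 * (\<Sum>n. (cmod (a n))^2)"
    by (rule suminf_le_const[OF s part])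
qed

text \<open>Let \<open>p\<close> be the polynomial with coefficients \<open>a\<close>.
  If the radial limits are unimodular, then the mean squares of \<open>\<psi> p\<close> and of \<open>p\<close> on the circle
  of radius \<open>r\<close> have the same limit as \<open>r\<close> tends to one, by dominated convergence.  This is where it
  matters that \<open>p\<close> is a polynomial, hence bounded.\<close>

lemma conv_isometric:
  assumes c: "\<And>z. cmod z < 1 \<Longrightarrow> (\<lambda>n. c n * z ^ n) sums \<psi> z"
    and C: "\<And>z. cmod z < 1 \<Longrightarrow> cmod (\<psi> z) \<le> C"
    and lim: "AE t in circle_measure. \<exists>l. cmod l = 1 \<and> ((\<lambda>r. \<psi> (of_real r * cis t)) \<longlongrightarrow> l) (at_left 1)"
    and a: "\<And>n. n \<ge> N \<Longrightarrow> a n = 0"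
  shows "(\<Sum>k. (cmod (conv c a k))^2) = (\<Sum>n. (cmod (a n))^2)"
proof -
  define f where "f z = (\<Sum>n<N. a n * z ^ n)" for z
  have sa: "summable (\<lambda>n. (cmod (a n))^2)"
    by (rule summable_finite[of "{..<N}"]) (auto simp: a)
  have f: "(\<lambda>n. a n * z ^ n) sums f z" for z
    unfolding f_def by (rule sums_finite) (auto simp: a)
  have g: "(\<lambda>k. conv c a k * z ^ k) sums (\<psi> z * f z)" if "cmod z < 1" for z
    using conv_sums[OF c sa that] f[of z] by (simp add: sums_iff)
  have sg: "summable (\<lambda>k. (cmod (conv c a k))^2)"
    by (rule conv_square_summable[OF c C sa])
  define F where "F j t = (cmod (f (of_real (radius j) * cis t)))^2" for j t
  define G where "G j t = (cmod (\<psi> (of_real (radius j) * cis t) * f (of_real (radius j) * cis t)))^2" for j t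
  note PF = Parseval_circle[OF f radius, folded F_def] and PG = Parseval_circle[OF g radius, folded G_def]
  define K where "K = (\<Sum>n<N. cmod (a n))"
  have FK: "F j t \<le> K^2" for j t
  proof -
    have "cmod (f (of_real (radius j) * cis t)) \<le> K"
      unfolding f_def K_def using radius[of j]
      by (intro sum_norm_le) (auto simp: norm_mult norm_power intro!: mult_left_le power_le_one)
    then show ?thesis by (simp add: F_def power_mono)
  qed
  have Gdiff: "G j t - F j t = ((cmod (\<psi> (of_real (radius j) * cis t)))^2 - 1) * F j t" for j t
    by (simp add: G_def F_def norm_mult power_mult_distrib algebra_simps)
  have at: "filterlim radius (at_left 1) sequentially"
    using radius_tendsto radius(2) less_imp_neq[OF radius(2)]
    by (auto simp: filterlim_at intro!: always_eventually)
  \<comment> \<open>The integrand is \<open>|\<psi>|^2 - 1\<close> times \<open>|f|^2\<close>; the first factor tends to zero almost everywhere.\<close>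
  have diff: "(\<lambda>j. integral\<^sup>L circle_measure (\<lambda>t. G j t - F j t)) \<longlonglongrightarrow> integral\<^sup>L circle_measure (\<lambda>t. 0)"
  proof (rule integral_dominated_convergence[where w = "\<lambda>_. (C^2 + 1) * K^2"])
    show "(\<lambda>t. G j t - F j t) \<in> borel_measurable circle_measure" for j
      by (intro borel_measurable_integrable Bochner_Integration.integrable_diff PF(2) PG(2))
    show "AE t in circle_measure. (\<lambda>j. G j t - F j t) \<longlonglongrightarrow> 0"
      using lim
    proof eventually_elim
      case (elim t)
      then obtain l where l: "cmod l = 1" "((\<lambda>r. \<psi> (of_real r * cis t)) \<longlongrightarrow> l) (at_left 1)" by blast
      have "(\<lambda>j. \<psi> (of_real (radius j) * cis t)) \<longlonglongrightarrow> l"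
        by (rule filterlim_compose[OF l(2) at])
      then have "(\<lambda>j. (cmod (\<psi> (of_real (radius j) * cis t)))^2 - 1) \<longlonglongrightarrow> (cmod l)^2 - 1"
        by (intro tendsto_intros)
      then have "(\<lambda>j. (cmod (\<psi> (of_real (radius j) * cis t)))^2 - 1) \<longlonglongrightarrow> 0" using l(1) by simp
      moreover have "(\<lambda>j. F j t) \<longlonglongrightarrow> (cmod (f (of_real 1 * cis t)))^2"
        unfolding F_def f_def by (intro tendsto_intros radius_tendsto)
      ultimately have "(\<lambda>j. ((cmod (\<psi> (of_real (radius j) * cis t)))^2 - 1) * F j t) \<longlonglongrightarrow>
          0 * (cmod (f (of_real 1 * cis t)))^2"
        by (rule tendsto_mult)
      then show ?case by (simp add: Gdiff)
    qed
    show "AE t in circle_measure. norm (G j t - F j t) \<le> (C^2 + 1) * K^2" for j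
    proof (rule AE_I2)
      fix t
      have "cmod (of_real (radius j) * cis t) < 1" using radius[of j] by (simp add: norm_mult)
      then have "(cmod (\<psi> (of_real (radius j) * cis t)))^2 \<le> C^2" by (intro power_mono C) auto
      then have "\<bar>(cmod (\<psi> (of_real (radius j) * cis t)))^2 - 1\<bar> \<le> C^2 + 1"
        using zero_le_power2[of "cmod (\<psi> (of_real (radius j) * cis t))"] zero_le_power2[of C] by linarith
      then show "norm (G j t - F j t) \<le> (C^2 + 1) * K^2"
        unfolding Gdiff using FK[of j t]
        by (auto simp: abs_mult F_def intro!: mult_mono)
    qed
  qed auto
  have intdiff: "integral\<^sup>L circle_measure (\<lambda>t. G j t - F j t) / (2 * pi)
      = (\<Sum>k. (cmod (conv c a k))^2 * radius j ^ (2 * k)) - (\<Sum>n. (cmod (a n))^2 * radius j ^ (2 * n))" for j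
    using PF(1)[of j] PG(1)[of j]
    by (simp add: Bochner_Integration.integral_diff[OF PG(2) PF(2)] sums_iff diff_divide_distrib)
  have "(\<lambda>j. \<Sum>n<N. (cmod (a n))^2 * radius j ^ (2 * n)) \<longlonglongrightarrow> (\<Sum>n<N. (cmod (a n))^2 * 1 ^ (2 * n))"
    by (intro tendsto_intros radius_tendsto)
  moreover have "(\<Sum>n. (cmod (a n))^2 * x ^ (2 * n)) = (\<Sum>n<N. (cmod (a n))^2 * x ^ (2 * n))" for x
    by (rule suminf_finite) (auto simp: a)
  moreover have "(\<Sum>n. (cmod (a n))^2) = (\<Sum>n<N. (cmod (a n))^2)"
    by (rule suminf_finite) (auto simp: a)
  ultimately have limA: "(\<lambda>j. \<Sum>n. (cmod (a n))^2 * radius j ^ (2 * n)) \<longlonglongrightarrow> (\<Sum>n. (cmod (a n))^2)"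
    by simp
  have "(\<lambda>j. integral\<^sup>L circle_measure (\<lambda>t. G j t - F j t) / (2 * pi) + (\<Sum>n. (cmod (a n))^2 * radius j ^ (2 * n)))
      \<longlonglongrightarrow> integral\<^sup>L circle_measure (\<lambda>t. 0) / (2 * pi) + (\<Sum>n. (cmod (a n))^2)"
    by (intro tendsto_intros diff limA) simp
  then have limG: "(\<lambda>j. \<Sum>k. (cmod (conv c a k))^2 * radius j ^ (2 * k)) \<longlonglongrightarrow> (\<Sum>n. (cmod (a n))^2)"
    by (simp add: intdiff)
  show ?thesis
  proof (rule antisym)
    show "(\<Sum>k. (cmod (conv c a k))^2) \<le> (\<Sum>n. (cmod (a n))^2)"
      by (rule suminf_le_const[OF sg sum_le_if_radius_bound[OF _ limG]])
         (intro sum_le_suminf summable_radius sg; use radius in auto)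
    show "(\<Sum>n. (cmod (a n))^2) \<le> (\<Sum>k. (cmod (conv c a k))^2)"
      by (rule LIMSEQ_le_const2[OF limG]) (use summable_radius(2)[OF sg] in auto)
  qed
qed

section \<open>Multiplication operators\<close>

subsection \<open>Reproducing kernels\<close>

lemma summable_on_geometric2:
  fixes r s :: real
  assumes "0 \<le> r" "r < 1" "0 \<le> s" "s < 1"
  shows "(\<lambda>p. r ^ fst p * s ^ snd p) summable_on UNIV"
proof -
  have "(\<lambda>p. r ^ fst p * s ^ snd p) summable_on (SIGMA i:UNIV. UNIV)"
  proof (rule summable_on_SigmaI)
    show "((\<lambda>j. r ^ fst (i, j) * s ^ snd (i, j)) has_sum (r ^ i * (1 / (1 - s)))) UNIV" for i :: nat
      using assms sums_mult[OF geometric_sums[of s], of "r ^ i"]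
      by (intro sums_nonneg_imp_has_sum) auto
    show "(\<lambda>i. r ^ i * (1 / (1 - s))) summable_on UNIV"
      using assms by (subst summable_on_UNIV_nonneg_real_iff) (auto intro!: summable_mult2 summable_divide summable_geometric)
  qed (use assms in auto)
  then show ?thesis by simp
qed

text \<open>The Szego kernel of the bidisk.  Outside of the bidisk the coefficients are not square
  summable, whence the default value.\<close>

lift_definition kern :: "complex \<Rightarrow> complex \<Rightarrow> hardy2" is
  "\<lambda>l m p. if cmod l < 1 \<and> cmod m < 1 then cnj l ^ fst p * cnj m ^ snd p else 0"
proof -
  fix l m :: complex
  show "(\<lambda>p. (cmod (if cmod l < 1 \<and> cmod m < 1 then cnj l ^ fst p * cnj m ^ snd p else 0))^2) summable_on UNIV"
  proof (cases "cmod l < 1 \<and> cmod m < 1")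
    case True
    have "(\<lambda>p. ((cmod l)^2) ^ fst p * ((cmod m)^2) ^ snd p) summable_on UNIV"
      using True by (intro summable_on_geometric2) (auto simp: power_less_one_iff abs_square_less_1)
    then show ?thesis using True
      by (simp add: norm_mult norm_power power_mult_distrib power_mult[symmetric] mult.commute[of _ 2])
  qed auto
qed

lemma cinner_kern: "z \<in> disk \<Longrightarrow> w \<in> disk \<Longrightarrow> cinner f (kern z w) = hval f z w"
  by (simp add: cinner_def hval_def kern.rep_eq case_prod_unfold mult.assoc)

lemma hval_linear:
  assumes "z \<in> disk" "w \<in> disk"
  shows "hval (f + g) z w = hval f z w + hval g z w" "hval (f - g) z w = hval f z w - hval g z w"
    "hval (cscale a f) z w = a * hval f z w"
  using assms by (simp_all add: cinner_kern[symmetric] cinner_simps)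

lemma summable_on_slices:
  fixes u :: "nat \<times> nat \<Rightarrow> 'c :: banach"
  assumes "u summable_on UNIV"
  shows "(\<lambda>k. u (k, n)) summable_on UNIV" "summable (\<lambda>k. u (k, n))"
    "((\<lambda>n. \<Sum>k. u (k, n)) has_sum infsum u UNIV) UNIV"
proof -
  have u: "(\<lambda>(n, k). u (k, n)) summable_on (UNIV \<times> UNIV)"
    using assms summable_on_swap[of u UNIV UNIV] by simp
  show s: "(\<lambda>k. u (k, n)) summable_on UNIV" for n
  proof -
    have "u summable_on (\<lambda>k. (k, n)) ` UNIV"
      by (rule summable_on_subset_banach[OF assms]) simp
    then show ?thesis by (subst (asm) summable_on_reindex) (auto simp: inj_on_def o_def)
  qed
  then show "summable (\<lambda>k. u (k, n))" by (rule summable_on_imp_summable)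
  have eq: "(\<Sum>\<^sub>\<infinity>k. u (k, n)) = (\<Sum>k. u (k, n))" for n
    using has_sum_imp_sums[OF has_sum_infsum[OF s[of n]]] by (simp add: sums_iff)
  have "((\<lambda>(n, k). u (k, n)) has_sum infsum u UNIV) (UNIV \<times> UNIV)"
    by (rule iffD1[OF has_sum_swap]) (simp only: UNIV_Times_UNIV has_sum_infsum[OF assms])
  from infsumI[OF this]
  have "infsum (\<lambda>(n, k). u (k, n)) (UNIV \<times> UNIV) = infsum u UNIV" .
  then have "infsum u UNIV = (\<Sum>\<^sub>\<infinity>n. \<Sum>\<^sub>\<infinity>k. u (k, n))"
    using infsum_Sigma'_banach[OF u] by simp
  moreover have "(\<lambda>n. \<Sum>\<^sub>\<infinity>k. u (k, n)) summable_on UNIV"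
    using summable_on_Sigma_banach[OF u] by simp
  ultimately show "((\<lambda>n. \<Sum>k. u (k, n)) has_sum infsum u UNIV) UNIV"
    by (simp add: eq has_sum_infsum)
qed

lemma summable_on_from_slices:
  fixes u :: "nat \<times> nat \<Rightarrow> real"
  assumes "\<And>p. 0 \<le> u p" "\<And>n. summable (\<lambda>k. u (k, n))" "(\<lambda>n. \<Sum>k. u (k, n)) summable_on UNIV"
  shows "u summable_on UNIV"
proof -
  have "(\<lambda>(n, k). u (k, n)) summable_on (SIGMA n:UNIV. UNIV)"
    by (rule summable_on_SigmaI[OF _ assms(3)])
       (auto intro!: sums_nonneg_imp_has_sum summable_sums assms(1,2))
  then show ?thesis using summable_on_swap[of u UNIV UNIV] by simp
qed

lemma hcoeff_slice_summable: "summable (\<lambda>k. (cmod (hcoeff f (k, n)))^2)"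
  using summable_on_slices(2)[OF hcoeff_summable] .

lemma norm_sq_slices: "((\<lambda>n. \<Sum>k. (cmod (hcoeff f (k, n)))^2) has_sum (norm f)^2) UNIV"
  using summable_on_slices(3)[OF hcoeff_summable] by (simp add: norm_sq_infsum)

lemma hval_slices:
  assumes z: "z \<in> disk" and w: "w \<in> disk"
  shows "((\<lambda>n. (\<Sum>k. hcoeff f (k, n) * z ^ k) * w ^ n) has_sum hval f z w) UNIV"
proof -
  have "(\<lambda>p. hcoeff f p * cnj (hcoeff (kern z w) p)) summable_on UNIV"
    by (intro square_summable_mult hcoeff_summable)
  then have s: "(\<lambda>p. hcoeff f p * z ^ fst p * w ^ snd p) summable_on UNIV"
    using z w by (simp add: kern.rep_eq mult.assoc)
  have "summable (\<lambda>k. hcoeff f (k, n) * z ^ k)" for n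
    using z by (intro summable_norm_cancel[OF square_summable_power_series] hcoeff_slice_summable) auto
  then have "(\<Sum>k. hcoeff f (k, n) * z ^ k) * w ^ n = (\<Sum>k. hcoeff f (k, n) * z ^ k * w ^ n)" for n
    by (rule suminf_mult2)
  then show ?thesis
    using summable_on_slices(3)[OF s] by (simp add: hval_def case_prod_unfold)
qed

text \<open>The function of \<open>w\<close> whose coefficients are the slices at \<open>z\<close> vanishes, so all slices vanish at
  every \<open>z\<close>, so all their coefficients vanish.\<close>

lemma hval_ext:
  assumes "\<And>z w. z \<in> disk \<Longrightarrow> w \<in> disk \<Longrightarrow> hval f z w = hval g z w"
  shows "f = g"
proof -
  define d where "d = f - g"
  have d0: "hval d z w = 0" if "z \<in> disk" "w \<in> disk" for z w
    using assms[OF that] that by (simp add: d_def hval_linear)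
  have slice0: "(\<Sum>k. hcoeff d (k, n) * z ^ k) = 0" if z: "z \<in> disk" for z n
  proof (rule power_series_zero_imp)
    fix w :: complex assume "cmod w < 1"
    then have "((\<lambda>n. (\<Sum>k. hcoeff d (k, n) * z ^ k) * w ^ n) has_sum 0) UNIV"
      using hval_slices[OF z, of w d] d0[OF z, of w] by simp
    then show "(\<lambda>n. (\<Sum>k. hcoeff d (k, n) * z ^ k) * w ^ n) sums 0" by (rule has_sum_imp_sums)
  qed
  have "hcoeff d (k, n) = 0" for k n
  proof (rule power_series_zero_imp[of "\<lambda>k. hcoeff d (k, n)"])
    fix z :: complex assume z: "cmod z < 1"
    have "summable (\<lambda>k. hcoeff d (k, n) * z ^ k)"
      by (rule summable_norm_cancel[OF square_summable_power_series[OF hcoeff_slice_summable z]])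
    then show "(\<lambda>k. hcoeff d (k, n) * z ^ k) sums 0"
      using slice0[of z n] z by (simp add: sums_iff)
  qed
  then have "d = 0" by (intro hcoeff_eqI) (auto simp: zero_hardy2.rep_eq)
  then show ?thesis by (simp add: d_def)
qed

lemma kern_total:
  assumes M: "closed_subspace M" and k: "\<And>z w. z \<in> disk \<Longrightarrow> w \<in> disk \<Longrightarrow> kern z w \<in> M"
  shows "M = UNIV"
proof (rule closed_subspace_eq_UNIV[OF M])
  fix y assume y: "\<And>x. x \<in> M \<Longrightarrow> cinner x y = 0"
  show "y = 0"
  proof (rule hval_ext)
    fix z w assume zw: "z \<in> disk" "w \<in> disk"
    have "cinner y (kern z w) = 0"
      using y[OF k[OF zw]] by (subst cinner_commute) simp
    then show "hval y z w = hval 0 z w" using zw cinner_kern[OF zw, of 0] by (simp add: cinner_kern)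
  qed
qed

lemma hardy2_ofI:
  assumes "\<And>z w. z \<in> disk \<Longrightarrow> w \<in> disk \<Longrightarrow> hval g z w = F z w"
  shows "hardy2_of F = g"
  unfolding hardy2_of_def by (rule the_equality) (use assms in \<open>auto intro: hval_ext\<close>)

lemma mult_opI:
  assumes "\<And>z w. z \<in> disk \<Longrightarrow> w \<in> disk \<Longrightarrow> hval g z w = \<phi> z w * hval f z w"
  shows "mult_op \<phi> f = g"
  unfolding mult_op_def by (rule hardy2_ofI) (rule assms)

subsection \<open>Bounded analytic multipliers\<close>

definition Hinf :: "(complex \<Rightarrow> complex) \<Rightarrow> bool" where
  "Hinf \<psi> \<longleftrightarrow> \<psi> holomorphic_on disk \<and> bounded (\<psi> ` disk)"

lemma HinfI: "\<psi> holomorphic_on disk \<Longrightarrow> (\<And>z. z \<in> disk \<Longrightarrow> cmod (\<psi> z) \<le> C) \<Longrightarrow> Hinf \<psi>"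
  unfolding Hinf_def bounded_iff by blast

lemma Hinf_bound: "Hinf \<psi> \<Longrightarrow> \<exists>C. \<forall>z\<in>disk. cmod (\<psi> z) \<le> C"
  unfolding Hinf_def bounded_iff by blast

definition taylor :: "(complex \<Rightarrow> complex) \<Rightarrow> nat \<Rightarrow> complex" where
  "taylor \<psi> n = (deriv ^^ n) \<psi> 0 / fact n"

lemma taylor_sums: "\<psi> holomorphic_on disk \<Longrightarrow> cmod z < 1 \<Longrightarrow> (\<lambda>n. taylor \<psi> n * z ^ n) sums \<psi> z"
  using holomorphic_power_series[of \<psi> 0 1 z] by (simp add: taylor_def)

abbreviation Mz :: "(complex \<Rightarrow> complex) \<Rightarrow> hardy2 \<Rightarrow> hardy2" where
  "Mz \<psi> \<equiv> mult_op (\<lambda>z w. \<psi> z)"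

abbreviation Mw :: "(complex \<Rightarrow> complex) \<Rightarrow> hardy2 \<Rightarrow> hardy2" where
  "Mw \<psi> \<equiv> mult_op (\<lambda>z w. \<psi> w)"

text \<open>For a fixed power of \<open>w\<close> the coefficients form a square summable sequence in the power of \<open>z\<close>.
  Multiplication by a function of \<open>z\<close> acts on each of these slices separately.\<close>

lemma
  assumes hol: "\<psi> holomorphic_on disk" and C: "\<And>z. z \<in> disk \<Longrightarrow> cmod (\<psi> z) \<le> C"
  shows hcoeff_Mz_bounded: "hcoeff (Mz \<psi> f) (k, n) = conv (taylor \<psi>) (\<lambda>i. hcoeff f (i, n)) k"
    and norm_Mz_le: "norm (Mz \<psi> f) \<le> C * norm f"
    and hval_Mz_bounded: "z \<in> disk \<Longrightarrow> w \<in> disk \<Longrightarrow> hval (Mz \<psi> f) z w = \<psi> z * hval f z w"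
proof -
  define b where "b p = conv (taylor \<psi>) (\<lambda>i. hcoeff f (i, snd p)) (fst p)" for p
  have C': "cmod (\<psi> z) \<le> C" if "cmod z < 1" for z using C that by simp
  note conv = conv_square_summable[OF taylor_sums[OF hol] C' hcoeff_slice_summable]
  have C0: "0 \<le> C" by (rule order_trans[OF norm_ge_zero C[of 0]]) simp
  have F: "(\<lambda>n. C^2 * (\<Sum>k. (cmod (hcoeff f (k, n)))^2)) summable_on UNIV"
    using norm_sq_slices by (intro summable_on_cmult_right) (auto simp: summable_on_def)
  have sum_b: "(\<lambda>n. \<Sum>k. (cmod (b (k, n)))^2) summable_on UNIV"
    by (rule summable_on_comparison_test[OF F])
       (use conv in \<open>auto simp: b_def intro!: suminf_nonneg\<close>)
  have "(\<lambda>p. (cmod (b p))^2) summable_on UNIV"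
    by (rule summable_on_from_slices[OF _ _ sum_b]) (use conv(1) in \<open>auto simp: b_def\<close>)
  then have hb: "hcoeff (Abs_hardy2 b) = b" by (simp add: Abs_hardy2_inverse)
  define g where "g = Abs_hardy2 b"
  have hg: "hcoeff g (k, n) = conv (taylor \<psi>) (\<lambda>i. hcoeff f (i, n)) k" for k n
    by (simp add: g_def hb b_def)
  have "(norm g)^2 \<le> C^2 * (norm f)^2"
  proof (rule has_sum_mono)
    show "((\<lambda>n. C^2 * (\<Sum>k. (cmod (hcoeff f (k, n)))^2)) has_sum C^2 * (norm f)^2) UNIV"
      by (intro has_sum_cmult_right norm_sq_slices)
    show "((\<lambda>n. \<Sum>k. (cmod (hcoeff g (k, n)))^2) has_sum (norm g)^2) UNIV"
      by (rule norm_sq_slices)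
  qed (use conv(2) in \<open>auto simp: hg\<close>)
  then have "(norm g)^2 \<le> (C * norm f)^2" by (simp add: power_mult_distrib)
  then have ng: "norm g \<le> C * norm f"
    by (rule power2_le_imp_le) (intro mult_nonneg_nonneg C0 norm_ge_zero)
  have hv: "hval g z w = \<psi> z * hval f z w" if zw: "z \<in> disk" "w \<in> disk" for z w
  proof -
    have "(\<Sum>k. hcoeff g (k, n) * z ^ k) = \<psi> z * (\<Sum>k. hcoeff f (k, n) * z ^ k)" for n
      using conv_sums[OF taylor_sums[OF hol] hcoeff_slice_summable, of z] zw by (simp add: hg sums_iff)
    then have "((\<lambda>n. \<psi> z * ((\<Sum>k. hcoeff f (k, n) * z ^ k) * w ^ n)) has_sum hval g z w) UNIV"
      using hval_slices[OF zw, of g] by (simp add: mult.assoc)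
    moreover have "((\<lambda>n. \<psi> z * ((\<Sum>k. hcoeff f (k, n) * z ^ k) * w ^ n)) has_sum \<psi> z * hval f z w) UNIV"
      by (intro has_sum_cmult_right hval_slices zw)
    ultimately show ?thesis by (rule has_sum_unique)
  qed
  have eq: "Mz \<psi> f = g" by (rule mult_opI) (rule hv)
  show "hcoeff (Mz \<psi> f) (k, n) = conv (taylor \<psi>) (\<lambda>i. hcoeff f (i, n)) k"
    "norm (Mz \<psi> f) \<le> C * norm f"
    "z \<in> disk \<Longrightarrow> w \<in> disk \<Longrightarrow> hval (Mz \<psi> f) z w = \<psi> z * hval f z w"
    using hg ng hv by (simp_all add: eq)
qed

lemma hcoeff_Mz: "Hinf \<psi> \<Longrightarrow> hcoeff (Mz \<psi> f) (k, n) = conv (taylor \<psi>) (\<lambda>i. hcoeff f (i, n)) k"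
  using Hinf_bound hcoeff_Mz_bounded unfolding Hinf_def by metis

lemma hval_Mz: "Hinf \<psi> \<Longrightarrow> z \<in> disk \<Longrightarrow> w \<in> disk \<Longrightarrow> hval (Mz \<psi> f) z w = \<psi> z * hval f z w"
  using Hinf_bound hval_Mz_bounded unfolding Hinf_def by metis

lemma bounded_op_Mz: assumes "Hinf \<psi>" shows "bounded_op (Mz \<psi>)"
proof -
  obtain C where C: "\<And>z. z \<in> disk \<Longrightarrow> cmod (\<psi> z) \<le> C" using Hinf_bound[OF assms] by blast
  show ?thesis
  proof (rule bounded_opI)
    show "norm (Mz \<psi> x) \<le> C * norm x" for x
      using assms C by (intro norm_Mz_le) (auto simp: Hinf_def)
  qed (rule hval_ext, use assms in \<open>simp add: hval_linear hval_Mz distrib_left mult_ac\<close>)+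
qed

subsection \<open>Exchanging the variables\<close>

text \<open>The unitary exchange of \<open>z\<close> and \<open>w\<close>; it carries every statement about multiplication by a function
  of \<open>z\<close> over to \<open>w\<close>.\<close>

lift_definition flip :: "hardy2 \<Rightarrow> hardy2" is "\<lambda>c p. c (prod.swap p)"
proof -
  fix c :: "nat \<times> nat \<Rightarrow> complex"
  assume "(\<lambda>p. (cmod (c p))^2) summable_on UNIV"
  then show "(\<lambda>p. (cmod (c (prod.swap p)))^2) summable_on UNIV"
    by (rule summable_on_reindex_bij_betw[OF bij_swap, of "\<lambda>p. (cmod (c p))^2", THEN iffD2])
qed

lemma flip_flip [simp]: "flip (flip f) = f"
  by transfer simp

lemma cinner_flip [simp]: "cinner (flip f) (flip g) = cinner f g"
  unfolding cinner_def flip.rep_eq by (rule infsum_reindex_bij_betw[OF bij_swap])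

lemma flip_kern: "flip (kern z w) = kern w z"
  by transfer (auto simp: fun_eq_iff mult.commute)

lemma hval_flip: "z \<in> disk \<Longrightarrow> w \<in> disk \<Longrightarrow> hval (flip f) z w = hval f w z"
  using cinner_flip[of f "kern w z"] by (simp add: flip_kern cinner_kern)

lemma norm_flip: "norm (flip f) = norm f"
  by (rule norm_eqI_cinner) simp

lemma bounded_op_flip: "bounded_op flip"
proof (rule bounded_opI[of _ 1])
  show "flip (x + y) = flip x + flip y" for x y by transfer simp
  show "flip (cscale a x) = cscale a (flip x)" for a x by transfer simp
qed (simp add: norm_flip)

lemma Mw_flip: assumes "Hinf \<psi>" shows "Mw \<psi> f = flip (Mz \<psi> (flip f))"
  by (rule mult_opI) (simp add: hval_flip hval_Mz assms)

lemma Mw_flip': assumes "Hinf \<psi>" shows "Mw \<psi> (flip f) = flip (Mz \<psi> f)"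
  by (simp add: Mw_flip assms)

lemma hval_Mw: "Hinf \<psi> \<Longrightarrow> z \<in> disk \<Longrightarrow> w \<in> disk \<Longrightarrow> hval (Mw \<psi> f) z w = \<psi> w * hval f z w"
  by (simp add: Mw_flip hval_flip hval_Mz)

lemma bounded_op_Mw: assumes "Hinf \<psi>" shows "bounded_op (Mw \<psi>)"
proof -
  have "bounded_op (\<lambda>f. flip (Mz \<psi> (flip f)))"
    by (rule bounded_op_compose[OF bounded_op_flip
          bounded_op_compose[OF bounded_op_Mz[OF assms] bounded_op_flip]])
  moreover have "Mw \<psi> = (\<lambda>f. flip (Mz \<psi> (flip f)))" by (rule ext) (rule Mw_flip[OF assms])
  ultimately show ?thesis by simp
qed

subsection \<open>Invariance under bounded analytic multipliers\<close>

text \<open>A bounded sequence converges weakly if it does so against a set with dense span, and the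
  kernels are such a set.\<close>

lemma weak_convergence_kern:
  assumes b: "\<And>j. norm (x j) \<le> K"
    and lim: "\<And>z w. z \<in> disk \<Longrightarrow> w \<in> disk \<Longrightarrow> (\<lambda>j. hval (x j) z w) \<longlonglongrightarrow> 0"
  shows "(\<lambda>j. cinner (x j) y) \<longlonglongrightarrow> 0"
proof -
  have "closed_subspace {y. (\<lambda>j. cinner (x j) y) \<longlonglongrightarrow> 0}" (is "closed_subspace ?S")
  proof (rule closed_subspaceI)
    show "y + y' \<in> ?S" if "y \<in> ?S" "y' \<in> ?S" for y y'
      using that tendsto_add[of "\<lambda>j. cinner (x j) y" 0 sequentially "\<lambda>j. cinner (x j) y'" 0]
      by (simp add: cinner_add_right)
    show "cscale a y \<in> ?S" if "y \<in> ?S" for a y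
      using that tendsto_mult_left[of "\<lambda>j. cinner (x j) y" 0 sequentially "cnj a"]
      by (simp add: cinner_cscale_right)
    show "closed ?S"
      unfolding closed_sequential_limits
    proof (intro allI impI, elim conjE)
      fix Y y assume Y: "\<forall>n. Y n \<in> ?S" and lim: "Y \<longlonglongrightarrow> y"
      have "(\<lambda>j. cinner (x j) y) \<longlonglongrightarrow> 0"
      proof (rule LIMSEQ_I)
        fix e :: real assume e: "0 < e"
        have K: "0 \<le> K" using b[of 0] norm_ge_zero[of "x 0"] by linarith
        define L where "L = K + 1"
        have L: "0 < L" "K \<le> L" using K by (simp_all add: L_def)
        have "0 < e / (2 * L)" using e L by simp
        then obtain n where n: "norm (Y n - y) < e / (2 * L)"
          using LIMSEQ_D[OF lim] by blast
        have "(\<lambda>j. cinner (x j) (Y n)) \<longlonglongrightarrow> 0" using Y by simp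
        then obtain J where J: "\<And>j. j \<ge> J \<Longrightarrow> cmod (cinner (x j) (Y n)) < e / 2"
          using LIMSEQ_D[of _ 0 "e/2"] e by (metis half_gt_zero diff_zero)
        have "norm (cinner (x j) y - 0) < e" if "j \<ge> J" for j
        proof -
          have "cinner (x j) y = cinner (x j) (Y n) - cinner (x j) (Y n - y)"
            by (simp add: cinner_diff_right)
          then have "cmod (cinner (x j) y) \<le> cmod (cinner (x j) (Y n)) + cmod (cinner (x j) (Y n - y))"
            by (metis norm_triangle_ineq4)
          moreover have "cmod (cinner (x j) (Y n - y)) \<le> L * (e / (2 * L))"
            using order_trans[OF b[of j] L(2)] L n e
            by (intro order_trans[OF cinner_Cauchy_Schwarz] mult_mono) auto
          moreover have "L * (e / (2 * L)) = e / 2" using L by simp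
          ultimately show ?thesis using J[OF that] unfolding diff_zero by linarith
        qed
        then show "\<exists>J. \<forall>j\<ge>J. norm (cinner (x j) y - 0) < e" by blast
      qed
      then show "y \<in> ?S" by simp
    qed
  qed simp
  then have "?S = UNIV"
    by (rule kern_total) (simp add: cinner_kern lim)
  then show ?thesis by blast
qed

lemma Hinf_id: "Hinf (\<lambda>z. z)"
  by (rule HinfI[of _ 1]) (auto intro: holomorphic_intros)

text \<open>A function analytic across the closed disk is an absolutely convergent power series in the
  coordinate.  The dilations \<open>\<psi>(r z)\<close> are uniformly bounded multipliers of this kind, and they
  converge weakly to \<open>\<psi>\<close>; a closed subspace is weakly closed.\<close>

lemma Mz_invariant:
  assumes M: "closed_subspace M" and Z: "\<And>x. x \<in> M \<Longrightarrow> Mz (\<lambda>z. z) x \<in> M"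
    and \<psi>: "Hinf \<psi>" and x: "x \<in> M"
  shows "Mz \<psi> x \<in> M"
proof -
  obtain C where C: "\<And>z. z \<in> disk \<Longrightarrow> cmod (\<psi> z) \<le> C" using Hinf_bound[OF \<psi>] by blast
  have hol: "\<psi> holomorphic_on disk" using \<psi> by (simp add: Hinf_def)
  define \<psi>r where "\<psi>r j z = \<psi> (of_real (radius j) * z)" for j z
  have rz: "of_real (radius j) * z \<in> disk" if "z \<in> disk" for j z
  proof -
    have "radius j * cmod z \<le> 1 * cmod z"
      using radius[of j] by (intro mult_right_mono) auto
    then show ?thesis using that radius(1)[of j] by (simp add: norm_mult)
  qed
  have holr: "\<psi>r j holomorphic_on disk" for j
    unfolding \<psi>r_def
    by (rule holomorphic_on_compose_gen[OF _ hol, unfolded o_def]) (auto intro!: holomorphic_intros rz)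
  have Cr: "cmod (\<psi>r j z) \<le> C" if "z \<in> disk" for j z
    unfolding \<psi>r_def by (intro C rz that)
  have H: "Hinf (\<psi>r j)" for j by (rule HinfI[OF holr Cr])
  define Zp where "Zp k = (Mz (\<lambda>z. z) ^^ k) x" for k
  have hZ: "hval (Zp k) z w = z ^ k * hval x z w" if "z \<in> disk" "w \<in> disk" for k z w
    using that by (induction k) (simp_all add: Zp_def hval_Mz Hinf_id)
  have nZ: "norm (Zp k) \<le> norm x" for k
  proof (induction k)
    case (Suc k)
    have "norm (Mz (\<lambda>z. z) (Zp k)) \<le> 1 * norm (Zp k)"
      by (rule norm_Mz_le) (auto intro: holomorphic_intros)
    then show ?case using Suc by (simp add: Zp_def)
  qed (simp add: Zp_def)
  have ZpM: "Zp k \<in> M" for k by (induction k) (use x Z in \<open>simp_all add: Zp_def\<close>)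
  have in_M: "Mz (\<psi>r j) x \<in> M" for j
  proof -
    define r where "r = radius j"
    have r: "0 \<le> r" "r < 1" using radius by (auto simp: r_def)
    define c where "c k = taylor \<psi> k * of_real r ^ k" for k
    have "cmod (of_real ((1 + r) / 2)) < 1" using r unfolding norm_of_real by simp
    from sums_summable[OF taylor_sums[OF hol this]]
    have "summable (\<lambda>k. norm (c k))" unfolding c_def
      by (rule powser_insidea) (use r in \<open>simp only: norm_of_real; simp\<close>)
    then have "summable (\<lambda>k. norm (c k) * norm x)" by (rule summable_mult2)
    then have "summable (\<lambda>k. norm (cscale (c k) (Zp k)))"
      by (rule summable_comparison_test'[of _ 0]) (simp add: norm_cscale nZ mult_left_mono)
    then have "summable (\<lambda>k. cscale (c k) (Zp k))" by (rule summable_norm_cancel)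
    then obtain s where s: "(\<lambda>k. cscale (c k) (Zp k)) sums s" by (auto simp: summable_def)
    have "(\<Sum>k<n. cscale (c k) (Zp k)) \<in> M" for n
      by (induction n) (auto intro!: closed_subspaceD(1-3)[OF M] ZpM)
    then have sM: "s \<in> M"
      by (rule closed_sequentially[OF closed_subspaceD(6)[OF M] _ s[unfolded sums_def]])
    have "hval s z w = \<psi>r j z * hval x z w" if zw: "z \<in> disk" "w \<in> disk" for z w
    proof -
      have "(\<lambda>k. cinner (cscale (c k) (Zp k)) (kern z w)) sums cinner s (kern z w)"
        by (rule bounded_linear.sums[OF bounded_linear_cinner_left s])
      then have "(\<lambda>k. c k * (z ^ k * hval x z w)) sums hval s z w"
        using zw by (simp add: cinner_kern hval_linear hZ)
      moreover have "(\<lambda>k. (taylor \<psi> k * (of_real r * z) ^ k) * hval x z w) sums (\<psi> (of_real r * z) * hval x z w)"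
        using rz[OF zw(1), of j] by (intro sums_mult2 taylor_sums[OF hol]) (simp add: r_def)
      then have "(\<lambda>k. c k * (z ^ k * hval x z w)) sums (\<psi>r j z * hval x z w)"
        by (simp add: c_def \<psi>r_def r_def power_mult_distrib mult_ac)
      ultimately show ?thesis by (rule sums_unique2)
    qed
    then have "Mz (\<psi>r j) x = s" by (rule mult_opI)
    then show ?thesis using sM by simp
  qed
  have weak: "(\<lambda>j. cinner (Mz (\<psi>r j) x - Mz \<psi> x) y) \<longlonglongrightarrow> 0" for y
  proof (rule weak_convergence_kern)
    show "norm (Mz (\<psi>r j) x - Mz \<psi> x) \<le> C * norm x + C * norm x" for j
      by (intro order_trans[OF norm_triangle_ineq4] add_mono norm_Mz_le hol holr C Cr)
    fix z w assume zw: "z \<in> disk" "w \<in> disk"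
    have "(\<lambda>j. of_real (radius j) * z) \<longlonglongrightarrow> of_real 1 * z"
      by (intro tendsto_intros radius_tendsto)
    then have "(\<lambda>j. of_real (radius j) * z) \<longlonglongrightarrow> z" by simp
    moreover have "isCont \<psi> z"
      using holomorphic_on_imp_continuous_on[OF hol] zw(1) by (simp add: continuous_on_eq_continuous_at)
    ultimately have "(\<lambda>j. \<psi>r j z) \<longlonglongrightarrow> \<psi> z"
      unfolding \<psi>r_def by (rule isCont_tendsto_compose[rotated])
    then have "(\<lambda>j. \<psi>r j z * hval x z w - \<psi> z * hval x z w) \<longlonglongrightarrow> \<psi> z * hval x z w - \<psi> z * hval x z w"
      by (intro tendsto_intros)
    then show "(\<lambda>j. hval (Mz (\<psi>r j) x - Mz \<psi> x) z w) \<longlonglongrightarrow> 0"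
      using zw by (simp add: hval_linear hval_Mz H \<psi>)
  qed
  define y where "y = Mz \<psi> x - ortho_proj M (Mz \<psi> x)"
  have orth: "cinner h y = 0" if "h \<in> M" for h
  proof -
    have "cinner y h = 0" by (simp add: y_def cinner_diff_left ortho_proj(2)[OF M that])
    then show ?thesis by (subst cinner_commute) simp
  qed
  have "(\<lambda>j. - cinner (Mz \<psi> x) y) \<longlonglongrightarrow> 0"
    using weak[of y] by (simp add: cinner_diff_left orth[OF in_M])
  then have "cinner (Mz \<psi> x) y = 0" using LIMSEQ_const_iff[of "- cinner (Mz \<psi> x) y" 0] by simp
  then have "cinner y y = 0"
    using orth[OF ortho_proj(1)[OF M]] by (subst (1) y_def) (simp add: cinner_diff_left)
  then show ?thesis using ortho_proj(1)[OF M, of "Mz \<psi> x"] by (simp add: cinner_norm_sq y_def)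
qed

lemma Mw_invariant:
  assumes M: "closed_subspace M" and W: "\<And>x. x \<in> M \<Longrightarrow> Mw (\<lambda>z. z) x \<in> M"
    and \<psi>: "Hinf \<psi>" and x: "x \<in> M"
  shows "Mw \<psi> x \<in> M"
proof -
  have "Mz \<psi> (flip x) \<in> {y. flip y \<in> M}"
  proof (rule Mz_invariant[OF closed_subspace_vimage[OF bounded_op_flip M] _ \<psi>])
    show "Mz (\<lambda>z. z) y \<in> {y. flip y \<in> M}" if "y \<in> {y. flip y \<in> M}" for y
      using W[of "flip y"] that by (simp add: Mw_flip'[OF Hinf_id])
  qed (use x in simp)
  then show ?thesis by (simp add: Mw_flip \<psi>)
qed

subsection \<open>Isometric multipliers\<close>

text \<open>The norm is preserved on the dense space of elements that are polynomials of bounded degree in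
  \<open>z\<close>, where the boundary values can be used slice by slice.\<close>

lemma Mz_isometric_norm:
  assumes "inner_function \<psi>"
  shows "norm (Mz \<psi> f) = norm f"
proof -
  have \<psi>: "Hinf \<psi>" using assms by (simp add: inner_function_def Hinf_def)
  have lim: "AE t in circle_measure. \<exists>l. cmod l = 1 \<and> ((\<lambda>r. \<psi> (of_real r * cis t)) \<longlongrightarrow> l) (at_left 1)"
    using assms by (simp add: inner_function_def)
  obtain C where C: "\<And>z. z \<in> disk \<Longrightarrow> cmod (\<psi> z) \<le> C" using Hinf_bound[OF \<psi>] by blast
  have hol: "\<psi> holomorphic_on disk" using \<psi> by (simp add: Hinf_def)
  have poly: "norm (Mz \<psi> g) = norm g" if fin: "\<And>k n. k \<ge> N \<Longrightarrow> hcoeff g (k, n) = 0" for g N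
  proof -
    have "(\<Sum>k. (cmod (conv (taylor \<psi>) (\<lambda>i. hcoeff g (i, n)) k))^2) = (\<Sum>k. (cmod (hcoeff g (k, n)))^2)" for n
      by (rule conv_isometric[OF taylor_sums[OF hol] _ lim, of C N]) (use C fin in auto)
    then have "((\<lambda>n. \<Sum>k. (cmod (hcoeff g (k, n)))^2) has_sum (norm (Mz \<psi> g))^2) UNIV"
      using norm_sq_slices[of "Mz \<psi> g"] by (simp add: hcoeff_Mz[OF \<psi>])
    then have "(norm (Mz \<psi> g))^2 = (norm g)^2" using norm_sq_slices has_sum_unique by blast
    then show ?thesis by (simp add: power2_eq_iff_nonneg)
  qed
  define P where "P = {g. \<exists>N. \<forall>k n. k \<ge> N \<longrightarrow> hcoeff g (k, n) = 0}"
  have sub: "h2_subspace P"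
    unfolding h2.subspace_def
  proof (intro conjI ballI allI)
    show "0 \<in> P" by (simp add: P_def zero_hardy2.rep_eq)
    fix x assume x: "x \<in> P"
    then show "cscale a x \<in> P" for a by (auto simp: P_def cscale.rep_eq)
    fix y assume "y \<in> P"
    with x obtain N N' where "\<forall>k n. k \<ge> N \<longrightarrow> hcoeff x (k, n) = 0" "\<forall>k n. k \<ge> N' \<longrightarrow> hcoeff y (k, n) = 0"
      by (auto simp: P_def)
    then show "x + y \<in> P" unfolding P_def by (auto simp: plus_hardy2.rep_eq intro!: exI[of _ "max N N'"])
  qed
  have "hbasis p \<in> P" for p
    by (auto simp: P_def hbasis.rep_eq intro!: exI[of _ "Suc (fst p)"])
  then have "closure (h2_span P) = UNIV"
    by (intro hbasis_total closed_subspace_closure_span in_closure_span)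
  moreover have "h2_span P = P" using sub h2.span_eq_iff by blast
  ultimately obtain X where X: "\<And>n. X n \<in> P" "X \<longlonglongrightarrow> f"
    using closure_sequential[of f P] by auto
  have "(\<lambda>n. norm (Mz \<psi> (X n))) \<longlonglongrightarrow> norm (Mz \<psi> f)"
    by (intro tendsto_norm tendsto_bounded_op[OF bounded_op_Mz[OF \<psi>]] X)
  moreover have "norm (Mz \<psi> (X n)) = norm (X n)" for n
    using X(1)[of n] poly unfolding P_def by blast
  ultimately have "(\<lambda>n. norm (X n)) \<longlonglongrightarrow> norm (Mz \<psi> f)" by simp
  moreover have "(\<lambda>n. norm (X n)) \<longlonglongrightarrow> norm f" by (intro tendsto_norm X)
  ultimately show ?thesis by (rule LIMSEQ_unique)
qed

text \<open>Polarization.\<close>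

lemma isometricI_norm:
  assumes T: "bounded_op T" and n: "\<And>x. norm (T x) = norm x"
  shows "isometric T"
proof -
  have re: "inner (T x) (T y) = inner x y" for x y
  proof -
    have "(norm (T (x + y)))^2 = (norm (x + y))^2" by (simp only: n)
    then have "(norm (T x))^2 + 2 * inner (T x) (T y) + (norm (T y))^2 = (norm x)^2 + 2 * inner x y + (norm y)^2"
      unfolding bounded_opD(1)[OF T] power2_norm_eq_inner
      by (simp add: inner_add_left inner_add_right inner_commute)
    then show ?thesis by (simp add: n)
  qed
  have "cinner (T x) (T y) = cinner x y" for x y
  proof (rule complex_eqI)
    show "Re (cinner (T x) (T y)) = Re (cinner x y)"
      using re[of x y] by (simp add: inner_hardy2_def)
    show "Im (cinner (T x) (T y)) = Im (cinner x y)"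
      using re[of x "cscale \<i> y"] by (simp add: inner_hardy2_def bounded_opD(2)[OF T] cinner_cscale_right)
  qed
  then show ?thesis by (simp add: isometric_def)
qed

lemma isometric_Mz: "inner_function \<psi> \<Longrightarrow> isometric (Mz \<psi>)"
  by (intro isometricI_norm bounded_op_Mz Mz_isometric_norm) (auto simp: inner_function_def Hinf_def)

lemma isometric_Mw:
  assumes "Hinf \<psi>" "isometric (Mz \<psi>)"
  shows "isometric (Mw \<psi>)"
  using assms(2) by (simp add: isometric_def Mw_flip[OF assms(1)])

lemma inner_function_id: "inner_function (\<lambda>z. z)"
proof -
  have "((\<lambda>r. of_real r * cis t) \<longlongrightarrow> of_real 1 * cis t) (at_left 1)" for t
    by (intro tendsto_intros)
  then have "\<exists>l. cmod l = 1 \<and> ((\<lambda>r. of_real r * cis t) \<longlongrightarrow> l) (at_left 1)" for t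
    by (intro exI[of _ "cis t"]) simp
  then show ?thesis
    unfolding inner_function_def by (auto intro!: holomorphic_intros bounded_subset[OF bounded_ball[of 0 1]])
qed

lemmas isometric_Z = isometric_Mz[OF inner_function_id]
lemmas isometric_W = isometric_Mw[OF Hinf_id isometric_Z]

subsection \<open>The algebra of bounded analytic functions\<close>

lemma Hinf_mult: assumes "Hinf f" "Hinf g" shows "Hinf (\<lambda>z. f z * g z)"
proof -
  obtain C where C: "\<forall>z\<in>disk. cmod (f z) \<le> C" using Hinf_bound[OF assms(1)] by blast
  obtain D where D: "\<forall>z\<in>disk. cmod (g z) \<le> D" using Hinf_bound[OF assms(2)] by blast
  show ?thesis
  proof (rule HinfI[of _ "C * D"])
    show "(\<lambda>z. f z * g z) holomorphic_on disk"
      using assms by (auto simp: Hinf_def intro: holomorphic_intros)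
    fix z assume "z \<in> disk"
    then have f: "cmod (f z) \<le> C" and g: "cmod (g z) \<le> D" using C D by auto
    show "cmod (f z * g z) \<le> C * D"
      unfolding norm_mult by (rule mult_mono[OF f g order_trans[OF norm_ge_zero f] norm_ge_zero])
  qed
qed

lemma Hinf_const: "Hinf (\<lambda>z. c)"
  by (rule HinfI[of _ "cmod c"]) (auto intro: holomorphic_intros)

lemma Hinf_diff: assumes "Hinf f" "Hinf g" shows "Hinf (\<lambda>z. f z - g z)"
proof -
  obtain C where C: "\<forall>z\<in>disk. cmod (f z) \<le> C" using Hinf_bound[OF assms(1)] by blast
  obtain D where D: "\<forall>z\<in>disk. cmod (g z) \<le> D" using Hinf_bound[OF assms(2)] by blast
  show ?thesis
  proof (rule HinfI[of _ "C + D"])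
    show "(\<lambda>z. f z - g z) holomorphic_on disk"
      using assms by (auto simp: Hinf_def intro: holomorphic_intros)
    show "cmod (f z - g z) \<le> C + D" if "z \<in> disk" for z
      using C D that by (intro order_trans[OF norm_triangle_ineq4] add_mono) auto
  qed
qed

lemma Hinf_power: "Hinf f \<Longrightarrow> Hinf (\<lambda>z. f z ^ n)"
  by (induction n) (simp_all add: Hinf_const Hinf_mult)

lemma one_minus_bound:
  assumes "cmod a < 1" "cmod s \<le> 1"
  shows "1 - cmod a \<le> cmod (1 - cnj a * s)" "1 - cnj a * s \<noteq> 0"
proof -
  have "cmod (cnj a * s) \<le> cmod a * 1"
    unfolding norm_mult complex_mod_cnj using assms by (intro mult_left_mono) auto
  then show "1 - cmod a \<le> cmod (1 - cnj a * s)"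
    using norm_triangle_ineq2[of 1 "cnj a * s"] by simp
  then show "1 - cnj a * s \<noteq> 0" using assms by auto
qed

lemma Hinf_inverse_one_minus:
  assumes f: "Hinf f" "\<And>z. z \<in> disk \<Longrightarrow> cmod (f z) \<le> 1" and a: "cmod a < 1"
  shows "Hinf (\<lambda>z. 1 / (1 - cnj a * f z))"
proof (rule HinfI[of _ "1 / (1 - cmod a)"])
  show "(\<lambda>z. 1 / (1 - cnj a * f z)) holomorphic_on disk"
    using f one_minus_bound(2)[OF a f(2)] by (auto simp: Hinf_def intro!: holomorphic_intros)
  show "cmod (1 / (1 - cnj a * f z)) \<le> 1 / (1 - cmod a)" if "z \<in> disk" for z
    using one_minus_bound(1)[OF a f(2)[OF that]] a by (simp add: norm_divide frac_le)
qed

lemma Hinf_moebius: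
  assumes f: "Hinf f" "\<And>z. z \<in> disk \<Longrightarrow> cmod (f z) \<le> 1" and a: "cmod a < 1"
  shows "Hinf (\<lambda>z. moebius a (f z))"
proof -
  have "Hinf (\<lambda>z. (a - f z) * (1 / (1 - cnj a * f z)))"
    by (intro Hinf_mult Hinf_diff Hinf_const f Hinf_inverse_one_minus a)
  then show ?thesis by (simp add: moebius_def)
qed

lemma Mz_Mw: "Hinf f \<Longrightarrow> Hinf g \<Longrightarrow> Mz f (Mw g x) = Mw g (Mz f x)"
  by (rule hval_ext) (simp add: hval_Mz hval_Mw mult.left_commute)

lemma Mz_one_minus:
  "Hinf f \<Longrightarrow> Mz (\<lambda>z. 1 - c * f z) x = x - cscale c (Mz f x)"
  by (rule mult_opI) (simp add: hval_linear hval_Mz algebra_simps)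

lemma Mz_const_minus:
  "Hinf f \<Longrightarrow> Mz (\<lambda>z. c - f z) x = cscale c x - Mz f x"
  by (rule mult_opI) (simp add: hval_linear hval_Mz algebra_simps)

lemma Mw_one_minus:
  "Hinf f \<Longrightarrow> Mw (\<lambda>z. 1 - c * f z) x = x - cscale c (Mw f x)"
  by (rule mult_opI) (simp add: hval_linear hval_Mw algebra_simps)

lemma Mz_moebius_one_minus:
  assumes f: "Hinf f" "\<And>z. z \<in> disk \<Longrightarrow> cmod (f z) \<le> 1" and a: "cmod a < 1"
  shows "Mz (\<lambda>z. moebius a (f z)) (Mz (\<lambda>z. 1 - cnj a * f z) x) = Mz (\<lambda>z. a - f z) x"
proof -
  have H: "Hinf (\<lambda>z. 1 - cnj a * f z)" "Hinf (\<lambda>z. moebius a (f z))" "Hinf (\<lambda>z. a - f z)"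
    using f a by (auto intro!: Hinf_diff Hinf_mult Hinf_const Hinf_moebius)
  show ?thesis
  proof (rule mult_opI[symmetric])
    fix z w assume zw: "z \<in> disk" "w \<in> disk"
    show "hval (Mz (\<lambda>z. moebius a (f z)) (Mz (\<lambda>z. 1 - cnj a * f z) x)) z w = (a - f z) * hval x z w"
      unfolding hval_Mz[OF H(2) zw] hval_Mz[OF H(1) zw]
      using one_minus_bound(2)[OF a f(2)[OF zw(1)]] by (simp add: moebius_def)
  qed
qed

text \<open>For an isometry \<open>T\<close> the norms of \<open>(a - T) y\<close> and \<open>(1 - cnj a T) y\<close> agree, as one sees by
  expanding both.  Since \<open>1 - cnj a T\<close> is invertible, the quotient of the two is an isometry.\<close>

lemma isometric_Mz_moebius:
  assumes f: "Hinf f" "\<And>z. z \<in> disk \<Longrightarrow> cmod (f z) \<le> 1" "isometric (Mz f)" and a: "cmod a < 1"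
  shows "isometric (Mz (\<lambda>z. moebius a (f z)))"
proof -
  have H: "Hinf (\<lambda>z. 1 - cnj a * f z)" "Hinf (\<lambda>z. 1 / (1 - cnj a * f z))"
    using f a by (auto intro!: Hinf_diff Hinf_mult Hinf_const Hinf_inverse_one_minus)
  have inv: "Mz (\<lambda>z. 1 - cnj a * f z) (Mz (\<lambda>z. 1 / (1 - cnj a * f z)) x) = x" for x
  proof (rule hval_ext)
    fix z w assume zw: "z \<in> disk" "w \<in> disk"
    show "hval (Mz (\<lambda>z. 1 - cnj a * f z) (Mz (\<lambda>z. 1 / (1 - cnj a * f z)) x)) z w = hval x z w"
      unfolding hval_Mz[OF H(2) zw] hval_Mz[OF H(1) zw]
      using one_minus_bound(2)[OF a f(2)[OF zw(1)]] by simp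
  qed
  have iso: "cinner (Mz (\<lambda>z. a - f z) y) (Mz (\<lambda>z. a - f z) y')
      = cinner (Mz (\<lambda>z. 1 - cnj a * f z) y) (Mz (\<lambda>z. 1 - cnj a * f z) y')" for y y'
    unfolding Mz_one_minus[OF f(1)] Mz_const_minus[OF f(1)]
    by (simp add: cinner_simps isometricD[OF f(3)] algebra_simps)
  have "Mz (\<lambda>z. moebius a (f z)) x = Mz (\<lambda>z. a - f z) (Mz (\<lambda>z. 1 / (1 - cnj a * f z)) x)" for x
    using Mz_moebius_one_minus[OF f(1,2) a, of "Mz (\<lambda>z. 1 / (1 - cnj a * f z)) x"] unfolding inv .
  then show ?thesis
    by (simp add: isometric_def iso inv)
qed

subsection \<open>The constant function and contractivity\<close>

abbreviation one_h2 :: hardy2 where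
  "one_h2 \<equiv> kern 0 0"

lemma hval_kern:
  assumes l: "l \<in> disk" "m \<in> disk" and z: "z \<in> disk" "w \<in> disk"
  shows "hval (kern l m) z w = 1 / ((1 - cnj l * z) * (1 - cnj m * w))"
proof -
  have lt: "cmod (cnj l * z) < 1" "cmod (cnj m * w) < 1"
    using l z by (auto simp: norm_mult intro: mult_left_le_one_le le_less_trans[OF mult_left_le])
  have slice: "(\<Sum>k. hcoeff (kern l m) (k, n) * z ^ k) = cnj m ^ n * (1 / (1 - cnj l * z))" for n
  proof -
    have "(\<lambda>k. cnj m ^ n * (cnj l * z) ^ k) sums (cnj m ^ n * (1 / (1 - cnj l * z)))"
      by (intro sums_mult geometric_sums lt)
    moreover have "hcoeff (kern l m) (k, n) * z ^ k = cnj m ^ n * (cnj l * z) ^ k" for k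
      using l by (simp add: kern.rep_eq power_mult_distrib mult_ac)
    ultimately show ?thesis by (simp add: sums_iff)
  qed
  have "(\<lambda>n. cnj m ^ n * (1 / (1 - cnj l * z)) * w ^ n) sums hval (kern l m) z w"
    using has_sum_imp_sums[OF hval_slices[OF z, of "kern l m"]] unfolding slice .
  then have "(\<lambda>n. (1 / (1 - cnj l * z)) * (cnj m * w) ^ n) sums hval (kern l m) z w"
    by (simp add: power_mult_distrib mult_ac)
  moreover have "(\<lambda>n. (1 / (1 - cnj l * z)) * (cnj m * w) ^ n) sums
      ((1 / (1 - cnj l * z)) * (1 / (1 - cnj m * w)))"
    by (intro sums_mult geometric_sums lt)
  ultimately show ?thesis using sums_unique2 by fastforce
qed

text \<open>All powers of \<open>f\<close> are isometric multipliers too, so the powers of \<open>f(z)\<close> are bounded.\<close>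

lemma isometric_multiplier_le_one:
  assumes f: "Hinf f" "isometric (Mz f)" and z: "z \<in> disk"
  shows "cmod (f z) \<le> 1"
proof (rule ccontr)
  assume "\<not> cmod (f z) \<le> 1"
  then obtain n where n: "norm one_h2 * norm (kern z 0) < cmod (f z) ^ n"
    using real_arch_pow by fastforce
  have "norm ((Mz f ^^ n) one_h2) = norm one_h2"
    by (induction n) (simp_all add: isometric_norm[OF f(2)])
  moreover have "hval ((Mz f ^^ n) one_h2) z 0 = f z ^ n"
    using z by (induction n) (simp_all add: hval_Mz f hval_kern)
  ultimately have "cmod (f z) ^ n \<le> norm one_h2 * norm (kern z 0)"
    using cinner_Cauchy_Schwarz[of "(Mz f ^^ n) one_h2" "kern z 0"] z
    by (simp add: cinner_kern norm_power)
  then show False using n by simp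
qed

lemma nonconstant_inner_less_one:
  assumes f: "inner_function f" "\<not> f constant_on disk" and z: "z \<in> disk"
  shows "cmod (f z) < 1"
proof (rule ccontr)
  have H: "Hinf f" using f(1) by (simp add: inner_function_def Hinf_def)
  have le: "cmod (f x) \<le> 1" if "x \<in> disk" for x
    by (rule isometric_multiplier_le_one[OF H isometric_Mz[OF f(1)] that])
  assume "\<not> cmod (f z) < 1"
  then have "cmod (f x) \<le> cmod (f z)" if "x \<in> disk" for x using le[OF that] by linarith
  then have "f constant_on disk"
    using H z by (intro maximum_modulus_principle[of f disk disk z]) (auto simp: Hinf_def)
  with f(2) show False ..
qed

subsection \<open>Eigenvectors of adjoint multipliers\<close>

text \<open>The eigenvectors of the adjoint of multiplication by \<open>\<psi>(z)\<close>; the eigenvalue is the conjugate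
  of \<open>s\<close>.\<close>

definition eigz :: "(complex \<Rightarrow> complex) \<Rightarrow> complex \<Rightarrow> hardy2 set" where
  "eigz \<psi> s = {y. \<forall>x. cinner (Mz \<psi> x) y = s * cinner x y}"

lemma eigzD: "y \<in> eigz \<psi> s \<Longrightarrow> cinner (Mz \<psi> x) y = s * cinner x y"
  by (simp add: eigz_def)

lemma closed_subspace_eigz: "closed_subspace (eigz \<psi> s)"
  unfolding eigz_def
proof (rule closed_subspaceI)
  have "continuous_on UNIV (\<lambda>y. cinner g y)" for g
    by (rule linear_continuous_on[OF bounded_linear_cinner_right])
  then show "closed {y. \<forall>x. cinner (Mz \<psi> x) y = s * cinner x y}"
    by (intro closed_Collect_all closed_Collect_eq continuous_intros)
qed (simp_all add: cinner_simps algebra_simps)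

lemma kern_eigz: "Hinf \<psi> \<Longrightarrow> z \<in> disk \<Longrightarrow> w \<in> disk \<Longrightarrow> kern z w \<in> eigz \<psi> (\<psi> z)"
  by (simp add: eigz_def cinner_kern hval_Mz)

lemma hcoeff_W: "hcoeff (Mw (\<lambda>z. z) y) (k, n) = (case n of 0 \<Rightarrow> 0 | Suc m \<Rightarrow> hcoeff y (k, m))"
proof -
  have t: "taylor (\<lambda>z. z) i = (if i = 1 then 1 else 0)" for i
    by (simp add: taylor_def)
  have "hcoeff (Mw (\<lambda>z. z) y) (k, n) = conv (taylor (\<lambda>z. z)) (\<lambda>i. hcoeff y (k, i)) n"
    by (simp add: Mw_flip[OF Hinf_id] flip.rep_eq hcoeff_Mz[OF Hinf_id])
  also have "\<dots> = (\<Sum>i\<le>n. if i = 1 then hcoeff y (k, n - i) else 0)"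
    unfolding conv_def by (intro sum.cong) (auto simp: t)
  also have "\<dots> = (case n of 0 \<Rightarrow> 0 | Suc m \<Rightarrow> hcoeff y (k, m))"
    by (subst sum.delta) (auto split: nat.split)
  finally show ?thesis .
qed

lift_definition shift_w :: "hardy2 \<Rightarrow> hardy2" is "\<lambda>c p. c (fst p, Suc (snd p))"
proof -
  fix c :: "nat \<times> nat \<Rightarrow> complex"
  assume "(\<lambda>p. (cmod (c p))^2) summable_on UNIV"
  then have "(\<lambda>p. (cmod (c p))^2) summable_on (\<lambda>p. (fst p, Suc (snd p))) ` UNIV"
    by (rule summable_on_subset_banach) simp
  moreover have "inj (\<lambda>p :: nat \<times> nat. (fst p, Suc (snd p)))" by (auto simp: inj_on_def prod_eq_iff)
  ultimately show "(\<lambda>p. (cmod (c (fst p, Suc (snd p))))^2) summable_on UNIV"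
    by (simp add: summable_on_reindex o_def)
qed

lemma cinner_degree_zero_W:
  assumes "\<And>k n. hcoeff f (k, Suc n) = 0"
  shows "cinner f (Mw (\<lambda>z. z) y) = 0"
proof -
  have "hcoeff f p * cnj (hcoeff (Mw (\<lambda>z. z) y) p) = 0" for p
    by (cases p, cases "snd p") (use assms in \<open>auto simp: hcoeff_W\<close>)
  then have "cinner f (Mw (\<lambda>z. z) y) = (\<Sum>\<^sub>\<infinity>p :: nat \<times> nat. 0)"
    unfolding cinner_def by (rule infsum_cong)
  then show ?thesis by simp
qed

text \<open>Any \<open>x\<close> is the sum of an element that does not depend on \<open>w\<close> and a multiple of \<open>w\<close>.  The first
  summand is orthogonal to all multiples of \<open>w\<close>, also after multiplication by \<open>\<psi>(z)\<close>, and from the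
  second one the factor \<open>w\<close> can be cancelled.  This is the fact that multiplications in the variable
  \<open>z\<close> commute with the adjoints of multiplications in \<open>w\<close>.\<close>

lemma eigz_W_invariant:
  assumes \<psi>: "Hinf \<psi>" and y: "y \<in> eigz \<psi> s"
  shows "Mw (\<lambda>z. z) y \<in> eigz \<psi> s"
  unfolding eigz_def
proof (intro CollectI allI)
  fix x
  define x1 where "x1 = shift_w x"
  define x0 where "x0 = x - Mw (\<lambda>z. z) x1"
  have c0: "hcoeff x0 (k, Suc n) = 0" for k n
    by (simp add: x0_def x1_def minus_hardy2.rep_eq hcoeff_W shift_w.rep_eq)
  have c1: "hcoeff (Mz \<psi> x0) (k, Suc n) = 0" for k n
    by (simp add: hcoeff_Mz[OF \<psi>] conv_def c0)
  have x: "x = x0 + Mw (\<lambda>z. z) x1" by (simp add: x0_def)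
  have "cinner (Mz \<psi> x) (Mw (\<lambda>z. z) y)
      = cinner (Mz \<psi> x0) (Mw (\<lambda>z. z) y) + cinner (Mw (\<lambda>z. z) (Mz \<psi> x1)) (Mw (\<lambda>z. z) y)"
    by (subst x) (simp add: bounded_opD[OF bounded_op_Mz[OF \<psi>]] cinner_add_left Mz_Mw[OF \<psi> Hinf_id])
  also have "\<dots> = s * cinner x1 y"
    by (simp add: cinner_degree_zero_W[OF c1] isometricD[OF isometric_W] eigzD[OF y])
  also have "\<dots> = s * cinner x (Mw (\<lambda>z. z) y)"
    by (subst x) (simp add: cinner_add_left cinner_degree_zero_W[OF c0] isometricD[OF isometric_W])
  finally show "cinner (Mz \<psi> x) (Mw (\<lambda>z. z) y) = s * cinner x (Mw (\<lambda>z. z) y)" .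
qed

lemma eigz_Mw:
  assumes "Hinf \<psi>" "Hinf \<eta>" "y \<in> eigz \<psi> s"
  shows "Mw \<eta> y \<in> eigz \<psi> s"
  by (rule Mw_invariant[OF closed_subspace_eigz eigz_W_invariant[OF assms(1)] assms(2,3)])

lemma eigz_moebius:
  assumes f: "Hinf f" "\<And>z. z \<in> disk \<Longrightarrow> cmod (f z) \<le> 1" and a: "cmod a < 1"
    and y: "y \<in> eigz (\<lambda>z. moebius a (f z)) 0"
  shows "y \<in> eigz f a"
  unfolding eigz_def
proof (intro CollectI allI)
  fix x
  have "cinner (Mz (\<lambda>z. a - f z) x) y
      = cinner (Mz (\<lambda>z. moebius a (f z)) (Mz (\<lambda>z. 1 - cnj a * f z) x)) y"
    by (simp only: Mz_moebius_one_minus[OF f a])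
  also have "\<dots> = 0 * cinner (Mz (\<lambda>z. 1 - cnj a * f z) x) y" by (rule eigzD[OF y])
  finally have "cinner (Mz (\<lambda>z. a - f z) x) y = 0" by simp
  then show "cinner (Mz f x) y = a * cinner x y"
    by (simp add: Mz_const_minus[OF f(1)] cinner_simps)
qed

subsection \<open>Orthonormal families and the isometries they define\<close>

text \<open>The isometry is constructed as the adjoint of the map that assigns to \<open>x\<close> its coefficients with respect to
  the family \<open>v\<close>, which are square summable by Bessel's inequality.  Its values follow by
  pairing with the kernels.\<close>

lemma isometry_from_orthonormal:
  assumes v: "\<And>p q. cinner (v p) (v q) = (if p = q then 1 else 0)"
  shows "\<exists>V. bounded_op V \<and> isometric V \<and> (\<forall>p. V (hbasis p) = v p) \<and>
    (\<forall>f. \<forall>z\<in>disk. \<forall>w\<in>disk. hval (V f) z w = (\<Sum>\<^sub>\<infinity>p. hcoeff f p * hval (v p) z w))"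
proof -
  have inj: "inj v"
  proof (rule injI)
    fix p q assume "v p = v q"
    then show "p = q" using v[of p q] v[of p p] by (auto split: if_splits)
  qed
  have fin: "(\<Sum>p\<in>F. (cmod (cinner x (v p)))^2) \<le> (norm x)^2" if "finite F" for x F
  proof -
    have "norm (v p) = 1" for p
      using v[of p p] norm_ge_zero[of "v p"] by (simp add: norm_hardy2_def inner_hardy2_def)
    then have "orthonormal_set (v ` F)" using v by (auto simp: orthonormal_set_def)
    from Bessel_inequality[OF this, of x] that show ?thesis
      by (simp add: sum.reindex inj_on_subset[OF inj])
  qed
  define S where "S x = Abs_hardy2 (\<lambda>p. cinner x (v p))" for x
  have summ: "(\<lambda>p. (cmod (cinner x (v p)))^2) summable_on UNIV" for x
    by (rule nonneg_bdd_above_summable_on) (auto intro!: bdd_aboveI2 fin)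
  then have S: "hcoeff (S x) p = cinner x (v p)" for x p
    by (simp add: S_def Abs_hardy2_inverse)
  have bS: "bounded_op S"
  proof (rule bounded_opI[of _ 1])
    show "S (x + y) = S x + S y" for x y
      by (rule hcoeff_eqI) (simp add: S plus_hardy2.rep_eq cinner_add_left)
    show "S (cscale a x) = cscale a (S x)" for a x
      by (rule hcoeff_eqI) (simp add: S cscale.rep_eq cinner_cscale_left)
    have "(norm (S x))^2 \<le> (norm x)^2" for x
      unfolding norm_sq_infsum[of "S x"] S by (rule infsum_le_finite_sums[OF summ]) (rule fin)
    then show "norm (S x) \<le> 1 * norm x" for x by (auto intro: power2_le_imp_le)
  qed
  define V where "V = adj_on UNIV S"
  have V: "cinner h (V f) = cinner (S h) f" for h f
    unfolding V_def by (rule adj_on(2)[OF bS closed_subspace_UNIV]) simp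
  have Sv: "S (v p) = hbasis p" for p
    by (rule hcoeff_eqI) (auto simp: S v hbasis.rep_eq)
  have SV: "S (V f) = f" for f
  proof (rule hcoeff_eqI)
    fix p
    have "hcoeff (S (V f)) p = cnj (cinner (v p) (V f))"
      by (subst cinner_commute[symmetric]) (rule S)
    also have "\<dots> = cnj (cinner (hbasis p) f)" by (simp add: V Sv)
    also have "\<dots> = hcoeff f p" by (subst cinner_commute[symmetric]) (rule cinner_hbasis)
    finally show "hcoeff (S (V f)) p = hcoeff f p" .
  qed
  have iso: "isometric V" by (simp add: isometric_def V SV)
  have "bounded_op V"
    by (rule bounded_opI[of _ 1])
       (simp_all add: isometric_norm[OF iso], simp_all add: V_def adj_on_linear[OF bS closed_subspace_UNIV])
  moreover have "V (hbasis p) = v p" for p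
    by (rule cinner_ext_right) (simp add: V cinner_hbasis S)
  moreover have "hval (V f) z w = (\<Sum>\<^sub>\<infinity>p. hcoeff f p * hval (v p) z w)"
    if zw: "z \<in> disk" "w \<in> disk" for f z w
  proof -
    have "hval (V f) z w = cinner (V f) (kern z w)" by (simp only: cinner_kern[OF zw])
    also have "\<dots> = cnj (cinner (kern z w) (V f))" by (rule cinner_commute)
    also have "\<dots> = cinner f (S (kern z w))"
      by (subst V) (rule cinner_commute[symmetric])
    also have "\<dots> = (\<Sum>\<^sub>\<infinity>p. hcoeff f p * hval (v p) z w)"
    proof -
      have "cnj (cinner (kern z w) (v p)) = hval (v p) z w" for p
        unfolding cinner_kern[OF zw, symmetric] by (rule cinner_commute[symmetric])
      then show ?thesis by (simp add: cinner_def[of f] S)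
    qed
    finally show ?thesis .
  qed
  ultimately show ?thesis using iso by (intro exI[of _ V] conjI allI ballI)
qed

text \<open>The Gram identity extends from the standard basis by linearity and continuity, first in one argument,
  then in the other.\<close>

lemma gram_extension:
  assumes S: "bounded_op S" and T: "bounded_op T"
    and c: "\<And>p q. cinner (S (hbasis p)) (T (hbasis q)) = (if p = q then c else 0)"
  shows "cinner (S x) (T y) = c * cinner x y"
proof -
  have bc: "bounded_op (cscale c)"
    by (rule bounded_opI[of _ "cmod c"])
       (auto simp: h2.scale_right_distrib norm_cscale mult.commute)
  have 1: "cinner (S x) (T (hbasis q)) = c * cinner x (hbasis q)" for x q
  proof -
    have "{x. cinner (S x) (T (hbasis q)) = cinner (cscale c x) (hbasis q)} = UNIV"
      by (rule hbasis_total[OF closed_subspace_weak_eq[OF S bc]])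
         (auto simp: c cinner_cscale_left cinner_hbasis hbasis.rep_eq cscale.rep_eq)
    then have "x \<in> {x. cinner (S x) (T (hbasis q)) = cinner (cscale c x) (hbasis q)}" by simp
    then show ?thesis by (simp add: cinner_cscale_left)
  qed
  have "{y. cinner (T y) (S x) = cinner y (cscale c x)} = UNIV"
  proof (rule hbasis_total[OF closed_subspace_weak_eq[OF T bounded_op_id]])
    show "hbasis q \<in> {y. cinner (T y) (S x) = cinner y (cscale c x)}" for q
      using arg_cong[OF 1[of x q], of cnj] cinner_commute[of "T (hbasis q)"] cinner_commute[of "hbasis q" x]
      by (simp add: cinner_cscale_right)
  qed
  then have "cinner (T y) (S x) = cinner y (cscale c x)" by blast
  then have "cinner (S x) (T y) = cinner (cscale c x) y"
    using cinner_commute by metis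
  then show ?thesis by (simp add: cinner_cscale_left)
qed

section \<open>Composition with inner functions\<close>

text \<open>If \<open>e\<close> and \<open>f\<close> are eigenvectors of \<open>T\<^sup>*\<close>, then the inner product of \<open>T\<^sup>k e\<close> and \<open>f\<close> is \<open>a\<^sup>k\<close> times
  the one of \<open>e\<close> and \<open>f\<close>.  For an inner function \<open>T = \<theta>\<close> with \<open>\<theta>(0) = a\<close> and \<open>e = f = 1\<close> this means
  that \<open>\<theta>\<close> transports normalized Lebesgue measure on the circle to the Poisson kernel at \<open>a\<close>, and the
  factor \<open>1 - cnj a T\<close> below compensates for the density.\<close>

lemma shifted_eigenvectors_orthogonal:
  assumes T: "bounded_op T" "isometric T"
    and e: "\<And>x. cinner (T x) e = a * cinner x e" and f: "\<And>x. cinner (T x) f = a * cinner x f"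
  shows "cinner ((T ^^ p) e - cscale (cnj a) ((T ^^ Suc p) e)) ((T ^^ q) f - cscale (cnj a) ((T ^^ Suc q) f))
    = (if p = q then (1 - (cmod a)^2) * cinner e f else 0)"
proof -
  define g where "g n x = (T ^^ n) x - cscale (cnj a) ((T ^^ Suc n) x)" for n x
  have step: "g (Suc n) x = T (g n x)" for n x
    by (simp add: g_def bounded_opD[OF T(1)])
  have cancel: "cinner (g (k + q) x) (g (l + q) y) = cinner (g k x) (g l y)" for k l q x y
    by (induction q) (simp_all add: step isometricD[OF T(2)])
  have ahead: "cinner (g (Suc j) x) (g 0 y) = 0" if y: "\<And>x. cinner (T x) y = a * cinner x y" for x y j
    by (simp add: g_def cinner_simps isometricD[OF T(2)] y algebra_simps)
  have ahead': "cinner (g p x) (g q y) = 0" if "q < p" "\<And>x. cinner (T x) y = a * cinner x y" for p q x y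
  proof -
    obtain j where "p = Suc j + q" using \<open>q < p\<close> less_iff_Suc_add by auto
    then show ?thesis using cancel[of "Suc j" q x 0 y] ahead[OF that(2)] by simp
  qed
  have eq: "cinner (g 0 e) (g 0 f) = (1 - (cmod a)^2) * cinner e f"
  proof -
    have "cinner e (T f) = cnj (cinner (T f) e)" by (rule cinner_commute)
    also have "\<dots> = cnj a * cinner e f" by (simp add: e) (metis cinner_commute)
    finally show ?thesis
      by (simp add: g_def cinner_simps isometricD[OF T(2)] f complex_norm_square algebra_simps del: of_real_power)
  qed
  have "cinner (g p e) (g q f) = (if p = q then (1 - (cmod a)^2) * cinner e f else 0)"
  proof (cases p q rule: linorder_cases)
    case less
    then have "cinner (g q f) (g p e) = 0" using ahead' e by blast
    then show ?thesis using less by (subst cinner_commute) simp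
  next
    case equal
    then show ?thesis using cancel[of 0 p e 0 f] eq by simp
  next
    case greater
    then show ?thesis using ahead' f by simp
  qed
  then show ?thesis by (simp only: g_def)
qed

text \<open>Here \<open>\<tau>\<close> is \<open>\<theta>\<close> followed by the disk automorphism that moves \<open>a = \<theta>(0)\<close> to zero.  The functions
  \<open>h\<^sub>p\<close> are the images of the monomials \<open>z\<^sup>p\<close> under the isometric version of composition with \<open>\<theta>\<close>, and
  \<open>e\<^sub>l\<close> is the reproducing kernel at \<open>l\<close> of the model space \<open>H^2 \<ominus> \<tau> H^2\<close>.\<close>

locale nonconstant_inner =
  fixes \<theta> :: "complex \<Rightarrow> complex"
  assumes inner: "inner_function \<theta>" and nonconstant: "\<not> \<theta> constant_on disk"
begin

definition "a = \<theta> 0"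
definition "\<tau> z = moebius a (\<theta> z)"
definition "d = complex_of_real (sqrt (1 - (cmod a)^2))"
definition "h p z = (1 - cnj a * \<theta> z) / d * \<theta> z ^ p"
definition "e l z = (1 - cnj (\<tau> l) * \<tau> z) / (1 - cnj l * z)"

lemma Hinf_\<theta>: "Hinf \<theta>"
  using inner by (simp add: inner_function_def Hinf_def)

lemma \<theta>_less: "z \<in> disk \<Longrightarrow> cmod (\<theta> z) < 1"
  by (rule nonconstant_inner_less_one[OF inner nonconstant])

lemma \<theta>_le: "z \<in> disk \<Longrightarrow> cmod (\<theta> z) \<le> 1"
  using \<theta>_less less_imp_le by blast

lemma \<theta>_disk: "z \<in> disk \<Longrightarrow> \<theta> z \<in> disk"
  using \<theta>_less by simp

lemma a_less: "cmod a < 1"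
  by (simp add: a_def \<theta>_less)

lemma d_sq: "d * d = 1 - (cmod a)^2" and d_nz: "d \<noteq> 0" and cnj_d: "cnj d = d"
proof -
  have pos: "0 < 1 - (cmod a)^2" using a_less by (simp add: abs_square_less_1)
  then show "d \<noteq> 0" by (simp add: d_def)
  show "d * d = 1 - (cmod a)^2"
    unfolding d_def of_real_mult[symmetric] using pos by (simp add: real_sqrt_mult_self)
  show "cnj d = d" by (simp add: d_def)
qed

lemma isometric_\<theta>: "isometric (Mz \<theta>)"
  by (rule isometric_Mz[OF inner])

lemma Hinf_\<tau>: "Hinf \<tau>"
  using Hinf_moebius[OF Hinf_\<theta> \<theta>_le a_less] by (simp add: \<tau>_def[abs_def])

lemma isometric_\<tau>: "isometric (Mz \<tau>)"
  using isometric_Mz_moebius[OF Hinf_\<theta> \<theta>_le isometric_\<theta> a_less] by (simp add: \<tau>_def[abs_def])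

lemma \<tau>_le: "z \<in> disk \<Longrightarrow> cmod (\<tau> z) \<le> 1"
  by (rule isometric_multiplier_le_one[OF Hinf_\<tau> isometric_\<tau>])

lemma \<tau>_0: "\<tau> 0 = 0"
  by (simp add: \<tau>_def a_def moebius_def)

lemma Hinf_num: "Hinf (\<lambda>z. 1 - cnj (\<tau> l) * \<tau> z)"
  by (intro Hinf_diff Hinf_mult Hinf_const Hinf_\<tau>)

lemma Hinf_e: assumes "l \<in> disk" shows "Hinf (e l)"
proof -
  have "Hinf (\<lambda>z. (1 - cnj (\<tau> l) * \<tau> z) * (1 / (1 - cnj l * z)))"
    using assms by (intro Hinf_mult Hinf_num Hinf_inverse_one_minus[OF Hinf_id]) auto
  then show ?thesis by (simp add: e_def[abs_def])
qed

lemma Hinf_h: "Hinf (h p)"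
proof -
  have "Hinf (\<lambda>z. (1 - cnj a * \<theta> z) * (1 / d) * \<theta> z ^ p)"
    by (intro Hinf_mult Hinf_diff Hinf_const Hinf_\<theta> Hinf_power)
  then show ?thesis by (simp add: h_def[abs_def])
qed

lemma Hinf_inverse_h: "Hinf (\<lambda>z. 1 / h 0 z)"
proof -
  have "Hinf (\<lambda>z. d * (1 / (1 - cnj a * \<theta> z)))"
    by (intro Hinf_mult Hinf_const Hinf_inverse_one_minus Hinf_\<theta> \<theta>_le a_less)
  then show ?thesis by (simp add: h_def[abs_def])
qed

lemma h_0_nz: "z \<in> disk \<Longrightarrow> h 0 z \<noteq> 0"
  using one_minus_bound(2)[OF a_less \<theta>_le] d_nz by (simp add: h_def)

lemma h_power: "h p z = h 0 z * \<theta> z ^ p"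
  by (simp add: h_def)

lemma e_0: "e 0 z = 1" "l \<in> disk \<Longrightarrow> e l 0 = 1"
  by (simp_all add: e_def \<tau>_0)

lemma one_minus_cnj_nz: "l \<in> disk \<Longrightarrow> z \<in> disk \<Longrightarrow> 1 - cnj l * z \<noteq> 0"
  using one_minus_bound(2)[of l z] by simp

text \<open>Since \<open>\<tau>\<close> vanishes at the origin, it is divisible by the coordinate.  The quotient is bounded by
  compactness near the origin, and by twice the bound of \<open>\<tau>\<close> elsewhere.\<close>

lemma exists_quotient: "\<exists>u. Hinf u \<and> (\<forall>z\<in>disk. \<tau> z = z * u z)"
proof -
  have hol: "\<tau> holomorphic_on ball 0 1" using Hinf_\<tau> by (simp add: Hinf_def)
  obtain u where u: "u holomorphic_on ball 0 1" "\<And>z. norm z < 1 \<Longrightarrow> \<tau> z = z * u z"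
    by (rule Schwarz3[OF hol \<tau>_0]) blast
  have "continuous_on (cball 0 (1/2)) u"
    using holomorphic_on_imp_continuous_on[OF u(1)] by (rule continuous_on_subset) auto
  then have "bounded (u ` cball 0 (1/2))"
    by (intro compact_imp_bounded compact_continuous_image) auto
  then obtain C where C: "\<forall>z\<in>cball 0 (1/2). cmod (u z) \<le> C"
    unfolding bounded_iff by blast
  have "cmod (u z) \<le> max C 2" if z: "z \<in> disk" for z
  proof (cases "cmod z \<le> 1/2")
    case True
    then show ?thesis using C by (simp add: max.coboundedI1)
  next
    case False
    have "cmod z * cmod (u z) \<le> 1"
      using u(2)[of z] z \<tau>_le[OF z] by (simp add: norm_mult)
    moreover have "1/2 * cmod (u z) \<le> cmod z * cmod (u z)"
      using False by (intro mult_right_mono) auto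
    ultimately show ?thesis by simp
  qed
  then have "Hinf u" by (rule HinfI[OF u(1)])
  then show ?thesis using u(2) by (intro exI[of _ u]) simp
qed

definition "u = (SOME u. Hinf u \<and> (\<forall>z\<in>disk. \<tau> z = z * u z))"

lemma Hinf_u: "Hinf u" and \<tau>_u: "z \<in> disk \<Longrightarrow> \<tau> z = z * u z"
  using someI_ex[OF exists_quotient] unfolding u_def by blast+

lemma Mz_u: "Mz (\<lambda>z. z) (Mz u x) = Mz \<tau> x"
  by (rule hval_ext) (simp add: hval_Mz Hinf_id Hinf_u Hinf_\<tau> \<tau>_u)

lemma isometric_u: "isometric (Mz u)"
  unfolding isometric_def
proof (intro allI)
  fix x y
  have "cinner (Mz u x) (Mz u y) = cinner (Mz (\<lambda>z. z) (Mz u x)) (Mz (\<lambda>z. z) (Mz u y))"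
    by (rule isometricD[OF isometric_Z, symmetric])
  then show "cinner (Mz u x) (Mz u y) = cinner x y"
    by (simp add: Mz_u isometricD[OF isometric_\<tau>])
qed

lemma Mz_e:
  assumes l: "l \<in> disk"
  shows "Mz (e l) x = x + cscale (cnj l) (Mz (\<lambda>z. z) (Mz (e l) x))
    - cscale (cnj (\<tau> l)) (Mz (\<lambda>z. z) (Mz u x))"
proof (rule mult_opI)
  fix z w assume zw: "z \<in> disk" "w \<in> disk"
  have "e l z * (1 - cnj l * z) = 1 - cnj (\<tau> l) * \<tau> z"
    using one_minus_cnj_nz[OF l zw(1)] by (simp add: e_def)
  then have "e l z = 1 + cnj l * (z * e l z) - cnj (\<tau> l) * \<tau> z"
    by (simp add: algebra_simps)
  then have "e l z * hval x z w = (1 + cnj l * (z * e l z) - cnj (\<tau> l) * \<tau> z) * hval x z w"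
    by (rule arg_cong)
  also have "\<dots> = hval x z w + cnj l * (z * (e l z * hval x z w)) - cnj (\<tau> l) * (\<tau> z * hval x z w)"
    by (simp add: algebra_simps)
  finally show "hval (x + cscale (cnj l) (Mz (\<lambda>z. z) (Mz (e l) x)) - cscale (cnj (\<tau> l)) (Mz (\<lambda>z. z) (Mz u x))) z w
      = e l z * hval x z w"
    by (simp only: Mz_u hval_linear[OF zw] hval_Mz[OF Hinf_id zw] hval_Mz[OF Hinf_e[OF l] zw]
        hval_Mz[OF Hinf_\<tau> zw])
qed

text \<open>Multiplication by \<open>e\<^sub>l\<close> tends strongly to the identity as \<open>l\<close> tends to zero, because both corrections in
  \<open>Mz_e\<close> carry a factor that tends to zero.\<close>

lemma closed_under_e_limit:
  assumes K: "closed K" and y: "\<And>l. l \<in> disk - {0} \<Longrightarrow> Mz (e l) y \<in> K"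
  shows "y \<in> K"
proof -
  define l where "l n = complex_of_real (inverse (real (Suc (Suc n))))" for n
  have l: "l n \<in> disk - {0}" "cmod (l n) \<le> 1/2" for n
  proof -
    have "cmod (l n) = inverse (real (Suc (Suc n)))"
      unfolding l_def norm_of_real by simp
    then have "cmod (l n) \<le> 1/2" "0 < cmod (l n)" by (simp_all add: inverse_eq_divide divide_le_eq)
    then show "l n \<in> disk - {0}" "cmod (l n) \<le> 1/2" by auto
  qed
  have l0: "l \<longlonglongrightarrow> 0"
    using tendsto_of_real[OF LIMSEQ_Suc[OF LIMSEQ_inverse_real_of_nat]] unfolding l_def of_real_0 .
  have nz: "norm (Mz (\<lambda>z. z) x) = norm x" for x by (rule isometric_norm[OF isometric_Z])
  have est: "norm (Mz (e (l n)) y - y) \<le> cmod (l n) * norm (Mz (e (l n)) y) + cmod (\<tau> (l n)) * norm y" for n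
  proof -
    have "Mz (e (l n)) y - y = cscale (cnj (l n)) (Mz (\<lambda>z. z) (Mz (e (l n)) y))
      - cscale (cnj (\<tau> (l n))) (Mz (\<lambda>z. z) (Mz u y))"
      using Mz_e[of "l n" y] l(1)[of n] by (simp add: algebra_simps)
    then have "norm (Mz (e (l n)) y - y) \<le> norm (cscale (cnj (l n)) (Mz (\<lambda>z. z) (Mz (e (l n)) y)))
      + norm (cscale (cnj (\<tau> (l n))) (Mz (\<lambda>z. z) (Mz u y)))"
      by (simp only: norm_triangle_ineq4)
    then show ?thesis by (simp add: norm_cscale nz isometric_norm[OF isometric_u])
  qed
  \<comment> \<open>The estimate absorbs its own right-hand side, as the factor \<open>cmod (l n)\<close> is at most one half.\<close>
  have bound: "norm (Mz (e (l n)) y) \<le> 4 * norm y" for n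
  proof -
    have "norm (Mz (e (l n)) y) \<le> norm y + norm (Mz (e (l n)) y - y)"
      using norm_triangle_ineq[of y "Mz (e (l n)) y - y"] by simp
    moreover have "cmod (l n) * norm (Mz (e (l n)) y) \<le> 1/2 * norm (Mz (e (l n)) y)"
      by (intro mult_right_mono l(2)) simp
    moreover have "cmod (\<tau> (l n)) * norm y \<le> 1 * norm y"
      using l(1)[of n] by (intro mult_right_mono \<tau>_le) auto
    ultimately show ?thesis using est[of n] by linarith
  qed
  have "isCont \<tau> 0"
    using Hinf_\<tau> holomorphic_on_imp_continuous_on[of \<tau> disk]
    by (simp add: Hinf_def continuous_on_eq_continuous_at)
  then have \<tau>l: "(\<lambda>n. \<tau> (l n)) \<longlonglongrightarrow> 0"
    using isCont_tendsto_compose[OF _ l0, of \<tau>] by (simp add: \<tau>_0)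
  have "(\<lambda>n. Mz (e (l n)) y) \<longlonglongrightarrow> y"
  proof (rule LIM_zero_cancel, rule Lim_null_comparison)
    have "norm (Mz (e (l n)) y - y) \<le> cmod (l n) * (4 * norm y) + cmod (\<tau> (l n)) * norm y" for n
      using est[of n] mult_left_mono[OF bound[of n], of "cmod (l n)"] by simp
    then show "\<forall>\<^sub>F n in sequentially. norm (Mz (e (l n)) y - y) \<le> cmod (l n) * (4 * norm y) + cmod (\<tau> (l n)) * norm y"
      by simp
    have "(\<lambda>n. cmod (l n) * (4 * norm y) + cmod (\<tau> (l n)) * norm y) \<longlonglongrightarrow> cmod 0 * (4 * norm y) + cmod 0 * norm y"
      by (intro tendsto_intros l0 \<tau>l)
    then show "(\<lambda>n. cmod (l n) * (4 * norm y) + cmod (\<tau> (l n)) * norm y) \<longlonglongrightarrow> 0" by simp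
  qed
  then show ?thesis by (rule closed_sequentially[OF K y[OF l(1)]])
qed

lemma Mz_h: "Mz (h p) x = cscale (1 / d) ((Mz \<theta> ^^ p) x - cscale (cnj a) ((Mz \<theta> ^^ Suc p) x))"
proof (rule mult_opI)
  fix z w assume zw: "z \<in> disk" "w \<in> disk"
  have "hval ((Mz \<theta> ^^ n) x) z w = \<theta> z ^ n * hval x z w" for n
    by (induction n) (simp_all add: hval_Mz[OF Hinf_\<theta> zw])
  then show "hval (cscale (1 / d) ((Mz \<theta> ^^ p) x - cscale (cnj a) ((Mz \<theta> ^^ Suc p) x))) z w = h p z * hval x z w"
    by (simp only: hval_linear[OF zw]) (simp add: h_def field_simps d_nz)
qed

lemma cinner_h:
  assumes "x \<in> eigz \<theta> a" "y \<in> eigz \<theta> a"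
  shows "cinner (Mz (h p) x) (Mz (h q) y) = (if p = q then cinner x y else 0)"
proof -
  have "cinner (Mz (h p) x) (Mz (h q) y)
      = 1 / (d * d) * cinner ((Mz \<theta> ^^ p) x - cscale (cnj a) ((Mz \<theta> ^^ Suc p) x))
          ((Mz \<theta> ^^ q) y - cscale (cnj a) ((Mz \<theta> ^^ Suc q) y))"
    by (simp only: Mz_h cinner_cscale_left cinner_cscale_right) (simp add: cnj_d)
  also have "\<dots> = 1 / (d * d) * (if p = q then d * d * cinner x y else 0)"
    using shifted_eigenvectors_orthogonal[OF bounded_op_Mz[OF Hinf_\<theta>] isometric_\<theta>
        eigzD[OF assms(1)] eigzD[OF assms(2)], of p q] d_sq by simp
  also have "\<dots> = (if p = q then cinner x y else 0)" using d_nz by simp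
  finally show ?thesis .
qed

lemma eigz_\<tau>: "y \<in> eigz \<tau> 0 \<Longrightarrow> y \<in> eigz \<theta> a"
  using eigz_moebius[OF Hinf_\<theta> \<theta>_le a_less, of y] by (simp add: \<tau>_def[abs_def])

text \<open>Subtracting the component along \<open>\<tau> H^2\<close> from a vector that is an eigenvector, such as a kernel, leaves a vector
  orthogonal to \<open>\<tau> H^2\<close>.\<close>

lemma eigz_numerator:
  assumes y: "y \<in> eigz \<tau> (\<tau> l)"
  shows "Mz (\<lambda>z. 1 - cnj (\<tau> l) * \<tau> z) y \<in> eigz \<tau> 0"
  unfolding eigz_def Mz_one_minus[OF Hinf_\<tau>]
  by (simp add: cinner_simps eigzD[OF y] isometricD[OF isometric_\<tau>])

end

locale inner_pair = fst: nonconstant_inner \<theta> + snd: nonconstant_inner \<phi> for \<theta> \<phi> :: "complex \<Rightarrow> complex"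
begin

lemma swap: "inner_pair \<phi> \<theta>"
  by (intro inner_pair.intro fst.nonconstant_inner_axioms snd.nonconstant_inner_axioms)

text \<open>The functions \<open>e\<^sub>l(z) e\<^sub>m(w)\<close> reproduce the values at \<open>(l, m)\<close> of functions that are orthogonal to
  the multiples of \<open>\<tau>(z)\<close> and of \<open>\<sigma>(w)\<close>, where \<open>\<sigma>\<close> belongs to \<open>\<phi>\<close> as \<open>\<tau>\<close> does to \<open>\<theta>\<close>.  They have
  this orthogonality themselves, which gives their mutual inner products.\<close>

definition "\<epsilon> l m = Mz (fst.e l) (Mw (snd.e m) one_h2)"

lemma \<epsilon>_eq:
  assumes lm: "l \<in> disk" "m \<in> disk"
  shows "\<epsilon> l m = Mz (\<lambda>z. 1 - cnj (fst.\<tau> l) * fst.\<tau> z)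
    (Mw (\<lambda>z. 1 - cnj (snd.\<tau> m) * snd.\<tau> z) (kern l m))"
proof (rule hval_ext)
  fix z w assume zw: "z \<in> disk" "w \<in> disk"
  have "hval (\<epsilon> l m) z w = fst.e l z * snd.e m w"
    unfolding \<epsilon>_def hval_Mz[OF fst.Hinf_e[OF lm(1)] zw] hval_Mw[OF snd.Hinf_e[OF lm(2)] zw]
    using zw by (simp add: hval_kern)
  then show "hval (\<epsilon> l m) z w = hval (Mz (\<lambda>z. 1 - cnj (fst.\<tau> l) * fst.\<tau> z)
    (Mw (\<lambda>z. 1 - cnj (snd.\<tau> m) * snd.\<tau> z) (kern l m))) z w"
    unfolding hval_Mz[OF fst.Hinf_num zw] hval_Mw[OF snd.Hinf_num zw] hval_kern[OF lm zw]
    by (simp add: fst.e_def snd.e_def)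
qed

lemma hval_\<epsilon>:
  assumes "l \<in> disk" "m \<in> disk" "z \<in> disk" "w \<in> disk"
  shows "hval (\<epsilon> l m) z w = fst.e l z * snd.e m w"
  unfolding \<epsilon>_def hval_Mz[OF fst.Hinf_e[OF assms(1)] assms(3,4)] hval_Mw[OF snd.Hinf_e[OF assms(2)] assms(3,4)]
  using assms by (simp add: hval_kern)

lemma \<epsilon>_eigz: "l \<in> disk \<Longrightarrow> m \<in> disk \<Longrightarrow> \<epsilon> l m \<in> eigz fst.\<tau> 0"
  unfolding \<epsilon>_eq
  by (intro fst.eigz_numerator eigz_Mw kern_eigz fst.Hinf_\<tau> snd.Hinf_num)

lemma flip_\<epsilon>: "l \<in> disk \<Longrightarrow> m \<in> disk \<Longrightarrow> flip (\<epsilon> l m) = inner_pair.\<epsilon> \<phi> \<theta> m l"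
  by (rule hval_ext) (simp add: hval_flip hval_\<epsilon> inner_pair.hval_\<epsilon>[OF swap])

lemma flip_\<epsilon>_eigz: "l \<in> disk \<Longrightarrow> m \<in> disk \<Longrightarrow> flip (\<epsilon> l m) \<in> eigz snd.\<tau> 0"
  unfolding flip_\<epsilon> by (rule inner_pair.\<epsilon>_eigz[OF swap])

lemma cinner_\<epsilon>:
  assumes lm: "l \<in> disk" "m \<in> disk" and lm': "l' \<in> disk" "m' \<in> disk"
  shows "cinner (\<epsilon> l m) (\<epsilon> l' m') = fst.e l l' * snd.e m m'"
proof -
  define y where "y = Mw (\<lambda>z. 1 - cnj (snd.\<tau> m') * snd.\<tau> z) (kern l' m')"
  have 1: "cinner (\<epsilon> l m) (Mz fst.\<tau> y) = 0"
    by (subst cinner_commute) (simp add: eigzD[OF \<epsilon>_eigz[OF lm]])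
  have "cinner (flip (Mw snd.\<tau> (kern l' m'))) (flip (\<epsilon> l m)) = 0"
    using eigzD[OF flip_\<epsilon>_eigz[OF lm]] by (simp add: Mw_flip[OF snd.Hinf_\<tau>] del: cinner_flip)
  then have 2: "cinner (\<epsilon> l m) (Mw snd.\<tau> (kern l' m')) = 0"
    by (subst cinner_commute) simp
  have "\<epsilon> l' m' = y - cscale (cnj (fst.\<tau> l')) (Mz fst.\<tau> y)"
    unfolding \<epsilon>_eq[OF lm'] y_def by (rule Mz_one_minus[OF fst.Hinf_\<tau>])
  then have "cinner (\<epsilon> l m) (\<epsilon> l' m') = cinner (\<epsilon> l m) y"
    by (simp add: cinner_simps 1)
  also have "\<dots> = cinner (\<epsilon> l m) (kern l' m')"
    unfolding y_def Mw_one_minus[OF snd.Hinf_\<tau>] by (simp add: cinner_simps 2)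
  also have "\<dots> = fst.e l l' * snd.e m m'"
    by (simp only: cinner_kern[OF lm'] hval_\<epsilon>[OF lm lm'])
  finally show ?thesis .
qed

text \<open>The orthogonality in one variable is used twice.  For the first variable it applies because
  multiplication by a function of \<open>w\<close> does not affect being an eigenvector in \<open>z\<close>.\<close>

lemma cinner_hh:
  assumes x: "x \<in> eigz fst.\<tau> 0" "flip x \<in> eigz snd.\<tau> 0" and y: "y \<in> eigz fst.\<tau> 0" "flip y \<in> eigz snd.\<tau> 0"
  shows "cinner (Mz (fst.h p) (Mw (snd.h q) x)) (Mz (fst.h p') (Mw (snd.h q') y))
    = (if (p, q) = (p', q') then cinner x y else 0)"
proof -
  have "cinner (Mz (fst.h p) (Mw (snd.h q) x)) (Mz (fst.h p') (Mw (snd.h q') y))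
      = (if p = p' then cinner (Mw (snd.h q) x) (Mw (snd.h q') y) else 0)"
    by (intro fst.cinner_h eigz_Mw fst.Hinf_\<theta> snd.Hinf_h fst.eigz_\<tau> x y)
  also have "cinner (Mw (snd.h q) x) (Mw (snd.h q') y) = (if q = q' then cinner x y else 0)"
    using snd.cinner_h[OF snd.eigz_\<tau>[OF x(2)] snd.eigz_\<tau>[OF y(2)], of q q']
    by (simp add: Mw_flip[OF snd.Hinf_h])
  finally show ?thesis by simp
qed

definition "v p = Mz (fst.h (Product_Type.fst p)) (Mw (snd.h (Product_Type.snd p)) one_h2)"

lemma one_eq_\<epsilon>: "one_h2 = \<epsilon> 0 0"
  by (rule hval_ext) (simp add: hval_\<epsilon> fst.e_0 snd.e_0 hval_kern)

lemma cinner_v: "cinner (v p) (v q) = (if p = q then 1 else 0)"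
proof -
  have e: "\<epsilon> 0 0 \<in> eigz fst.\<tau> 0" "flip (\<epsilon> 0 0) \<in> eigz snd.\<tau> 0"
    by (simp_all add: \<epsilon>_eigz flip_\<epsilon>_eigz)
  have "cinner (\<epsilon> 0 0) (\<epsilon> 0 0) = 1" by (simp add: cinner_\<epsilon> fst.e_0 snd.e_0)
  then show ?thesis
    unfolding v_def one_eq_\<epsilon> cinner_hh[OF e e] by (simp add: prod_eq_iff)
qed

text \<open>Composition with \<open>\<theta>\<close> and \<open>\<phi>\<close> is not isometric unless both vanish at zero, but it becomes so
  after multiplication by the invertible functions \<open>h\<^sub>0(z)\<close> and \<open>h\<^sub>0(w)\<close>.\<close>

lemma exists_V: "\<exists>V. bounded_op V \<and> isometric V \<and> (\<forall>p. V (hbasis p) = v p) \<and>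
  (\<forall>f. \<forall>z\<in>disk. \<forall>w\<in>disk. hval (V f) z w = fst.h 0 z * snd.h 0 w * hval f (\<theta> z) (\<phi> w))"
proof -
  obtain V where V: "bounded_op V" "isometric V" "\<forall>p. V (hbasis p) = v p"
    and hV: "\<forall>f. \<forall>z\<in>disk. \<forall>w\<in>disk. hval (V f) z w = (\<Sum>\<^sub>\<infinity>p. hcoeff f p * hval (v p) z w)"
    using isometry_from_orthonormal[OF cinner_v] by (elim exE conjE)
  have "hval (V f) z w = fst.h 0 z * snd.h 0 w * hval f (\<theta> z) (\<phi> w)" if zw: "z \<in> disk" "w \<in> disk" for f z w
  proof -
    have "hval (v p) z w = fst.h (Product_Type.fst p) z * snd.h (Product_Type.snd p) w" for p
      unfolding v_def hval_Mz[OF fst.Hinf_h zw] hval_Mw[OF snd.Hinf_h zw] using zw by (simp add: hval_kern)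
    then have "hcoeff f p * hval (v p) z w
        = (fst.h 0 z * snd.h 0 w) * (case p of (m, n) \<Rightarrow> hcoeff f (m, n) * \<theta> z ^ m * \<phi> w ^ n)" for p
      by (simp add: fst.h_power[of "Product_Type.fst p"] snd.h_power[of "Product_Type.snd p"] case_prod_unfold)
    then show ?thesis
      using hV zw unfolding hval_def[of f] by (simp only: infsum_cmult_right')
  qed
  then show ?thesis using V by (intro exI[of _ V]) simp
qed

definition "V = (SOME V. bounded_op V \<and> isometric V \<and> (\<forall>p. V (hbasis p) = v p) \<and>
  (\<forall>f. \<forall>z\<in>disk. \<forall>w\<in>disk. hval (V f) z w = fst.h 0 z * snd.h 0 w * hval f (\<theta> z) (\<phi> w)))"

lemma V: "bounded_op V" "isometric V" "V (hbasis p) = v p"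
  "z \<in> disk \<Longrightarrow> w \<in> disk \<Longrightarrow> hval (V f) z w = fst.h 0 z * snd.h 0 w * hval f (\<theta> z) (\<phi> w)"
proof -
  have V: "bounded_op V \<and> isometric V \<and> (\<forall>p. V (hbasis p) = v p) \<and>
    (\<forall>f. \<forall>z\<in>disk. \<forall>w\<in>disk. hval (V f) z w = fst.h 0 z * snd.h 0 w * hval f (\<theta> z) (\<phi> w))"
    unfolding V_def by (rule someI_ex[OF exists_V])
  show "bounded_op V" "isometric V" using V by simp_all
  show "V (hbasis p) = v p" using V[THEN conjunct2, THEN conjunct2, THEN conjunct1] by (rule spec)
  show "z \<in> disk \<Longrightarrow> w \<in> disk \<Longrightarrow> hval (V f) z w = fst.h 0 z * snd.h 0 w * hval f (\<theta> z) (\<phi> w)"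
    using V by simp
qed

lemma comp_op_V: "comp_op \<theta> \<phi> f = Mz (\<lambda>z. 1 / fst.h 0 z) (Mw (\<lambda>z. 1 / snd.h 0 z) (V f))"
  unfolding comp_op_def
proof (rule hardy2_ofI)
  fix z w assume zw: "z \<in> disk" "w \<in> disk"
  show "hval (Mz (\<lambda>z. 1 / fst.h 0 z) (Mw (\<lambda>z. 1 / snd.h 0 z) (V f))) z w = hval f (\<theta> z) (\<phi> w)"
    unfolding hval_Mz[OF fst.Hinf_inverse_h zw] hval_Mw[OF snd.Hinf_inverse_h zw] V(4)[OF zw]
    using fst.h_0_nz[OF zw(1)] snd.h_0_nz[OF zw(2)] by simp
qed

lemma V_comp_op: "V f = Mz (fst.h 0) (Mw (snd.h 0) (comp_op \<theta> \<phi> f))"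
proof (rule hval_ext)
  fix z w assume zw: "z \<in> disk" "w \<in> disk"
  show "hval (V f) z w = hval (Mz (fst.h 0) (Mw (snd.h 0) (comp_op \<theta> \<phi> f))) z w"
    unfolding comp_op_V hval_Mz[OF fst.Hinf_h zw] hval_Mw[OF snd.Hinf_h zw]
      hval_Mz[OF fst.Hinf_inverse_h zw] hval_Mw[OF snd.Hinf_inverse_h zw]
    using fst.h_0_nz[OF zw(1)] snd.h_0_nz[OF zw(2)] by simp
qed

text \<open>The reason for evaluating the invariants of \<open>M\<close> at \<open>(\<theta>(0), \<phi>(0))\<close>: the embedding turns multiplication by the
  automorphism at that point into multiplication by a function that vanishes at the origin.\<close>

lemma V_moebius:
  "V (Mz (moebius fst.a) x) = Mz fst.\<tau> (V x)" "V (Mw (moebius snd.a) x) = Mw snd.\<tau> (V x)"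
proof -
  have H: "Hinf (moebius fst.a)" "Hinf (moebius snd.a)"
    using Hinf_moebius[OF Hinf_id _ fst.a_less] Hinf_moebius[OF Hinf_id _ snd.a_less] by auto
  show "V (Mz (moebius fst.a) x) = Mz fst.\<tau> (V x)"
    by (rule hval_ext)
       (simp only: V(4) hval_Mz[OF fst.Hinf_\<tau>] hval_Mz[OF H(1) fst.\<theta>_disk snd.\<theta>_disk], simp add: fst.\<tau>_def)
  show "V (Mw (moebius snd.a) x) = Mw snd.\<tau> (V x)"
    by (rule hval_ext)
       (simp only: V(4) hval_Mw[OF snd.Hinf_\<tau>] hval_Mw[OF H(2) fst.\<theta>_disk snd.\<theta>_disk], simp add: snd.\<tau>_def)
qed

text \<open>It suffices to check this on monomials, whose images are the functions \<open>h\<^sub>p(z) h\<^sub>q(w)\<close>.\<close>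

lemma cinner_EFV:
  assumes lm: "l \<in> disk" "m \<in> disk" and lm': "l' \<in> disk" "m' \<in> disk"
  shows "cinner (Mz (fst.e l) (Mw (snd.e m) (V x))) (Mz (fst.e l') (Mw (snd.e m') (V y)))
    = fst.e l l' * snd.e m m' * cinner x y"
proof (rule gram_extension)
  have b: "bounded_op (\<lambda>x. Mz (fst.e l) (Mw (snd.e m) (V x)))" if "l \<in> disk" "m \<in> disk" for l m
    by (intro bounded_op_compose[OF bounded_op_Mz[OF fst.Hinf_e[OF that(1)]]]
        bounded_op_compose[OF bounded_op_Mw[OF snd.Hinf_e[OF that(2)]] V(1)])
  show "bounded_op (\<lambda>x. Mz (fst.e l) (Mw (snd.e m) (V x)))" by (rule b[OF lm])
  show "bounded_op (\<lambda>x. Mz (fst.e l') (Mw (snd.e m') (V x)))" by (rule b[OF lm'])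
  have ev: "Mz (fst.e l) (Mw (snd.e m) (v p)) = Mz (fst.h (Product_Type.fst p)) (Mw (snd.h (Product_Type.snd p)) (\<epsilon> l m))"
    if "l \<in> disk" "m \<in> disk" for l m p
    by (rule hval_ext)
       (simp only: v_def \<epsilon>_def hval_Mz[OF fst.Hinf_h] hval_Mw[OF snd.Hinf_h] hval_Mz[OF fst.Hinf_e[OF that(1)]]
          hval_Mw[OF snd.Hinf_e[OF that(2)]] mult.left_commute)
  show "cinner (Mz (fst.e l) (Mw (snd.e m) (V (hbasis p)))) (Mz (fst.e l') (Mw (snd.e m') (V (hbasis q))))
    = (if p = q then fst.e l l' * snd.e m m' else 0)" for p q
    unfolding V(3) ev[OF lm] ev[OF lm'] cinner_hh[OF \<epsilon>_eigz[OF lm] flip_\<epsilon>_eigz[OF lm] \<epsilon>_eigz[OF lm'] flip_\<epsilon>_eigz[OF lm']]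
    by (simp add: cinner_\<epsilon>[OF lm lm'] prod_eq_iff)
qed

end

section \<open>Generated submodules\<close>

lemma polynomial_multiple_in:
  assumes K: "closed_subspace K" and Z: "\<And>x. x \<in> K \<Longrightarrow> R_z x \<in> K" and W: "\<And>x. x \<in> K \<Longrightarrow> R_w x \<in> K"
    and f: "f \<in> K"
  shows "mult_op (poly2_val p) f \<in> K"
    and "z \<in> disk \<Longrightarrow> w \<in> disk \<Longrightarrow> hval (mult_op (poly2_val p) f) z w = poly2_val p z w * hval f z w"
proof -
  have one: "\<exists>g\<in>K. \<forall>z\<in>disk. \<forall>w\<in>disk. hval g z w = poly c z * hval f z w" for c
  proof (induction c)
    case 0
    have "hval 0 z w = 0" if "z \<in> disk" "w \<in> disk" for z w
      using cinner_kern[OF that, of 0] by simp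
    then show ?case using closed_subspaceD(1)[OF K] by (intro bexI[of _ 0]) simp_all
  next
    case (pCons a c)
    then obtain g where g: "g \<in> K" "\<forall>z\<in>disk. \<forall>w\<in>disk. hval g z w = poly c z * hval f z w" by blast
    have "cscale a f + R_z g \<in> K"
      by (intro closed_subspaceD(2,3)[OF K] Z f g(1))
    moreover have "hval (cscale a f + R_z g) z w = poly (pCons a c) z * hval f z w"
      if zw: "z \<in> disk" "w \<in> disk" for z w
      unfolding hval_linear[OF zw] hval_Mz[OF Hinf_id zw] using g(2) zw by (simp add: algebra_simps)
    ultimately show ?case by (intro bexI[of _ "cscale a f + R_z g"]) simp_all
  qed
  have "\<exists>g\<in>K. \<forall>z\<in>disk. \<forall>w\<in>disk. hval g z w = poly2_val p z w * hval f z w"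
  proof (induction p)
    case 0
    then show ?case using one[of 0] by (simp add: poly2_val_def)
  next
    case (pCons c p)
    then obtain g where g: "g \<in> K" "\<forall>z\<in>disk. \<forall>w\<in>disk. hval g z w = poly2_val p z w * hval f z w" by blast
    obtain g' where g': "g' \<in> K" "\<forall>z\<in>disk. \<forall>w\<in>disk. hval g' z w = poly c z * hval f z w"
      using one[of c] by blast
    have "g' + R_w g \<in> K" by (intro closed_subspaceD(2)[OF K] W g(1) g'(1))
    moreover have "hval (g' + R_w g) z w = poly2_val (pCons c p) z w * hval f z w"
      if zw: "z \<in> disk" "w \<in> disk" for z w
      unfolding hval_linear[OF zw] hval_Mw[OF Hinf_id zw] using g(2) g'(2) zw
      by (simp add: poly2_val_def algebra_simps)
    ultimately show ?case by (intro bexI[of _ "g' + R_w g"]) simp_all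
  qed
  then obtain g where g: "g \<in> K" "\<forall>z\<in>disk. \<forall>w\<in>disk. hval g z w = poly2_val p z w * hval f z w" by blast
  have "mult_op (poly2_val p) f = g" by (rule mult_opI) (use g(2) in simp)
  then show "mult_op (poly2_val p) f \<in> K"
    "z \<in> disk \<Longrightarrow> w \<in> disk \<Longrightarrow> hval (mult_op (poly2_val p) f) z w = poly2_val p z w * hval f z w"
    using g by simp_all
qed

lemma hval_mult_poly2:
  "z \<in> disk \<Longrightarrow> w \<in> disk \<Longrightarrow> hval (mult_op (poly2_val p) f) z w = poly2_val p z w * hval f z w"
  by (rule polynomial_multiple_in(2)[OF closed_subspace_UNIV]) simp_all

lemma generated_submodule:
  shows "closed_subspace (generated_submodule X)"
    and "f \<in> X \<Longrightarrow> f \<in> generated_submodule X"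
    and "x \<in> generated_submodule X \<Longrightarrow> R_z x \<in> generated_submodule X"
    and "x \<in> generated_submodule X \<Longrightarrow> R_w x \<in> generated_submodule X"
    and "closed_subspace K \<Longrightarrow> (\<And>x. x \<in> K \<Longrightarrow> R_z x \<in> K) \<Longrightarrow> (\<And>x. x \<in> K \<Longrightarrow> R_w x \<in> K)
      \<Longrightarrow> X \<subseteq> K \<Longrightarrow> generated_submodule X \<subseteq> K"
proof -
  define G where "G = {mult_op (poly2_val p) f |p f. f \<in> X}"
  have N: "generated_submodule X = closure (h2_span G)"
    by (simp add: generated_submodule_def G_def)
  show cs: "closed_subspace (generated_submodule X)"
    unfolding N by (rule closed_subspace_closure_span)
  have GN: "mult_op (poly2_val p) f \<in> generated_submodule X" if "f \<in> X" for p f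
    unfolding N by (rule in_closure_span) (use that in \<open>auto simp: G_def\<close>)
  show "f \<in> generated_submodule X" if "f \<in> X"
  proof -
    have "mult_op (poly2_val 1) f = f" by (rule mult_opI) (simp add: poly2_val_def)
    then show ?thesis using GN[OF that, of 1] by simp
  qed
  have "generated_submodule X \<subseteq> {x. R_z x \<in> generated_submodule X}"
  proof (subst (1) N, rule closed_subspaceD(7)[OF closed_subspace_vimage[OF bounded_op_Mz[OF Hinf_id] cs]])
    have "R_z (mult_op (poly2_val p) f) = mult_op (poly2_val ([:[:0, 1:]:] * p)) f" for p f
      by (rule mult_opI[symmetric, THEN sym])
         (simp add: hval_Mz[OF Hinf_id] hval_mult_poly2 poly2_val_def)
    then show "G \<subseteq> {x. R_z x \<in> generated_submodule X}" using GN by (auto simp: G_def)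
  qed
  then show "x \<in> generated_submodule X \<Longrightarrow> R_z x \<in> generated_submodule X" by blast
  have "generated_submodule X \<subseteq> {x. R_w x \<in> generated_submodule X}"
  proof (subst (1) N, rule closed_subspaceD(7)[OF closed_subspace_vimage[OF bounded_op_Mw[OF Hinf_id] cs]])
    have "R_w (mult_op (poly2_val p) f) = mult_op (poly2_val (pCons 0 p)) f" for p f
      by (rule hval_ext) (simp add: hval_Mw[OF Hinf_id] hval_mult_poly2 poly2_val_def)
    then show "G \<subseteq> {x. R_w x \<in> generated_submodule X}" using GN by (auto simp: G_def)
  qed
  then show "x \<in> generated_submodule X \<Longrightarrow> R_w x \<in> generated_submodule X" by blast
  show "generated_submodule X \<subseteq> K"
    if K: "closed_subspace K" "\<And>x. x \<in> K \<Longrightarrow> R_z x \<in> K" "\<And>x. x \<in> K \<Longrightarrow> R_w x \<in> K" "X \<subseteq> K"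
    unfolding N
  proof (rule closed_subspaceD(7)[OF K(1)])
    show "G \<subseteq> K" unfolding G_def using polynomial_multiple_in(1)[OF K(1-3)] K(4) by blast
  qed
qed

lemma submodule_closed_subspace: "submodule M \<Longrightarrow> closed_subspace M"
  by (simp add: submodule_def closed_subspace_def)

context inner_pair begin

lemma closed_under_e_limit_w:
  assumes K: "closed_subspace K" and y: "\<And>m. m \<in> disk - {0} \<Longrightarrow> Mw (snd.e m) y \<in> K"
  shows "y \<in> K"
proof -
  have "flip y \<in> {x. flip x \<in> K}"
  proof (rule snd.closed_under_e_limit)
    show "closed {x. flip x \<in> K}"
      by (rule closed_subspaceD(6)[OF closed_subspace_vimage[OF bounded_op_flip K]])
    fix m :: complex assume m: "m \<in> disk - {0}"
    then show "Mz (snd.e m) (flip y) \<in> {x. flip x \<in> K}"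
      using y[OF m] Mw_flip[OF snd.Hinf_e, of m y] by simp
  qed
  then show ?thesis by simp
qed

lemma Mw_e:
  assumes m: "m \<in> disk"
  shows "Mw (snd.e m) x = x + cscale (cnj m) (Mw (\<lambda>z. z) (Mw (snd.e m) x))
    - cscale (cnj (snd.\<tau> m)) (Mw (\<lambda>z. z) (Mw snd.u x))"
proof -
  have "flip (Mz (snd.e m) (flip x)) = flip (flip x + cscale (cnj m) (Mz (\<lambda>z. z) (Mz (snd.e m) (flip x)))
    - cscale (cnj (snd.\<tau> m)) (Mz (\<lambda>z. z) (Mz snd.u (flip x))))"
    by (rule arg_cong[OF snd.Mz_e[OF m]])
  also have "\<dots> = x + cscale (cnj m) (flip (Mz (\<lambda>z. z) (Mz (snd.e m) (flip x))))
    - cscale (cnj (snd.\<tau> m)) (flip (Mz (\<lambda>z. z) (Mz snd.u (flip x))))"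
    by (simp only: bounded_opD[OF bounded_op_flip] flip_flip)
  finally show ?thesis
    unfolding Mw_flip[OF snd.Hinf_e[OF m]] Mw_flip[OF Hinf_id] Mw_flip[OF snd.Hinf_u] flip_flip .
qed

lemma Mw_u: "Mw (\<lambda>z. z) (Mw snd.u x) = Mw snd.\<tau> x"
  by (simp add: Mw_flip[OF snd.Hinf_u] Mw_flip[OF Hinf_id] Mw_flip[OF snd.Hinf_\<tau>] snd.Mz_u)

lemma Hinf_moebius_a: "Hinf (moebius fst.a)" "Hinf (moebius snd.a)"
  using Hinf_moebius[OF Hinf_id _ fst.a_less] Hinf_moebius[OF Hinf_id _ snd.a_less] by auto

lemma isometric_moebius_a: "isometric (Mz (moebius fst.a))" "isometric (Mw (moebius snd.a))"
  using isometric_Mz_moebius[OF Hinf_id _ isometric_Z fst.a_less]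
    isometric_Mw[OF Hinf_moebius_a(2)] isometric_Mz_moebius[OF Hinf_id _ isometric_Z snd.a_less] by auto

definition test_vectors :: "hardy2 set \<Rightarrow> hardy2 set" where
  "test_vectors M = {Mz (fst.e l) (Mw (snd.e m) (V x)) | l m x. l \<in> disk - {0} \<and> m \<in> disk - {0} \<and> x \<in> M}"

text \<open>The generated submodule is invariant under all bounded multipliers, hence contains the test
  vectors.  Conversely the closed span of the test vectors is invariant: multiplying a test vector by
  \<open>z\<close> yields, by \<open>Mz_e\<close>, test vectors and limits of test vectors in which the first kernel is replaced
  by the constant \<open>1\<close>, where an excess factor \<open>\<tau>(z)\<close> is absorbed into \<open>M\<close>.\<close>

lemma generated_eq:
  assumes M: "submodule M"
  shows "generated_submodule (comp_op \<theta> \<phi> ` M) = closure (h2_span (test_vectors M))" (is "?N = ?K")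
proof (rule antisym)
  have cM: "closed_subspace M" by (rule submodule_closed_subspace[OF M])
  have ZM: "R_z x \<in> M" "R_w x \<in> M" if "x \<in> M" for x
    using M that by (auto simp: submodule_def)
  note N = generated_submodule[where X = "comp_op \<theta> \<phi> ` M"]
  have Nz: "Mz \<psi> x \<in> ?N" if "Hinf \<psi>" "x \<in> ?N" for \<psi> x
    by (rule Mz_invariant[OF N(1,3) that])
  have Nw: "Mw \<psi> x \<in> ?N" if "Hinf \<psi>" "x \<in> ?N" for \<psi> x
    by (rule Mw_invariant[OF N(1,4) that])
  have K: "closed_subspace ?K" by (rule closed_subspace_closure_span)
  have VN: "V x \<in> ?N" if "x \<in> M" for x
    unfolding V_comp_op by (intro Nz Nw fst.Hinf_h snd.Hinf_h N(2) imageI that)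
  show "?K \<subseteq> ?N"
  proof (rule closed_subspaceD(7)[OF N(1)])
    show "test_vectors M \<subseteq> ?N"
      unfolding test_vectors_def by (auto intro!: Nz Nw fst.Hinf_e snd.Hinf_e VN)
  qed
  have EFV: "Mz (fst.e l) (Mw (snd.e m) (V x)) \<in> ?K" if "l \<in> disk - {0}" "m \<in> disk - {0}" "x \<in> M" for l m x
    by (rule in_closure_span) (use that in \<open>auto simp: test_vectors_def\<close>)
  have FV: "Mw (snd.e m) (V x) \<in> ?K" if "m \<in> disk - {0}" "x \<in> M" for m x
    by (rule fst.closed_under_e_limit[OF closed_subspaceD(6)[OF K]]) (rule EFV[OF _ that])
  have EV: "Mz (fst.e l) (V x) \<in> ?K" if l: "l \<in> disk - {0}" and x: "x \<in> M" for l x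
  proof (rule closed_under_e_limit_w[OF K])
    fix m :: complex assume m: "m \<in> disk - {0}"
    show "Mw (snd.e m) (Mz (fst.e l) (V x)) \<in> ?K"
      using EFV[OF l m x] l m Mz_Mw[OF fst.Hinf_e snd.Hinf_e, of l m "V x"] by simp
  qed
  have VK: "V x \<in> ?K" if "x \<in> M" for x
    by (rule closed_under_e_limit_w[OF K]) (rule FV[OF _ that])
  have AM: "Mz (moebius fst.a) x \<in> M" "Mw (moebius snd.a) x \<in> M" if "x \<in> M" for x
    using Mz_invariant[OF cM ZM(1) Hinf_moebius_a(1) that] Mw_invariant[OF cM ZM(2) Hinf_moebius_a(2) that] by auto
  have KZ: "?K \<subseteq> {x. R_z x \<in> ?K}"
  proof (rule closed_subspaceD(7)[OF closed_subspace_vimage[OF bounded_op_Mz[OF Hinf_id] K]])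
    show "test_vectors M \<subseteq> {x. R_z x \<in> ?K}"
    proof
      fix g assume "g \<in> test_vectors M"
      then obtain l m x where g: "g = Mz (fst.e l) (Mw (snd.e m) (V x))"
        and l: "l \<in> disk - {0}" and m: "m \<in> disk - {0}" and x: "x \<in> M"
        by (auto simp: test_vectors_def)
      define y where "y = Mw (snd.e m) (V x)"
      have ld: "l \<in> disk" and md: "m \<in> disk" using l m by auto
      have "R_z (Mz fst.u y) = Mw (snd.e m) (V (Mz (moebius fst.a) x))"
        unfolding y_def fst.Mz_u V_moebius by (rule Mz_Mw[OF fst.Hinf_\<tau> snd.Hinf_e[OF md]])
      then have "R_z (Mz fst.u y) \<in> ?K" using FV[OF m AM(1)[OF x]] by simp
      moreover have "cscale (cnj l) (R_z g) = g - y + cscale (cnj (fst.\<tau> l)) (R_z (Mz fst.u y))"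
        using fst.Mz_e[OF ld, of y] by (simp add: g y_def algebra_simps)
      ultimately have 1: "cscale (cnj l) (R_z g) \<in> ?K"
        using EFV[OF l m x] FV[OF m x] unfolding g y_def
        by (simp only:) (intro closed_subspaceD(2-4)[OF K])
      have "R_z g = cscale (1 / cnj l) (cscale (cnj l) (R_z g))" using l by simp
      also have "\<dots> \<in> ?K" by (rule closed_subspaceD(3)[OF K 1])
      finally show "g \<in> {x. R_z x \<in> ?K}" by simp
    qed
  qed
  have KW: "?K \<subseteq> {x. R_w x \<in> ?K}"
  proof (rule closed_subspaceD(7)[OF closed_subspace_vimage[OF bounded_op_Mw[OF Hinf_id] K]])
    show "test_vectors M \<subseteq> {x. R_w x \<in> ?K}"
    proof
      fix g assume "g \<in> test_vectors M"
      then obtain l m x where g0: "g = Mz (fst.e l) (Mw (snd.e m) (V x))"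
        and l: "l \<in> disk - {0}" and m: "m \<in> disk - {0}" and x: "x \<in> M"
        by (auto simp: test_vectors_def)
      define y where "y = Mz (fst.e l) (V x)"
      have ld: "l \<in> disk" and md: "m \<in> disk" using l m by auto
      have g: "g = Mw (snd.e m) y"
        unfolding g0 y_def by (rule Mz_Mw[OF fst.Hinf_e[OF ld] snd.Hinf_e[OF md]])
      have "R_w (Mw snd.u y) = Mz (fst.e l) (V (Mw (moebius snd.a) x))"
        unfolding y_def Mw_u V_moebius by (rule Mz_Mw[OF fst.Hinf_e[OF ld] snd.Hinf_\<tau>, symmetric])
      then have "R_w (Mw snd.u y) \<in> ?K" using EV[OF l AM(2)[OF x]] by simp
      moreover have "cscale (cnj m) (R_w g) = g - y + cscale (cnj (snd.\<tau> m)) (R_w (Mw snd.u y))"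
        using Mw_e[OF md, of y] by (simp add: g algebra_simps)
      moreover have "g \<in> ?K" unfolding g0 by (rule EFV[OF l m x])
      moreover have "y \<in> ?K" unfolding y_def by (rule EV[OF l x])
      ultimately have 1: "cscale (cnj m) (R_w g) \<in> ?K"
        by (simp only:) (intro closed_subspaceD(2-4)[OF K])
      have "R_w g = cscale (1 / cnj m) (cscale (cnj m) (R_w g))" using m by simp
      also have "\<dots> \<in> ?K" by (rule closed_subspaceD(3)[OF K 1])
      finally show "g \<in> {x. R_w x \<in> ?K}" by simp
    qed
  qed
  have KZ': "R_z x \<in> ?K" and KW': "R_w x \<in> ?K" if "x \<in> ?K" for x using KZ KW that by auto
  show "?N \<subseteq> ?K"
  proof (rule N(5)[OF K KZ' KW'])
    show "comp_op \<theta> \<phi> ` M \<subseteq> ?K"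
    proof (rule image_subsetI)
      fix x assume x: "x \<in> M"
      show "comp_op \<theta> \<phi> x \<in> ?K"
        unfolding comp_op_V
        by (intro Mz_invariant[OF K KZ'] Mw_invariant[OF K KW'] fst.Hinf_inverse_h snd.Hinf_inverse_h VK x)
    qed
  qed
qed

lemma amplification_generated:
  assumes M: "submodule M"
  shows "amplification M (generated_submodule (comp_op \<theta> \<phi> ` M)) R_z (Mz fst.u) (Mz (moebius fst.a))
    R_w (Mw snd.u) (Mw (moebius snd.a)) V (\<lambda>l. Mz (fst.e l)) (\<lambda>m. Mw (snd.e m)) fst.\<tau> snd.\<tau> fst.e snd.e"
proof -
  have cM: "closed_subspace M" by (rule submodule_closed_subspace[OF M])
  have ZM: "R_z x \<in> M" "R_w x \<in> M" if "x \<in> M" for x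
    using M that by (auto simp: submodule_def)
  note N = generated_submodule[where X = "comp_op \<theta> \<phi> ` M"]
  have Nz: "Mz \<psi> x \<in> generated_submodule (comp_op \<theta> \<phi> ` M)" if "Hinf \<psi>" "x \<in> generated_submodule (comp_op \<theta> \<phi> ` M)" for \<psi> x
    by (rule Mz_invariant[OF N(1,3) that])
  have Nw: "Mw \<psi> x \<in> generated_submodule (comp_op \<theta> \<phi> ` M)" if "Hinf \<psi>" "x \<in> generated_submodule (comp_op \<theta> \<phi> ` M)" for \<psi> x
    by (rule Mw_invariant[OF N(1,4) that])
  show ?thesis
  proof unfold_locales
    show "V x \<in> generated_submodule (comp_op \<theta> \<phi> ` M)" if "x \<in> M" for x
      unfolding V_comp_op by (intro Nz Nw fst.Hinf_h snd.Hinf_h N(2) imageI that)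
    show "Mz (fst.e 0) x = x" for x by (rule mult_opI) (simp add: fst.e_0)
    show "Mw (snd.e 0) x = x" for x by (rule mult_opI) (simp add: snd.e_0)
    show "fst.e l 0 = 1" "fst.e 0 l = 1" if "l \<in> disk" for l using that by (simp_all add: fst.e_0)
    show "snd.e l 0 = 1" "snd.e 0 l = 1" if "l \<in> disk" for l using that by (simp_all add: snd.e_0)
    show "generated_submodule (comp_op \<theta> \<phi> ` M) = closure (h2_span
      {Mz (fst.e l) (Mw (snd.e m) (V x)) | l m x. l \<in> disk - {0} \<and> m \<in> disk - {0} \<and> x \<in> M})"
      unfolding generated_eq[OF M] test_vectors_def ..
    show "R_z (Mz fst.u (V x)) = V (Mz (moebius fst.a) x)" for x by (simp add: fst.Mz_u V_moebius)
    show "R_w (Mw snd.u (V x)) = V (Mw (moebius snd.a) x)" for x by (simp add: Mw_u V_moebius)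
    show "Mz (moebius fst.a) x \<in> M" "Mw (moebius snd.a) x \<in> M" if "x \<in> M" for x
      by (rule Mz_invariant[OF cM ZM(1) Hinf_moebius_a(1) that], assumption)
         (rule Mw_invariant[OF cM ZM(2) Hinf_moebius_a(2) that], assumption)
  qed (assumption | rule cM isometric_moebius_a V bounded_op_Mz bounded_op_Mw Hinf_moebius_a Hinf_id fst.Hinf_u snd.Hinf_u
      fst.Hinf_e snd.Hinf_e isometric_Z isometric_W fst.isometric_u isometric_Mw snd.isometric_u
      Nz Nw Mz_Mw Mz_Mw[symmetric] fst.Mz_e Mw_e cinner_EFV)+
qed

end

section \<open>The numerical invariants\<close>

text \<open>At the origin the automorphism is \<open>- z\<close> rather than \<open>z\<close>; the two signs in a commutator cancel.\<close>

lemma commutator_adj_uminus: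
  assumes A: "bounded_op A" and B: "bounded_op B" and N: "closed_subspace N"
  shows "commutator (adj_on N (\<lambda>x. - A x)) (\<lambda>x. - B x) = commutator (adj_on N A) B"
proof -
  have A': "bounded_op (\<lambda>x. - A x)"
    using A by (auto simp: bounded_op_def)
  have adj: "adj_on N (\<lambda>x. - A x) f = - adj_on N A f" for f
    by (rule adj_on(3)[OF A' N])
       (simp_all add: closed_subspaceD(5)[OF N] adj_on(1,2)[OF A N] cinner_simps)
  have "adj_on N A (- f) = - adj_on N A f" for f
    using adj_on_linear(2)[OF A N, of 0 f] adj_on_linear(2)[OF A N, of 0 0] by simp
  then show ?thesis by (simp add: commutator_def adj fun_eq_iff bounded_opD[OF B])
qed

lemma R_moebius_zero: "R_moebius_z 0 = (\<lambda>x. - R_z x)" "R_moebius_w 0 = (\<lambda>x. - R_w x)"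
proof -
  have m: "hval (- f) z w = - hval f z w" if "z \<in> disk" "w \<in> disk" for f z w
    using that by (simp add: cinner_kern[symmetric] cinner_minus_left)
  show "R_moebius_z 0 = (\<lambda>x. - R_z x)"
    by (rule ext, rule mult_opI) (simp add: m hval_Mz[OF Hinf_id] moebius_def)
  show "R_moebius_w 0 = (\<lambda>x. - R_w x)"
    by (rule ext, rule mult_opI) (simp add: m hval_Mw[OF Hinf_id] moebius_def)
qed

theorem theorem4p1:
  fixes \<theta> \<phi> :: "complex \<Rightarrow> complex" and M :: "hardy2 set"
  assumes "inner_function \<theta>" and "\<not> \<theta> constant_on disk"
    and "inner_function \<phi>" and "\<not> \<phi> constant_on disk"
    and "hilbert_schmidt_submodule M"
  shows "let N = generated_submodule (comp_op \<theta> \<phi> ` M) in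
    Sigma0 N 0 0 = Sigma0 M (\<theta> 0) (\<phi> 0) \<and>
    Sigma1 N 0 0 = Sigma1 M (\<theta> 0) (\<phi> 0) \<and>
    hs_norm_sq UNIV (core_operator N) = Sigma0 M (\<theta> 0) (\<phi> 0) + Sigma1 M (\<theta> 0) (\<phi> 0)"
proof -
  interpret inner_pair \<theta> \<phi>
    using assms by (intro inner_pair.intro nonconstant_inner.intro)
  have M: "submodule M" using assms(5) by (simp add: hilbert_schmidt_submodule_def)
  define N where "N = generated_submodule (comp_op \<theta> \<phi> ` M)"
  interpret amplification M N R_z "Mz fst.u" "Mz (moebius fst.a)" R_w "Mw snd.u" "Mw (moebius snd.a)" V
    "\<lambda>l. Mz (fst.e l)" "\<lambda>m. Mw (snd.e m)" fst.\<tau> snd.\<tau> fst.e snd.e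
    unfolding N_def by (rule amplification_generated[OF M])
  have S0: "Sigma0 N 0 0 = hs_norm_sq N (commutator (adj_on N R_z) R_z \<circ> commutator (adj_on N R_w) R_w)"
    and S1: "Sigma1 N 0 0 = hs_norm_sq N (commutator (adj_on N R_z) R_w)"
    unfolding Sigma0_def Sigma1_def R_moebius_zero commutator_adj_uminus[OF Z(1) Z(1) N]
      commutator_adj_uminus[OF W(1) W(1) N] commutator_adj_uminus[OF Z(1) W(1) N]
    by (rule refl)+
  have 0: "Sigma0 N 0 0 = Sigma0 M (\<theta> 0) (\<phi> 0)"
    unfolding S0 hs_norm_sq_defects by (simp add: Sigma0_def fst.a_def snd.a_def)
  have 1: "Sigma1 N 0 0 = Sigma1 M (\<theta> 0) (\<phi> 0)"
    unfolding S1 hs_norm_sq_cross by (simp add: Sigma1_def fst.a_def snd.a_def)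
  have "core_operator N = (\<lambda>f. let g = ortho_proj N f in g - R_z (adj_on N R_z g) - R_w (adj_on N R_w g)
           + R_z (R_w (adj_on N R_z (adj_on N R_w g))))"
    by (rule ext) (rule core_operator_def)
  then have "hs_norm_sq UNIV (core_operator N) = Sigma0 N 0 0 + Sigma1 N 0 0"
    unfolding S0 S1 using hs_norm_sq_alternating_sum[OF N Z W] by simp
  then show ?thesis using 0 1 by (simp add: Let_def N_def)
qed

end
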